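(* Let $P$ be a probability distribution on $\mathbb N$ with $P(1)<1$, let $n_o\sim P$, and assume $\mathbb E[e^{\theta n_o}]<\infty$ for some $\theta>0$. Consider the Erlang Weighted Tree with potential degree distribution $P$. If $\beta_0>1$, then the probability of extinction is less than $1$. If $\beta_0\le1$, then the probability of extinction equals $1$.
   Context: $\mathbb N=\{1,2,\dots\}$, $\mathbb Z_+=\{0,1,\dots\}$, $\mathbb R_+=[0,\infty)$. $\mathrm{Erlang}(k)$ has density $e^{-x}x^{k-1}/(k-1)!$. **Erlang Weighted Tree (EWT).** Let $\mathbb N^f=\bigcup_{i\ge0}\mathbb N^i$, $\mathbb N^0=\{o\}$, $\widehat P(k)=P(k+1)$. Independently over $\boldsymbol i\in\mathbb N^f$: $n_o\sim P$, $n_{\boldsymbol i}\sim\widehat P$ for $\boldsymbol i\ne o$; given $n_{\boldsymbol i}$, $v_{\boldsymbol i}\sim\mathrm{Erlang}(n_{\boldsymbol i}+1)$; given $(n_{\boldsymbol i},v_{\boldsymbol i})$, the costs $\zeta_{(\boldsymbol i,1)},\dots,\zeta_{(\boldsymbol i,n_{\boldsymbol i})}$ are i.i.d. uniform on $[0,v_{\boldsymbol i}]$. The backbone tree is the component of $o$ in the graph with edges $\{\boldsymbol i,(\boldsymbol i,j)\}$, $1\le j\le n_{\boldsymbol i}$. The EWT is the component of the root $o$ after keeping $\{\boldsymbol i,(\boldsymbol i,j)\}$ iff $\zeta_{(\boldsymbol i,j)}<v_{(\boldsymbol i,j)}$. $Z_l$ is the number of its vertices at distance $l$ from $o$; the probability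 of extinction is $\mathbb P(\bigcup_{l\ge1}\{Z_l=0\})$. **$\beta_0$.** $g_2(x)=e^{-x}\sum_{k=2}^\infty P(k)\frac{x^{k-2}}{(k-2)!}$; $G_0\equiv1$, $G_i(x)=\int_{y=x}^\infty\int_{z=y}^\infty g_2(z)G_{i-1}(z)\,dz\,dy$ for $i\ge1$; $L(\beta,x)=\sum_{i\ge0}G_i(x)(-1/\beta)^i$. $\beta_0$ is the largest $\beta>0$ with $L(\beta,0)=0$. *)

theory Defs
  imports "HOL-Probability.Probability"
begin

text \<open>Vertices are finite words over the positive integers; the root is the empty word and the
  \<open>j\<close>-th potential child of \<open>i\<close> is \<open>i @ [j]\<close>, \<open>j \<ge> 1\<close>.\<close>

type_synonym vertex = "nat list"

definition vertices :: "vertex set" where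
  "vertices = {i. 0 \<notin> set i}"

text \<open>Undirected graphs are given by symmetric edge relations.\<close>

definition component :: "('a \<times> 'a) set \<Rightarrow> 'a \<Rightarrow> 'a set" where
  "component E r = E\<^sup>* `` {r}"

definition graph_dist :: "('a \<times> 'a) set \<Rightarrow> 'a \<Rightarrow> 'a \<Rightarrow> nat" where
  "graph_dist E x y = (LEAST l. (x, y) \<in> E ^^ l)"

definition backbone_edges :: "(vertex \<Rightarrow> nat) \<Rightarrow> (vertex \<times> vertex) set" where
  "backbone_edges n =
     (let D = {(i, i @ [j]) | i j. i \<in> vertices \<and> 1 \<le> j \<and> j \<le> n i} in D \<union> D\<inverse>)"

definition backbone_tree :: "(vertex \<Rightarrow> nat) \<Rightarrow> vertex set" where
  "backbone_tree n = component (backbone_edges n) []"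

definition ewt_edges ::
  "(vertex \<Rightarrow> nat) \<Rightarrow> (vertex \<Rightarrow> real) \<Rightarrow> (vertex \<Rightarrow> real) \<Rightarrow> (vertex \<times> vertex) set" where
  "ewt_edges n v \<zeta> =
     (let D = {(i, i @ [j]) | i j.
                 i \<in> backbone_tree n \<and> 1 \<le> j \<and> j \<le> n i \<and> \<zeta> (i @ [j]) < v (i @ [j])}
      in D \<union> D\<inverse>)"

definition ewt :: "(vertex \<Rightarrow> nat) \<Rightarrow> (vertex \<Rightarrow> real) \<Rightarrow> (vertex \<Rightarrow> real) \<Rightarrow> vertex set" where
  "ewt n v \<zeta> = component (ewt_edges n v \<zeta>) []"

definition ewt_Z ::
  "(vertex \<Rightarrow> nat) \<Rightarrow> (vertex \<Rightarrow> real) \<Rightarrow> (vertex \<Rightarrow> real) \<Rightarrow> nat \<Rightarrow> nat" where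
  "ewt_Z n v \<zeta> l = card {i \<in> ewt n v \<zeta>. graph_dist (ewt_edges n v \<zeta>) [] i = l}"

definition child_law :: "nat pmf \<Rightarrow> vertex \<Rightarrow> nat \<Rightarrow> real" where
  "child_law P i k = (if i = [] then pmf P k else pmf P (k + 1))"

text \<open>The random variables attached to a vertex \<open>i\<close> are \<open>n i\<close>, \<open>v i\<close> and the costs
  \<open>\<zeta> (i @ [j])\<close> of its children \<open>1 \<le> j \<le> n i\<close>. A value \<open>\<zeta> (i @ [j])\<close> with \<open>j > n i\<close> has no
  meaning; in the independence assumption it is masked by \<open>0\<close>, and its law is unconstrained.
  The assumption \<open>node_law\<close> is the hierarchical law of one node: \<open>erlang_density k 1\<close> is the
  density of \<open>Erlang(k + 1)\<close> (the library's index is the shape minus one), and given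
  \<open>n i = k\<close> and \<open>v i = x\<close> the \<open>k\<close> costs are i.i.d. uniform on \<open>[0, x]\<close>.\<close>

locale erlang_weighted_tree = prob_space M
  for M :: "'w measure" and P :: "nat pmf"
    and n :: "vertex \<Rightarrow> 'w \<Rightarrow> nat" and v \<zeta> :: "vertex \<Rightarrow> 'w \<Rightarrow> real" +
  assumes n_measurable: "\<And>i. i \<in> vertices \<Longrightarrow> random_variable (count_space UNIV) (n i)"
    and v_measurable: "\<And>i. i \<in> vertices \<Longrightarrow> random_variable borel (v i)"
    and cost_measurable:
      "\<And>i j. i \<in> vertices \<Longrightarrow> 1 \<le> j \<Longrightarrow> random_variable borel (\<zeta> (i @ [j]))"
    and nodes_indep:
      "indep_vars (\<lambda>_. count_space UNIV \<Otimes>\<^sub>M borel \<Otimes>\<^sub>M (\<Pi>\<^sub>M j\<in>{1..}. borel))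
         (\<lambda>i \<omega>. (n i \<omega>, v i \<omega>, \<lambda>j\<in>{1..}. if j \<le> n i \<omega> then \<zeta> (i @ [j]) \<omega> else 0))
         vertices"
    and node_law:
      "\<And>i k A B. \<lbrakk>i \<in> vertices; A \<in> sets borel; \<And>j. j \<in> {1..k} \<Longrightarrow> B j \<in> sets borel\<rbrakk> \<Longrightarrow>
         emeasure M {\<omega> \<in> space M. n i \<omega> = k \<and> v i \<omega> \<in> A \<and> (\<forall>j\<in>{1..k}. \<zeta> (i @ [j]) \<omega> \<in> B j)} =
         ennreal (child_law P i k) *
         (\<integral>\<^sup>+x\<in>A. ennreal (erlang_density k 1 x) *
             (\<Prod>j\<in>{1..k}. emeasure (uniform_measure lborel {0..x}) (B j)) \<partial>lborel)"

definition extinction_prob ::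
  "'w measure \<Rightarrow> (vertex \<Rightarrow> 'w \<Rightarrow> nat) \<Rightarrow> (vertex \<Rightarrow> 'w \<Rightarrow> real) \<Rightarrow> (vertex \<Rightarrow> 'w \<Rightarrow> real) \<Rightarrow> real" where
  "extinction_prob M n v \<zeta> =
     measure M (\<Union>l\<in>{1..}. {\<omega> \<in> space M. ewt_Z (\<lambda>i. n i \<omega>) (\<lambda>i. v i \<omega>) (\<lambda>i. \<zeta> i \<omega>) l = 0})"

definition g2 :: "nat pmf \<Rightarrow> real \<Rightarrow> real" where
  "g2 P x = exp (- x) * (\<Sum>\<^sub>\<infinity>k\<in>{2..}. pmf P k * x ^ (k - 2) / fact (k - 2))"

primrec G :: "nat pmf \<Rightarrow> nat \<Rightarrow> real \<Rightarrow> real" where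
  "G P 0 = (\<lambda>x. 1)"
| "G P (Suc i) = (\<lambda>x. LBINT y:{x..}. LBINT z:{y..}. g2 P z * G P i z)"

definition L :: "nat pmf \<Rightarrow> real \<Rightarrow> real \<Rightarrow> real" where
  "L P \<beta> x = (\<Sum>i. G P i x * (- 1 / \<beta>) ^ i)"

definition beta0 :: "nat pmf \<Rightarrow> real" where
  "beta0 P = (GREATEST \<beta>. \<beta> > 0 \<and> L P \<beta> 0 = 0)"

end

theory Submission
  imports Defs
begin

text \<open>Give a vertex \<open>i\<close> of the tree the lifetime \<open>v i\<close> if its subtree reaches depth \<open>l\<close>, and \<open>0\<close> otherwise; the
  edge to a child survives and leads to depth \<open>l\<close> iff its cost is below the child's lifetime.
  Since a cost is uniform on \<open>[0, v i]\<close>, the only statistic of the lifetime \<open>U\<close> of a child that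
  matters is \<open>W x = E (min x U)\<close>, and averaging over the first generation gives the recursion
  \<open>W' x = \<integral> min x z * surv z (W z) dz\<close>, whose linearisation at \<open>0\<close> has the symmetric kernel
  \<open>min x z\<close> against the weight \<open>g2\<close>. The function \<open>L \<beta>\<close> solves
  \<open>L \<beta> x = L \<beta> 0 + 1/\<beta> * \<integral> min x z * g2 z * L \<beta> z dz\<close>, so at \<open>\<beta> = beta0\<close> it is a positive
  eigenfunction of the linearised operator with eigenvalue \<open>beta0\<close>.

  If \<open>beta0 > 1\<close>, a small multiple of (a truncation of) the eigenfunction is a subsolution of the
  recursion and bounds all iterates from below. If \<open>beta0 \<le> 1\<close>, then \<open>L 1 \<ge> 0\<close>, and testing the
  limiting fixed point against \<open>L 1\<close>, using the symmetry of the kernel and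
  \<open>surv z y \<le> g2 z * y\<close>, forces the fixed point to vanish.\<close>

text \<open>Two obstacles shape the proof. The tangent bound \<open>surv z y \<le> g2 z * y\<close>
  holds for every z, but no matching lower bound for small y is uniform in z: a term of degree k
  loses a factor of order (1 - y/z)^k, and degrees are unbounded. Cutting the weight at a finite
  degree restores uniformity. The mass cut off must then be small relative to the eigenfunction at
  every x, also near 0 where the eigenfunction vanishes; concavity of the kernel in x provides this.

  The other obstacle is the sign of \<open>L \<beta>\<close>, which its alternating series does not
  show. With s = 1/\<beta> it follows by continuity from s = 0, where the function is constantly 1.
  As long as the function is nonnegative it is nondecreasing in x, so its infimum sits at x = 0, and
  the sign can be lost only by passing through a root of \<open>L \<beta> 0\<close>. The largest
  root \<beta> is the first root in s, which is why \<open>beta0\<close> is the root with a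
  nonnegative eigenfunction.\<close>

definition half :: "real measure" where
  "half = density lborel (indicator {0..})"

lemma sets_half [measurable_cong, simp]: "sets half = sets borel"
  by (simp add: half_def)

lemma space_half [simp]: "space half = UNIV"
  by (simp add: half_def)

text \<open>A density, unlike a restricted space, leaves the carrier and the sigma-algebra
  unchanged, so measurability is proved on the whole line. Facts that hold only for z \<ge> 0 enter
  integrals through this statement.\<close>

lemma AE_half: "AE z in half. 0 \<le> z"
  unfolding half_def by (subst AE_density) (auto simp: indicator_def)

lemma nn_integral_half:
  "f \<in> borel_measurable borel \<Longrightarrow> (\<integral>\<^sup>+z. f z \<partial>half) = (\<integral>\<^sup>+z. f z * indicator {0..} z \<partial>lborel)"
  unfolding half_def by (subst nn_integral_density) (auto simp: mult.commute)

interpretation half: sigma_finite_measure half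
  unfolding half_def
  by (subst sigma_finite_measure.sigma_finite_iff_density_finite[OF sigma_finite_lborel]) (auto simp: indicator_def)

definition dens :: "(nat \<Rightarrow> real) \<Rightarrow> real \<Rightarrow> real" where
  "dens c z = exp (- z) * (\<Sum>k. c k * (z ^ k / fact k))"

text \<open>With \<open>c\<close> the law of the degree, \<open>dens c\<close> is the density of \<open>v i\<close>, and \<open>surv c z w\<close> is its
  density at \<open>z\<close> on the event that not all child edges are cut, when each one is cut with
  conditional probability \<open>1 - w / z\<close>.\<close>

definition surv :: "(nat \<Rightarrow> real) \<Rightarrow> real \<Rightarrow> real \<Rightarrow> real" where
  "surv c z w = exp (- z) * (\<Sum>k. c k * ((z ^ k - (z - w) ^ k) / fact k))"

primrec W :: "(nat \<Rightarrow> real) \<Rightarrow> nat \<Rightarrow> real \<Rightarrow> real" where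
  "W c 0 = (\<lambda>x. \<integral>z. min x z * dens c z \<partial>half)"
| "W c (Suc l) = (\<lambda>x. \<integral>z. min x z * surv c z (W c l z) \<partial>half)"

primrec reach :: "nat \<Rightarrow> (vertex \<Rightarrow> nat) \<Rightarrow> (vertex \<Rightarrow> real) \<Rightarrow> (vertex \<Rightarrow> real) \<Rightarrow> vertex \<Rightarrow> bool" where
  "reach 0 n v \<zeta> i = True"
| "reach (Suc l) n v \<zeta> i =
     (\<exists>j\<in>{1..n i}. \<zeta> (i @ [j]) < v (i @ [j]) \<and> reach l n v \<zeta> (i @ [j]))"

lemma summable_coeff_power:
  fixes c :: "nat \<Rightarrow> real"
  assumes "\<And>k. \<bar>c k\<bar> \<le> 1"
  shows "summable (\<lambda>k. c k * (z ^ k / fact k))"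
proof (rule summable_comparison_test')
  show "summable (\<lambda>k. \<bar>z\<bar> ^ k / fact k)"
    using summable_exp[of "\<bar>z\<bar>"] by (simp add: field_simps)
  show "norm (c k * (z ^ k / fact k)) \<le> \<bar>z\<bar> ^ k / fact k" for k
    using mult_right_mono[OF assms[of k], of "\<bar>z\<bar> ^ k / fact k"]
    by (simp add: abs_mult power_abs)
qed

lemma summable_coeff_diff:
  fixes c :: "nat \<Rightarrow> real"
  assumes "\<And>k. \<bar>c k\<bar> \<le> 1"
  shows "summable (\<lambda>k. c k * ((z ^ k - y ^ k) / fact k))"
  using summable_diff[OF summable_coeff_power[where c = c and z = z, OF assms] summable_coeff_power[where c = c and z = y, OF assms]]
  by (simp add: field_simps)

lemma borel_measurable_dens [measurable]: "dens c \<in> borel_measurable borel"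
  unfolding dens_def by measurable

lemma borel_measurable_surv [measurable]:
  assumes [measurable]: "f \<in> borel_measurable N" "g \<in> borel_measurable N"
  shows "(\<lambda>x. surv c (f x) (g x)) \<in> borel_measurable N"
  unfolding surv_def by measurable

lemma borel_measurable_min_integral:
  assumes [measurable]: "h \<in> borel_measurable borel"
  shows "(\<lambda>x. \<integral>z. min x z * h z \<partial>half) \<in> borel_measurable borel"
  by (rule half.borel_measurable_lebesgue_integral) measurable

lemma borel_measurable_W [measurable]: "W c l \<in> borel_measurable borel"
  by (induction l) (auto intro!: borel_measurable_min_integral)

lemma surv_nonneg:
  assumes "\<And>k. 0 \<le> c k" "\<And>k. c k \<le> 1" "0 \<le> w" "w \<le> z"
  shows "0 \<le> surv c z w"
  unfolding surv_def using assms
  by (intro mult_nonneg_nonneg suminf_nonneg summable_coeff_diff divide_nonneg_nonneg)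
    (auto intro!: power_mono simp: abs_le_iff le_minus_iff order_trans[of _ 0])

lemma dens_nonneg:
  assumes "\<And>k. 0 \<le> c k" "\<And>k. c k \<le> 1" "0 \<le> z"
  shows "0 \<le> dens c z"
  unfolding dens_def using assms
  by (intro mult_nonneg_nonneg suminf_nonneg summable_coeff_power)
    (auto simp: abs_le_iff le_minus_iff order_trans[of _ 0])

lemma suminf_ennreal_cmult:
  fixes a :: "nat \<Rightarrow> real"
  assumes "summable a" "\<And>k. 0 \<le> a k" "0 \<le> r"
  shows "(\<Sum>k. ennreal (r * a k)) = ennreal (r * suminf a)"
  using assms by (subst suminf_ennreal2) (auto simp: suminf_mult summable_mult)

text \<open>The shifted law, called P-hat in the definition of the tree, of the degrees at all
  vertices other than the root.\<close>

definition offspring :: "nat pmf \<Rightarrow> nat \<Rightarrow> real" where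
  "offspring P k = pmf P (k + 1)"

lemma offspring_bounds: "0 \<le> offspring P k" "offspring P k \<le> 1"
  by (auto simp: offspring_def pmf_le_1)

subsection \<open>Generations of the tree\<close>

context
  fixes n :: "vertex \<Rightarrow> nat" and v \<zeta> :: "vertex \<Rightarrow> real"
begin

primrec kept :: "vertex \<Rightarrow> nat list \<Rightarrow> bool" where
  "kept i [] = True"
| "kept i (j # w) = (1 \<le> j \<and> j \<le> n i \<and> \<zeta> (i @ [j]) < v (i @ [j]) \<and> kept (i @ [j]) w)"

text \<open>\<open>kept\<close> and \<open>reach\<close> peel words from the front, as the recursion
  over generations does, while walks from the root grow at the end. Splitting a word anywhere
  reconciles the two.\<close>

lemma kept_append: "kept i (w @ w') \<longleftrightarrow> kept i w \<and> kept (i @ w) w'"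
  by (induction w arbitrary: i) auto

lemma kept_vertices: "kept i w \<Longrightarrow> 0 \<notin> set w"
  by (induction w arbitrary: i) auto

lemma reach_iff_kept: "reach l n v \<zeta> i \<longleftrightarrow> (\<exists>w. length w = l \<and> kept i w)"
proof (induction l arbitrary: i)
  case (Suc l)
  show ?case (is "?lhs \<longleftrightarrow> ?rhs")
  proof
    assume ?lhs
    then obtain j w where "j \<in> {1..n i}" "\<zeta> (i @ [j]) < v (i @ [j])" "length w = l" "kept (i @ [j]) w"
      by (auto simp: Suc.IH)
    then show ?rhs by (intro exI[of _ "j # w"]) auto
  next
    assume ?rhs
    then obtain j w where "length w = l" "kept i (j # w)"
      by (auto simp: length_Suc_conv)
    then show ?lhs by (auto simp: Suc.IH intro!: bexI[of _ j])
  qed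
qed simp

text \<open>EWT edges are defined only at vertices of the backbone tree, so kept words have to be
  located there before they can be read as walks.\<close>

lemma kept_backbone: "kept [] w \<Longrightarrow> w \<in> backbone_tree n"
proof (induction w rule: rev_induct)
  case Nil
  then show ?case by (simp add: backbone_tree_def component_def)
next
  case (snoc j w)
  then have "w \<in> backbone_tree n" "1 \<le> j" "j \<le> n w" "w \<in> vertices"
    using kept_vertices[of "[]" w] by (auto simp: kept_append vertices_def)
  then have "([], w) \<in> (backbone_edges n)\<^sup>*" "(w, w @ [j]) \<in> backbone_edges n"
    by (auto simp: backbone_tree_def component_def backbone_edges_def Let_def)
  then show ?case by (auto simp: backbone_tree_def component_def)
qed

lemma kept_path: "kept [] w \<Longrightarrow> ([], w) \<in> ewt_edges n v \<zeta> ^^ length w"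
proof (induction w rule: rev_induct)
  case (snoc j w)
  then have "kept [] w" "1 \<le> j" "j \<le> n w" "\<zeta> (w @ [j]) < v (w @ [j])" by (auto simp: kept_append)
  with kept_backbone[of w] have "(w, w @ [j]) \<in> ewt_edges n v \<zeta>"
    by (auto simp: ewt_edges_def Let_def)
  with snoc.IH \<open>kept [] w\<close> show ?case by auto
qed simp

text \<open>A walk may turn back towards the root, so its length only bounds the depth. Each step
  appends a letter or removes the last one, and prefixes of kept words are kept.\<close>

lemma path_kept: "([], w) \<in> ewt_edges n v \<zeta> ^^ m \<Longrightarrow> kept [] w \<and> length w \<le> m"
proof (induction m arbitrary: w)
  case (Suc m)
  then obtain w' where w': "([], w') \<in> ewt_edges n v \<zeta> ^^ m" "(w', w) \<in> ewt_edges n v \<zeta>"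
    by auto
  from Suc.IH[OF w'(1)] have "kept [] w'" "length w' \<le> m" by auto
  with w'(2) show ?case
    by (auto simp: ewt_edges_def Let_def kept_append)
qed simp

lemma ewt_eq_kept: "ewt n v \<zeta> = {w. kept [] w}"
  using kept_path path_kept by (auto simp: ewt_def component_def rtrancl_power) blast

lemma graph_dist_ewt: "kept [] w \<Longrightarrow> graph_dist (ewt_edges n v \<zeta>) [] w = length w"
  unfolding graph_dist_def by (rule Least_equality) (auto dest: kept_path path_kept)

text \<open>\<open>card\<close> of an infinite set is 0, so finiteness is what lets
  \<open>ewt_Z\<close> = 0 mean that the generation is empty.\<close>

lemma finite_generation: "finite {w. length w = l \<and> kept [] w}"
proof (induction l)
  case (Suc l)
  have "{w. length w = Suc l \<and> kept [] w} \<subseteq>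
      (\<Union>w\<in>{w. length w = l \<and> kept [] w}. (\<lambda>j. w @ [j]) ` {1..n w})"
  proof
    fix w assume "w \<in> {w. length w = Suc l \<and> kept [] w}"
    then show "w \<in> (\<Union>w\<in>{w. length w = l \<and> kept [] w}. (\<lambda>j. w @ [j]) ` {1..n w})"
      by (cases w rule: rev_cases) (auto simp: kept_append)
  qed
  then show ?case by (rule finite_subset) (use Suc in auto)
qed (simp add: Collect_conv_if)

lemma ewt_Z_eq_0_iff: "ewt_Z n v \<zeta> l = 0 \<longleftrightarrow> \<not> reach l n v \<zeta> []"
proof -
  have "{i \<in> ewt n v \<zeta>. graph_dist (ewt_edges n v \<zeta>) [] i = l} = {w. length w = l \<and> kept [] w}"
    by (auto simp: ewt_eq_kept graph_dist_ewt)
  then show ?thesis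
    using finite_generation[of l] by (auto simp: ewt_Z_def reach_iff_kept)
qed

lemma reach_Suc_imp: "reach (Suc l) n v \<zeta> i \<Longrightarrow> reach l n v \<zeta> i"
proof (induction l arbitrary: i)
  case (Suc l)
  then obtain j where "j \<in> {1..n i}" "\<zeta> (i @ [j]) < v (i @ [j])" "reach (Suc l) n v \<zeta> (i @ [j])"
    unfolding reach.simps(2)[of "Suc l"] by blast
  then show ?case
    using Suc.IH unfolding reach.simps(2)[of l] by blast
qed simp

end

subsection \<open>The law of one generation\<close>

abbreviation node_space :: "(nat \<times> real \<times> (nat \<Rightarrow> real)) measure" where
  "node_space \<equiv> count_space UNIV \<Otimes>\<^sub>M borel \<Otimes>\<^sub>M (\<Pi>\<^sub>M j\<in>{1..}. borel)"

text \<open>A function of the node data alone, so that independence of the nodes applies to it. The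
  value 0 stands for failure to reach depth l: a nonnegative cost is never below 0, so one
  comparison tests both the edge and the child. With \<open>max 0\<close> the values are nonnegative
  at every sample point, not only almost surely.\<close>

primrec lifetime :: "nat \<Rightarrow> vertex \<Rightarrow> (vertex \<Rightarrow> nat \<times> real \<times> (nat \<Rightarrow> real)) \<Rightarrow> real" where
  "lifetime 0 i x = max 0 (fst (snd (x i)))"
| "lifetime (Suc l) i x =
     (if \<exists>j\<in>{1..fst (x i)}. snd (snd (x i)) j < lifetime l (i @ [j]) x
      then max 0 (fst (snd (x i))) else 0)"

definition descendants :: "vertex \<Rightarrow> vertex set" where
  "descendants i = {i @ w | w. w \<in> vertices}"

lemma descendants_self [simp]: "i \<in> descendants i"
  by (auto simp: descendants_def vertices_def intro!: exI[of _ "[]"])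

lemma descendants_child: "1 \<le> j \<Longrightarrow> descendants (i @ [j]) \<subseteq> descendants i"
  by (force simp: descendants_def vertices_def)

lemma descendants_vertices: "i \<in> vertices \<Longrightarrow> descendants i \<subseteq> vertices"
  by (auto simp: descendants_def vertices_def)

lemma child_vertices: "i \<in> vertices \<Longrightarrow> 1 \<le> j \<Longrightarrow> i @ [j] \<in> vertices"
  by (auto simp: vertices_def)

lemma lifetime_nonneg: "0 \<le> lifetime l i x"
  by (cases l) auto

text \<open>Only the data in the subtree of i are read; this turns disjointness of subtrees into
  independence of lifetimes.\<close>

lemma lifetime_cong: "(\<And>k. k \<in> descendants i \<Longrightarrow> x k = y k) \<Longrightarrow> lifetime l i x = lifetime l i y"
proof (induction l arbitrary: i)
  case (Suc l)
  have "lifetime l (i @ [j]) x = lifetime l (i @ [j]) y" if "j \<in> {1..fst (x i)}" for j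
    using descendants_child[of j i] that by (intro Suc.IH Suc.prems) auto
  with Suc.prems[of i] show ?case by auto
qed simp

lemma measurable_lifetime:
  "descendants i \<subseteq> J \<Longrightarrow> lifetime l i \<in> borel_measurable (PiM J (\<lambda>_. node_space))"
proof (induction l arbitrary: i)
  case 0
  then have [measurable]: "i \<in> J" by auto
  show ?case by simp
next
  case (Suc l)
  then have [measurable]: "i \<in> J" by auto
  have [measurable]: "lifetime l (i @ [j]) \<in> borel_measurable (PiM J (\<lambda>_. node_space))" if "1 \<le> j" for j
    using descendants_child[OF that, of i] Suc.prems by (intro Suc.IH) auto
  \<comment> \<open>The range of the quantifier depends on x. Over a fixed countable range the
    condition becomes a countable union of measurable sets.\<close>
  have *: "(\<exists>j\<in>{1..fst (x i)}. snd (snd (x i)) j < lifetime l (i @ [j]) x) \<longleftrightarrow>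
    (\<exists>j\<in>{1..}. j \<le> fst (x i) \<and> snd (snd (x i)) j < lifetime l (i @ [j]) x)" for x
    by auto
  have "(\<lambda>x. snd (snd (x i)) j) \<in> borel_measurable (PiM J (\<lambda>_. node_space))" if "1 \<le> j" for j
    by (rule measurable_compose[OF _ measurable_component_singleton[of j "{1..}"]]) (use that in auto)
  note [measurable] = this
  show ?case unfolding lifetime.simps * by measurable
qed

text \<open>The origin of the kernel \<open>min\<close>: with x the lifetime of the parent and u
  that of the child, this is the conditional probability that the cost is not below u.\<close>

lemma emeasure_uniform_Ici:
  fixes x u :: real
  assumes "0 < x"
  shows "emeasure (uniform_measure lborel {0..x}) {u..} = ennreal (1 - min x (max 0 u) / x)"
proof -
  have "{0..x} \<inter> {u..} = {max 0 u..x}" by auto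
  then have "emeasure (uniform_measure lborel {0..x}) {u..} = ennreal (x - min x (max 0 u)) / ennreal x"
    using assms by (auto simp: emeasure_uniform_measure emeasure_lborel_Icc_eq min_def)
  also have "\<dots> = ennreal ((x - min x (max 0 u)) / x)"
    using assms by (intro divide_ennreal) auto
  finally show ?thesis using assms by (simp add: diff_divide_distrib)
qed

section \<open>Conditioning a node on the lifetimes of its children\<close>

context erlang_weighted_tree
begin

abbreviation node :: "vertex \<Rightarrow> 'w \<Rightarrow> nat \<times> real \<times> (nat \<Rightarrow> real)" where
  "node i \<omega> \<equiv> (n i \<omega>, v i \<omega>, \<lambda>j\<in>{1..}. if j \<le> n i \<omega> then \<zeta> (i @ [j]) \<omega> else 0)"

definition U :: "nat \<Rightarrow> vertex \<Rightarrow> 'w \<Rightarrow> real" where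
  "U l i \<omega> = lifetime l i (\<lambda>k. node k \<omega>)"

lemma node_rv: "i \<in> vertices \<Longrightarrow> random_variable node_space (node i)"
  using nodes_indep by (auto simp: indep_vars_def)

lemma U_eq_restrict:
  "descendants i \<subseteq> J \<Longrightarrow> U l i \<omega> = lifetime l i (restrict (\<lambda>k. node k \<omega>) J)"
  unfolding U_def by (intro lifetime_cong) auto

lemma measurable_U: assumes "i \<in> vertices" shows "random_variable borel (U l i)"
proof -
  have "random_variable (PiM vertices (\<lambda>_. node_space)) (\<lambda>\<omega>. restrict (\<lambda>k. node k \<omega>) vertices)"
    by (intro measurable_restrict node_rv)
  from measurable_compose[OF this measurable_lifetime[OF descendants_vertices[OF assms]]]
  show ?thesis
    using U_eq_restrict[OF descendants_vertices[OF assms]] by (auto cong: measurable_cong)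
qed

lemma U_Suc:
  "U (Suc l) i \<omega> = (if \<exists>j\<in>{1..n i \<omega>}. \<zeta> (i @ [j]) \<omega> < U l (i @ [j]) \<omega> then max 0 (v i \<omega>) else 0)"
  by (auto simp: U_def)

text \<open>Words starting with i @ [j] for different j are different, so the children's subtrees
  are disjoint blocks of independent nodes.\<close>

lemma indep_children:
  assumes "i \<in> vertices"
  shows "indep_vars (\<lambda>_. borel) (\<lambda>j. U l (i @ [j])) {1..k}"
proof -
  have sub: "\<And>j. j \<in> {1..k} \<Longrightarrow> descendants (i @ [j]) \<subseteq> vertices"
    using assms by (intro descendants_vertices child_vertices) auto
  have disj: "disjoint_family_on (\<lambda>j. descendants (i @ [j])) {1..k}"
    by (auto simp: disjoint_family_on_def descendants_def)
  from indep_vars_compose2[OF indep_vars_restrict[OF nodes_indep sub disj]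
      measurable_lifetime[OF order_refl]]
  have "indep_vars (\<lambda>_. borel) (\<lambda>j \<omega>. lifetime l (i @ [j])
      (restrict (\<lambda>k. node k \<omega>) (descendants (i @ [j])))) {1..k}" .
  moreover have "U l (i @ [j]) = (\<lambda>\<omega>. lifetime l (i @ [j]) (restrict (\<lambda>k. node k \<omega>) (descendants (i @ [j]))))" for j
    by (auto simp: U_eq_restrict[OF order_refl])
  ultimately show ?thesis by simp
qed

text \<open>\<open>node_law\<close> evaluates only fixed sets for the costs, whereas the thresholds
  here are random. The data at i are independent of the data in the subtrees of its children, so the
  joint law is a product and Tonelli freezes the thresholds at a sample point \<omega> independent
  of the node.\<close>

lemma emeasure_node_children:
  assumes i: "i \<in> vertices" and [measurable]: "A \<in> sets borel"
  shows "emeasure M {\<omega> \<in> space M. n i \<omega> = k \<and> v i \<omega> \<in> A \<and> (\<forall>j\<in>{1..k}. U l (i @ [j]) \<omega> \<le> \<zeta> (i @ [j]) \<omega>)} =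
    (\<integral>\<^sup>+\<omega>. emeasure M {\<omega>' \<in> space M. n i \<omega>' = k \<and> v i \<omega>' \<in> A \<and>
      (\<forall>j\<in>{1..k}. U l (i @ [j]) \<omega> \<le> \<zeta> (i @ [j]) \<omega>')} \<partial>M)"
proof -
  define B where "B = (\<Union>j\<in>{1..k}. descendants (i @ [j]))"
  define X where "X J \<omega> = restrict (\<lambda>k. node k \<omega>) J" for J \<omega>
  define T where "T = {(x, y). fst (x i) = k \<and> fst (snd (x i)) \<in> A \<and>
     (\<forall>j\<in>{1..k}. lifetime l (i @ [j]) y \<le> snd (snd (x i)) j)}"
  let ?S = "PiM {i} (\<lambda>_. node_space)" and ?R = "PiM B (\<lambda>_. node_space)"
  have B: "B \<subseteq> vertices"
    unfolding B_def using i by (intro UN_least descendants_vertices child_vertices) auto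
  have disj: "{i} \<inter> B = {}" by (auto simp: descendants_def B_def)
  have [measurable]: "lifetime l (i @ [j]) \<in> borel_measurable ?R" if "j \<in> {1..k}" for j
    by (intro measurable_lifetime) (use that in \<open>auto simp: B_def\<close>)
  have [measurable]: "(\<lambda>x. snd (snd (x i)) j) \<in> borel_measurable ?S" if "j \<in> {1..k}" for j
    by (rule measurable_compose[OF _ measurable_component_singleton[of j "{1..}"]]) (use that in auto)
  have ind: "indep_var ?S (X {i}) ?R (X B)"
    unfolding X_def by (rule indep_var_restrict[OF nodes_indep disj _ B]) (use i in auto)
  then have rv [measurable]: "random_variable ?S (X {i})" "random_variable ?R (X B)"
    by (auto dest: indep_var_rv1 indep_var_rv2)
  have T: "T \<inter> space (?S \<Otimes>\<^sub>M ?R) \<in> sets (?S \<Otimes>\<^sub>M ?R)"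
  proof -
    have "T \<inter> space (?S \<Otimes>\<^sub>M ?R) = {p \<in> space (?S \<Otimes>\<^sub>M ?R). fst (fst p i) = k \<and> fst (snd (fst p i)) \<in> A \<and>
       (\<forall>j\<in>{1..k}. lifetime l (i @ [j]) (snd p) \<le> snd (snd (fst p i)) j)}"
      by (auto simp: T_def)
    also have "\<dots> \<in> sets (?S \<Otimes>\<^sub>M ?R)" by measurable
    finally show ?thesis .
  qed
  interpret D1: prob_space "distr M ?S (X {i})" by (rule prob_space_distr) fact
  interpret D2: prob_space "distr M ?R (X B)" by (rule prob_space_distr) fact
  interpret P: pair_sigma_finite "distr M ?S (X {i})" "distr M ?R (X B)" ..
  have T_iff: "(X {i} \<omega>', X B \<omega>) \<in> T \<longleftrightarrow> n i \<omega>' = k \<and> v i \<omega>' \<in> A \<and>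
      (\<forall>j\<in>{1..k}. U l (i @ [j]) \<omega> \<le> \<zeta> (i @ [j]) \<omega>')" for \<omega> \<omega>'
  proof -
    have "lifetime l (i @ [j]) (X B \<omega>) = U l (i @ [j]) \<omega>" if "j \<in> {1..k}" for j
      unfolding X_def by (rule U_eq_restrict[symmetric]) (use that in \<open>auto simp: B_def\<close>)
    then show ?thesis by (auto simp: T_def X_def)
  qed
  have spX: "\<omega> \<in> space M \<Longrightarrow> X {i} \<omega> \<in> space ?S" "\<omega> \<in> space M \<Longrightarrow> X B \<omega> \<in> space ?R" for \<omega>
    using rv by (auto dest: measurable_space)
  have "{\<omega> \<in> space M. n i \<omega> = k \<and> v i \<omega> \<in> A \<and> (\<forall>j\<in>{1..k}. U l (i @ [j]) \<omega> \<le> \<zeta> (i @ [j]) \<omega>)} =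
      (\<lambda>\<omega>. (X {i} \<omega>, X B \<omega>)) -` (T \<inter> space (?S \<Otimes>\<^sub>M ?R)) \<inter> space M"
    using spX by (auto simp: T_iff space_pair_measure)
  also have "emeasure M \<dots> = emeasure (distr M (?S \<Otimes>\<^sub>M ?R) (\<lambda>\<omega>. (X {i} \<omega>, X B \<omega>))) (T \<inter> space (?S \<Otimes>\<^sub>M ?R))"
    by (rule emeasure_distr[symmetric, OF measurable_Pair[OF rv] T])
  also have "\<dots> = emeasure (distr M ?S (X {i}) \<Otimes>\<^sub>M distr M ?R (X B)) (T \<inter> space (?S \<Otimes>\<^sub>M ?R))"
    using ind by (simp add: indep_var_distribution_eq)
  also have "\<dots> = (\<integral>\<^sup>+y. emeasure (distr M ?S (X {i})) ((\<lambda>x. (x, y)) -` (T \<inter> space (?S \<Otimes>\<^sub>M ?R))) \<partial>distr M ?R (X B))"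
    using T by (intro P.emeasure_pair_measure_alt2) simp
  also have "\<dots> = (\<integral>\<^sup>+\<omega>. emeasure (distr M ?S (X {i})) ((\<lambda>x. (x, X B \<omega>)) -` (T \<inter> space (?S \<Otimes>\<^sub>M ?R))) \<partial>M)"
    using T by (intro nn_integral_distr rv P.measurable_emeasure_Pair2) simp
  also have "\<dots> = (\<integral>\<^sup>+\<omega>. emeasure M {\<omega>' \<in> space M. n i \<omega>' = k \<and> v i \<omega>' \<in> A \<and>
      (\<forall>j\<in>{1..k}. U l (i @ [j]) \<omega> \<le> \<zeta> (i @ [j]) \<omega>')} \<partial>M)"
  proof (rule nn_integral_cong)
    fix \<omega> assume \<omega>: "\<omega> \<in> space M"
    have "(\<lambda>x. (x, X B \<omega>)) -` (T \<inter> space (?S \<Otimes>\<^sub>M ?R)) \<in> sets ?S"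
      using T by (rule sets_Pair2)
    then have "emeasure (distr M ?S (X {i})) ((\<lambda>x. (x, X B \<omega>)) -` (T \<inter> space (?S \<Otimes>\<^sub>M ?R))) =
       emeasure M (X {i} -` ((\<lambda>x. (x, X B \<omega>)) -` (T \<inter> space (?S \<Otimes>\<^sub>M ?R))) \<inter> space M)"
      by (intro emeasure_distr rv)
    also have "X {i} -` ((\<lambda>x. (x, X B \<omega>)) -` (T \<inter> space (?S \<Otimes>\<^sub>M ?R))) \<inter> space M =
      {\<omega>' \<in> space M. n i \<omega>' = k \<and> v i \<omega>' \<in> A \<and> (\<forall>j\<in>{1..k}. U l (i @ [j]) \<omega> \<le> \<zeta> (i @ [j]) \<omega>')}"
      using spX \<omega> by (auto simp: T_iff space_pair_measure)
    finally show "emeasure (distr M ?S (X {i})) ((\<lambda>x. (x, X B \<omega>)) -` (T \<inter> space (?S \<Otimes>\<^sub>M ?R))) =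
      emeasure M {\<omega>' \<in> space M. n i \<omega>' = k \<and> v i \<omega>' \<in> A \<and> (\<forall>j\<in>{1..k}. U l (i @ [j]) \<omega> \<le> \<zeta> (i @ [j]) \<omega>')}" .
  qed
  finally show ?thesis .
qed

lemma child_law_nonneg [simp]: "0 \<le> child_law P i k"
  by (simp add: child_law_def)

lemma child_law_le_1: "child_law P i k \<le> 1"
  by (simp add: child_law_def pmf_le_1)

lemma measurable_zeta: "i \<in> vertices \<Longrightarrow> j \<in> {1..k} \<Longrightarrow> random_variable borel (\<zeta> (i @ [j]))"
  by (rule cost_measurable) auto

lemma measurable_U_child: "i \<in> vertices \<Longrightarrow> j \<in> {1..k} \<Longrightarrow> random_variable borel (U l (i @ [j]))"
  by (intro measurable_U child_vertices) auto

lemma emeasure_degree_type: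
  assumes i: "i \<in> vertices" and A: "A \<in> sets borel"
  shows "emeasure M {\<omega> \<in> space M. n i \<omega> = k \<and> v i \<omega> \<in> A} =
    (\<integral>\<^sup>+x. ennreal (child_law P i k * (exp (- x) * (x ^ k / fact k))) * indicator A x \<partial>half)"
proof -
  have "emeasure M {\<omega> \<in> space M. n i \<omega> = k \<and> v i \<omega> \<in> A} =
     ennreal (child_law P i k) *
         (\<integral>\<^sup>+x\<in>A. ennreal (erlang_density k 1 x) *
             (\<Prod>j\<in>{1..k}. emeasure (uniform_measure lborel {0..x}) UNIV) \<partial>lborel)"
    using node_law[OF i A, of k "\<lambda>_. UNIV"] by simp
  also have "\<dots> = ennreal (child_law P i k) *
         (\<integral>\<^sup>+x. ennreal (erlang_density k 1 x) * indicator A x \<partial>lborel)"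
  proof -
    have "ennreal (erlang_density k 1 x) * (\<Prod>j\<in>{1..k}. emeasure (uniform_measure lborel {0..x}) UNIV) =
      ennreal (erlang_density k 1 x)" for x
    proof (cases "x > 0")
      case True
      then have "emeasure (uniform_measure lborel {0..x}) UNIV = 1"
        by (simp add: emeasure_uniform_measure divide_ennreal_def ennreal_inverse_positive
             flip: ennreal_mult)
           (simp add: inverse_ennreal flip: ennreal_mult)
      then show ?thesis by simp
    next
      \<comment> \<open>For x \<le> 0 the uniform measure is degenerate, but then the Erlang density
        is 0, except at x = 0 and k = 0, where the product is empty.\<close>
      case False
      then show ?thesis by (cases k) (auto simp: erlang_density_def)
    qed
    then show ?thesis by simp
  qed
  also have "\<dots> = (\<integral>\<^sup>+x. ennreal (child_law P i k) * (ennreal (erlang_density k 1 x) * indicator A x) \<partial>lborel)"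
    using A by (subst nn_integral_cmult) auto
  also have "\<dots> = (\<integral>\<^sup>+x. ennreal (child_law P i k * (exp (- x) * (x ^ k / fact k))) * indicator A x \<partial>half)"
    using A by (subst nn_integral_half)
      (auto intro!: nn_integral_cong simp: erlang_density_def indicator_def mult_ac simp flip: ennreal_mult')
  finally show ?thesis .
qed

text \<open>Given lifetime x, independence of the children turns the probability that all k edges
  fail into the k-th power of 1 - w x / x. The factor x^k of the Erlang density clears the
  denominators, which leaves (x - w x)^k.\<close>

lemma emeasure_no_child:
  assumes i: "i \<in> vertices" and A: "A \<in> sets borel"
    and w: "\<And>j x. 1 \<le> j \<Longrightarrow> 0 \<le> x \<Longrightarrow> expectation (\<lambda>\<omega>. min x (U l (i @ [j]) \<omega>)) = w x"
    and w_bounds: "\<And>x. 0 \<le> x \<Longrightarrow> 0 \<le> w x" "\<And>x. 0 \<le> x \<Longrightarrow> w x \<le> x"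
    and [measurable]: "w \<in> borel_measurable borel"
  shows "emeasure M {\<omega> \<in> space M. n i \<omega> = k \<and> v i \<omega> \<in> A \<and> (\<forall>j\<in>{1..k}. U l (i @ [j]) \<omega> \<le> \<zeta> (i @ [j]) \<omega>)} =
    (\<integral>\<^sup>+x. ennreal (child_law P i k * (exp (- x) * ((x - w x) ^ k / fact k))) * indicator A x \<partial>half)"
proof -
  note [measurable] = A
  have [measurable]: "random_variable borel (U l (i @ [j]))" if "j \<in> {1..k}" for j
    using measurable_U_child[OF i that] .
  \<comment> \<open>Failure probability of one edge. Evaluated at w x the minimum is inert, because
    w x \<le> x, so the same expression serves before and after taking expectations.\<close>
  define \<phi> where "\<phi> x u = 1 - min x u / x" for x u :: real
  have U0: "0 \<le> U l i' \<omega>" for i' \<omega> by (simp add: U_def lifetime_nonneg)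
  let ?e = "\<lambda>x. ennreal (erlang_density k 1 x)"
  have "emeasure M {\<omega> \<in> space M. n i \<omega> = k \<and> v i \<omega> \<in> A \<and> (\<forall>j\<in>{1..k}. U l (i @ [j]) \<omega> \<le> \<zeta> (i @ [j]) \<omega>)} =
    (\<integral>\<^sup>+\<omega>. ennreal (child_law P i k) *
         (\<integral>\<^sup>+x. ?e x * indicator A x * (\<Prod>j\<in>{1..k}. ennreal (\<phi> x (U l (i @ [j]) \<omega>))) \<partial>lborel) \<partial>M)"
    unfolding emeasure_node_children[OF i A]
  proof (rule nn_integral_cong)
    fix \<omega>
    have "?e x * (\<Prod>j\<in>{1..k}. emeasure (uniform_measure lborel {0..x}) {U l (i @ [j]) \<omega>..}) =
        ?e x * (\<Prod>j\<in>{1..k}. ennreal (\<phi> x (U l (i @ [j]) \<omega>)))" for x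
    proof (cases "x > 0")
      case True
      show ?thesis unfolding emeasure_uniform_Ici[OF True] \<phi>_def by (simp add: U0 max_absorb2)
    next
      case False
      then show ?thesis by (cases k) (auto simp: erlang_density_def)
    qed
    then show "emeasure M {\<omega>' \<in> space M. n i \<omega>' = k \<and> v i \<omega>' \<in> A \<and>
      (\<forall>j\<in>{1..k}. U l (i @ [j]) \<omega> \<le> \<zeta> (i @ [j]) \<omega>')} =  ennreal (child_law P i k) *
         (\<integral>\<^sup>+x. ?e x * indicator A x * (\<Prod>j\<in>{1..k}. ennreal (\<phi> x (U l (i @ [j]) \<omega>))) \<partial>lborel)"
      using node_law[OF i A, of k "\<lambda>j. {U l (i @ [j]) \<omega>..}"] by (simp add: mult_ac)
  qed
  also have "\<dots> = ennreal (child_law P i k) *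
     (\<integral>\<^sup>+\<omega>. \<integral>\<^sup>+x. ?e x * indicator A x * (\<Prod>j\<in>{1..k}. ennreal (\<phi> x (U l (i @ [j]) \<omega>))) \<partial>lborel \<partial>M)"
    by (rule nn_integral_cmult) (unfold \<phi>_def, measurable)
  also have "(\<integral>\<^sup>+\<omega>. \<integral>\<^sup>+x. ?e x * indicator A x * (\<Prod>j\<in>{1..k}. ennreal (\<phi> x (U l (i @ [j]) \<omega>))) \<partial>lborel \<partial>M) =
    (\<integral>\<^sup>+x. \<integral>\<^sup>+\<omega>. ?e x * indicator A x * (\<Prod>j\<in>{1..k}. ennreal (\<phi> x (U l (i @ [j]) \<omega>))) \<partial>M \<partial>lborel)"
  proof -
    interpret pair_sigma_finite lborel M ..
    show ?thesis by (rule Fubini') (unfold \<phi>_def, measurable)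
  qed
  also have "\<dots> = (\<integral>\<^sup>+x. ?e x * indicator A x * ennreal (\<phi> x (w x)) ^ k \<partial>lborel)"
  proof (rule nn_integral_cong)
    fix x :: real
    show "(\<integral>\<^sup>+\<omega>. ?e x * indicator A x * (\<Prod>j\<in>{1..k}. ennreal (\<phi> x (U l (i @ [j]) \<omega>))) \<partial>M) =
      ?e x * indicator A x * ennreal (\<phi> x (w x)) ^ k"
    proof (cases "x > 0")
      case True
      have "(\<integral>\<^sup>+\<omega>. ?e x * indicator A x * (\<Prod>j\<in>{1..k}. ennreal (\<phi> x (U l (i @ [j]) \<omega>))) \<partial>M) =
        ?e x * indicator A x * (\<integral>\<^sup>+\<omega>. (\<Prod>j\<in>{1..k}. ennreal (\<phi> x (U l (i @ [j]) \<omega>))) \<partial>M)"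
        by (rule nn_integral_cmult) (unfold \<phi>_def, measurable)
      also have "(\<integral>\<^sup>+\<omega>. (\<Prod>j\<in>{1..k}. ennreal (\<phi> x (U l (i @ [j]) \<omega>))) \<partial>M) =
        (\<Prod>j\<in>{1..k}. \<integral>\<^sup>+\<omega>. ennreal (\<phi> x (U l (i @ [j]) \<omega>)) \<partial>M)"
        by (rule indep_vars_nn_integral[OF _ indep_vars_compose2[OF indep_children[OF i]]])
           (auto simp: \<phi>_def)
      also have "\<dots> = (\<Prod>j\<in>{1..k}. ennreal (\<phi> x (w x)))"
      proof (rule prod.cong[OF refl])
        fix j assume j: "j \<in> {1..k}"
        have int: "integrable M (\<lambda>\<omega>. min x (U l (i @ [j]) \<omega>))"
          by (rule integrable_const_bound[where B = x]) (use True U0 measurable_U_child[OF i j] in auto)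
        have "(\<integral>\<^sup>+\<omega>. ennreal (\<phi> x (U l (i @ [j]) \<omega>)) \<partial>M) = ennreal (expectation (\<lambda>\<omega>. \<phi> x (U l (i @ [j]) \<omega>)))"
          by (rule nn_integral_eq_integral) (use int True in \<open>auto simp: \<phi>_def\<close>)
        also have "expectation (\<lambda>\<omega>. \<phi> x (U l (i @ [j]) \<omega>)) = 1 - expectation (\<lambda>\<omega>. min x (U l (i @ [j]) \<omega>)) / x"
          unfolding \<phi>_def using int by (simp add: prob_space)
        also have "\<dots> = \<phi> x (w x)"
          using w[of j x] j True w_bounds[of x] by (simp add: \<phi>_def min_def)
        finally show "(\<integral>\<^sup>+\<omega>. ennreal (\<phi> x (U l (i @ [j]) \<omega>)) \<partial>M) = ennreal (\<phi> x (w x))" .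
      qed
      finally show ?thesis by simp
    next
      case False
      then show ?thesis by (cases k) (auto simp: erlang_density_def prob_space emeasure_space_1)
    qed
  qed
  also have "ennreal (child_law P i k) * (\<integral>\<^sup>+x. ?e x * indicator A x * ennreal (\<phi> x (w x)) ^ k \<partial>lborel) =
    (\<integral>\<^sup>+x. ennreal (child_law P i k) * (?e x * indicator A x * ennreal (\<phi> x (w x)) ^ k) \<partial>lborel)"
    by (rule nn_integral_cmult[symmetric]) (unfold \<phi>_def, measurable)
  also have "\<dots> = (\<integral>\<^sup>+x. ennreal (child_law P i k * (exp (- x) * ((x - w x) ^ k / fact k))) * indicator {0..} x * indicator A x \<partial>lborel)"
  proof (rule nn_integral_cong)
    fix x :: real
    show "ennreal (child_law P i k) * (?e x * indicator A x * ennreal (\<phi> x (w x)) ^ k) =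
      ennreal (child_law P i k * (exp (- x) * ((x - w x) ^ k / fact k))) * indicator {0..} x * indicator A x"
    proof (cases "x \<ge> 0 \<and> x \<in> A")
      case True
      then have wx: "0 \<le> w x" "w x \<le> x" using w_bounds by auto
      have "0 \<le> \<phi> x (w x)" using wx by (auto simp: \<phi>_def min_def divide_simps)
      then have "ennreal (child_law P i k) * (?e x * indicator A x * ennreal (\<phi> x (w x)) ^ k) =
        ennreal (child_law P i k * (erlang_density k 1 x * \<phi> x (w x) ^ k))"
        using True by (simp add: ennreal_power ennreal_mult)
      also have "erlang_density k 1 x * \<phi> x (w x) ^ k = exp (- x) * ((x - w x) ^ k / fact k)"
      proof (cases "x = 0")
        case True
        then show ?thesis using wx by (cases k) (auto simp: erlang_density_def)
      next
        case False
        then have "x ^ k * \<phi> x (w x) ^ k = (x - w x) ^ k"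
          using wx by (simp add: \<phi>_def min_def field_simps flip: power_mult_distrib)
        with \<open>x \<ge> 0 \<and> x \<in> A\<close> show ?thesis by (simp add: erlang_density_def mult_ac)
      qed
      finally show ?thesis using True by simp
    next
      case False
      then show ?thesis by (auto simp: erlang_density_def)
    qed
  qed
  also have "\<dots> = (\<integral>\<^sup>+x. ennreal (child_law P i k * (exp (- x) * ((x - w x) ^ k / fact k))) * indicator A x \<partial>half)"
    by (subst nn_integral_half) (auto intro!: nn_integral_cong simp: mult_ac)
  finally show ?thesis .
qed

lemma suminf_ennreal_surv:
  assumes "0 \<le> w" "w \<le> x"
  shows "(\<Sum>k. ennreal (child_law P i k * (exp (- x) * ((x ^ k - (x - w) ^ k) / fact k)))) =
    ennreal (surv (child_law P i) x w)"
proof -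
  have s: "summable (\<lambda>k. child_law P i k * ((x ^ k - (x - w) ^ k) / fact k))"
    by (intro summable_coeff_diff) (auto simp: child_law_le_1)
  have eq: "child_law P i k * (exp (- x) * ((x ^ k - (x - w) ^ k) / fact k)) =
     exp (- x) * (child_law P i k * ((x ^ k - (x - w) ^ k) / fact k))" for k
    by simp
  show ?thesis
    unfolding eq surv_def using s
    by (rule suminf_ennreal_cmult)
      (use assms in \<open>auto intro!: mult_nonneg_nonneg divide_nonneg_nonneg power_mono\<close>)
qed

lemma suminf_ennreal_dens:
  assumes "0 \<le> x"
  shows "(\<Sum>k. ennreal (child_law P i k * (exp (- x) * (x ^ k / fact k)))) =
    ennreal (dens (child_law P i) x)"
proof -
  have s: "summable (\<lambda>k. child_law P i k * (x ^ k / fact k))"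
    by (intro summable_coeff_power) (auto simp: child_law_le_1)
  have eq: "child_law P i k * (exp (- x) * (x ^ k / fact k)) =
     exp (- x) * (child_law P i k * (x ^ k / fact k))" for k
    by simp
  show ?thesis
    unfolding eq dens_def using s
    by (rule suminf_ennreal_cmult) (use assms in auto)
qed

lemma sets_degree_type:
  "i \<in> vertices \<Longrightarrow> A \<in> sets borel \<Longrightarrow> {\<omega> \<in> space M. n i \<omega> = k \<and> v i \<omega> \<in> A} \<in> events"
  by (intro sets.sets_Collect_conj measurable_sets_Collect[OF n_measurable]
      measurable_sets_Collect[OF v_measurable]) auto

lemma sets_no_child:
  assumes i: "i \<in> vertices" and [measurable]: "A \<in> sets borel"
  shows "{\<omega> \<in> space M. n i \<omega> = k \<and> v i \<omega> \<in> A \<and> (\<forall>j\<in>{1..k}. U l (i @ [j]) \<omega> \<le> \<zeta> (i @ [j]) \<omega>)} \<in> events"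
proof -
  note [measurable] = n_measurable[OF i] v_measurable[OF i]
  have [measurable]: "random_variable borel (U l (i @ [j]))" "random_variable borel (\<zeta> (i @ [j]))" if "j \<in> {1..k}" for j
    using measurable_U_child[OF i that] measurable_zeta[OF i that] by auto
  show ?thesis by measurable
qed

lemma emeasure_type:
  assumes i: "i \<in> vertices" and A: "A \<in> sets borel"
  shows "emeasure M {\<omega> \<in> space M. v i \<omega> \<in> A} =
    (\<integral>\<^sup>+x. ennreal (dens (child_law P i) x) * indicator A x \<partial>half)"
proof -
  define S where "S k = {\<omega> \<in> space M. n i \<omega> = k \<and> v i \<omega> \<in> A}" for k
  have "emeasure M {\<omega> \<in> space M. v i \<omega> \<in> A} = emeasure M (\<Union>k. S k)"
    by (rule arg_cong[where f = "emeasure M"]) (auto simp: S_def)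
  also have "\<dots> = (\<Sum>k. emeasure M (S k))"
    using sets_degree_type[OF i A]
    by (intro suminf_emeasure[symmetric]) (auto simp: S_def disjoint_family_on_def)
  also have "\<dots> = (\<integral>\<^sup>+x. (\<Sum>k. ennreal (child_law P i k * (exp (- x) * (x ^ k / fact k))) * indicator A x) \<partial>half)"
    unfolding S_def emeasure_degree_type[OF i A] using A by (subst nn_integral_suminf) auto
  also have "\<dots> = (\<integral>\<^sup>+x. ennreal (dens (child_law P i) x) * indicator A x \<partial>half)"
    by (rule nn_integral_cong_AE) (use AE_half in \<open>eventually_elim, simp only: ennreal_suminf_multc suminf_ennreal_dens\<close>)
  finally show ?thesis .
qed

text \<open>Survival has no product form, but its complement does once the degree is fixed.
  Subtracting degree by degree and then summing over degrees yields the series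
  \<open>surv\<close>.\<close>

lemma emeasure_some_child:
  assumes i: "i \<in> vertices" and A: "A \<in> sets borel"
    and w: "\<And>j x. 1 \<le> j \<Longrightarrow> 0 \<le> x \<Longrightarrow> expectation (\<lambda>\<omega>. min x (U l (i @ [j]) \<omega>)) = w x"
    and w_bounds: "\<And>x. 0 \<le> x \<Longrightarrow> 0 \<le> w x" "\<And>x. 0 \<le> x \<Longrightarrow> w x \<le> x"
    and w_meas [measurable]: "w \<in> borel_measurable borel"
  shows "emeasure M {\<omega> \<in> space M. (\<exists>j\<in>{1..n i \<omega>}. \<zeta> (i @ [j]) \<omega> < U l (i @ [j]) \<omega>) \<and> v i \<omega> \<in> A} =
    (\<integral>\<^sup>+x. ennreal (surv (child_law P i) x (w x)) * indicator A x \<partial>half)"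
proof -
  define S where "S k = {\<omega> \<in> space M. n i \<omega> = k \<and> v i \<omega> \<in> A}" for k
  define S' where "S' k = {\<omega> \<in> space M. n i \<omega> = k \<and> v i \<omega> \<in> A \<and>
    (\<forall>j\<in>{1..k}. U l (i @ [j]) \<omega> \<le> \<zeta> (i @ [j]) \<omega>)}" for k
  note [measurable] = A
  have S: "S k \<in> events" and S': "S' k \<in> events" for k
    unfolding S_def S'_def by (intro sets_degree_type sets_no_child i A)+
  let ?c = "child_law P i"
  have diff: "emeasure M (S k - S' k) =
     (\<integral>\<^sup>+x. ennreal (?c k * (exp (- x) * ((x ^ k - (x - w x) ^ k) / fact k))) * indicator A x \<partial>half)" for k
  proof -
    have "emeasure M (S k - S' k) = emeasure M (S k) - emeasure M (S' k)"
      using S S' by (intro emeasure_Diff) (auto simp: S_def S'_def)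
    also have "\<dots> = (\<integral>\<^sup>+x. ennreal (?c k * (exp (- x) * (x ^ k / fact k))) * indicator A x \<partial>half) -
       (\<integral>\<^sup>+x. ennreal (?c k * (exp (- x) * ((x - w x) ^ k / fact k))) * indicator A x \<partial>half)"
      unfolding S_def S'_def
      by (simp only: emeasure_degree_type[OF i A] emeasure_no_child[OF i A w w_bounds w_meas])
    also have "\<dots> = (\<integral>\<^sup>+x. ennreal (?c k * (exp (- x) * (x ^ k / fact k))) * indicator A x -
       ennreal (?c k * (exp (- x) * ((x - w x) ^ k / fact k))) * indicator A x \<partial>half)"
    proof (rule nn_integral_diff[symmetric])
      have "(\<integral>\<^sup>+x. ennreal (?c k * (exp (- x) * ((x - w x) ^ k / fact k))) * indicator A x \<partial>half) = emeasure M (S' k)"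
        unfolding S'_def by (simp only: emeasure_no_child[OF i A w w_bounds w_meas])
      then show "(\<integral>\<^sup>+x. ennreal (?c k * (exp (- x) * ((x - w x) ^ k / fact k))) * indicator A x \<partial>half) \<noteq> \<infinity>"
        by simp
      show "AE x in half. ennreal (?c k * (exp (- x) * ((x - w x) ^ k / fact k))) * indicator A x \<le>
          ennreal (?c k * (exp (- x) * (x ^ k / fact k))) * indicator A x"
        using AE_half
      proof eventually_elim
        case (elim x)
        with w_bounds[of x] have "(x - w x) ^ k \<le> x ^ k" by (intro power_mono) auto
        then show ?case
          by (intro mult_right_mono ennreal_leI mult_left_mono divide_right_mono) auto
      qed
    qed measurable
    also have "\<dots> = (\<integral>\<^sup>+x. ennreal (?c k * (exp (- x) * ((x ^ k - (x - w x) ^ k) / fact k))) * indicator A x \<partial>half)"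
    proof (rule nn_integral_cong_AE)
      show "AE x in half. ennreal (?c k * (exp (- x) * (x ^ k / fact k))) * indicator A x -
         ennreal (?c k * (exp (- x) * ((x - w x) ^ k / fact k))) * indicator A x =
         ennreal (?c k * (exp (- x) * ((x ^ k - (x - w x) ^ k) / fact k))) * indicator A x"
        using AE_half
      proof eventually_elim
        case (elim x)
        then have "0 \<le> ?c k * (exp (- x) * ((x - w x) ^ k / fact k))"
          using w_bounds[of x] by auto
        moreover have "?c k * (exp (- x) * (x ^ k / fact k)) - ?c k * (exp (- x) * ((x - w x) ^ k / fact k)) =
          ?c k * (exp (- x) * ((x ^ k - (x - w x) ^ k) / fact k))"
          by (simp add: diff_divide_distrib right_diff_distrib)
        ultimately show ?case
          by (cases "x \<in> A") (simp_all add: ennreal_minus)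
      qed
    qed
    finally show ?thesis .
  qed
  have "emeasure M {\<omega> \<in> space M. (\<exists>j\<in>{1..n i \<omega>}. \<zeta> (i @ [j]) \<omega> < U l (i @ [j]) \<omega>) \<and> v i \<omega> \<in> A} =
    emeasure M (\<Union>k. S k - S' k)"
    by (rule arg_cong[where f = "emeasure M"]) (fastforce simp: S_def S'_def not_le)
  also have "\<dots> = (\<Sum>k. emeasure M (S k - S' k))"
    using S S' by (intro suminf_emeasure[symmetric]) (auto simp: S_def disjoint_family_on_def)
  also have "\<dots> = (\<integral>\<^sup>+x. (\<Sum>k. ennreal (?c k * (exp (- x) * ((x ^ k - (x - w x) ^ k) / fact k))) * indicator A x) \<partial>half)"
    unfolding diff by (subst nn_integral_suminf) auto
  also have "\<dots> = (\<integral>\<^sup>+x. ennreal (surv ?c x (w x)) * indicator A x \<partial>half)"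
    by (rule nn_integral_cong_AE)
      (use AE_half in \<open>eventually_elim, simp only: ennreal_suminf_multc suminf_ennreal_surv w_bounds\<close>)
  finally show ?thesis .
qed

text \<open>Restricting M to the event and pushing forward along \<open>v i\<close> gives
  \<open>half\<close> with density h, since both measures agree on Borel sets. This carries set
  formulas over to integrals of functions such as \<open>min x\<close>.\<close>

lemma nn_integral_type:
  assumes i: "i \<in> vertices" and E [measurable]: "Measurable.pred M E"
    and h [measurable]: "h \<in> borel_measurable borel"
    and law: "\<And>A. A \<in> sets borel \<Longrightarrow> emeasure M {\<omega> \<in> space M. E \<omega> \<and> v i \<omega> \<in> A} =
      (\<integral>\<^sup>+x. h x * indicator A x \<partial>half)"
    and f [measurable]: "f \<in> borel_measurable borel"
  shows "(\<integral>\<^sup>+\<omega>. indicator {\<omega>. E \<omega>} \<omega> * f (v i \<omega>) \<partial>M) = (\<integral>\<^sup>+x. h x * f x \<partial>half)"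
proof -
  note [measurable] = v_measurable[OF i]
  have "distr (density M (indicator {\<omega>. E \<omega>})) borel (v i) = density half h"
  proof (rule measure_eqI)
    fix A assume "A \<in> sets (distr (density M (indicator {\<omega>. E \<omega>})) borel (v i))"
    then have A [measurable]: "A \<in> sets borel" by simp
    have "emeasure (distr (density M (indicator {\<omega>. E \<omega>})) borel (v i)) A =
       (\<integral>\<^sup>+\<omega>. indicator {\<omega>. E \<omega>} \<omega> * indicator (v i -` A \<inter> space M) \<omega> \<partial>M)"
      by (simp add: emeasure_distr emeasure_density)
    also have "\<dots> = (\<integral>\<^sup>+\<omega>. indicator {\<omega> \<in> space M. E \<omega> \<and> v i \<omega> \<in> A} \<omega> \<partial>M)"
      by (intro nn_integral_cong) (auto simp: indicator_def)
    also have "\<dots> = emeasure (density half h) A"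
      using law[OF A] by (simp add: emeasure_density)
    finally show "emeasure (distr (density M (indicator {\<omega>. E \<omega>})) borel (v i)) A = emeasure (density half h) A" .
  qed simp
  then have "(\<integral>\<^sup>+x. f x \<partial>distr (density M (indicator {\<omega>. E \<omega>})) borel (v i)) = (\<integral>\<^sup>+x. f x \<partial>density half h)"
    by simp
  then show ?thesis by (simp add: nn_integral_distr nn_integral_density)
qed

section \<open>The recursion for truncated mean lifetimes, and extinction as a limit\<close>

lemma child_law_root: "child_law P [] = pmf P"
  by (simp add: child_law_def fun_eq_iff)

lemma child_law_offspring: "i \<noteq> [] \<Longrightarrow> child_law P i = offspring P"
  by (simp add: child_law_def offspring_def fun_eq_iff)

lemma U_bounds: "0 \<le> U l i \<omega>"
  by (simp add: U_def lifetime_nonneg)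

lemma expectation_U_bounds:
  assumes "i \<in> vertices" "0 \<le> x"
  shows "0 \<le> expectation (\<lambda>\<omega>. min x (U l i \<omega>))" "expectation (\<lambda>\<omega>. min x (U l i \<omega>)) \<le> x"
proof -
  note [measurable] = measurable_U[OF assms(1)]
  show "0 \<le> expectation (\<lambda>\<omega>. min x (U l i \<omega>))"
    using assms U_bounds by (intro integral_nonneg_AE) auto
  have "expectation (\<lambda>\<omega>. min x (U l i \<omega>)) \<le> expectation (\<lambda>\<omega>. x)"
    using assms U_bounds by (intro integral_mono integrable_const_bound[where B = x]) auto
  then show "expectation (\<lambda>\<omega>. min x (U l i \<omega>)) \<le> x" by (simp add: prob_space)
qed

lemma sets_some_child:
  assumes i: "i \<in> vertices"
  shows "Measurable.pred M (\<lambda>\<omega>. \<exists>j\<in>{1..n i \<omega>}. \<zeta> (i @ [j]) \<omega> < U l (i @ [j]) \<omega>)"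
proof -
  note [measurable] = n_measurable[OF i]
  have [measurable]: "random_variable borel (U l (i @ [j]))" "random_variable borel (\<zeta> (i @ [j]))" if "1 \<le> j" for j
    using i that by (auto intro!: measurable_U child_vertices cost_measurable)
  have "Measurable.pred M (\<lambda>\<omega>. \<exists>j\<in>{1..}. j \<le> n i \<omega> \<and> \<zeta> (i @ [j]) \<omega> < U l (i @ [j]) \<omega>)"
    by measurable
  moreover have "(\<exists>j\<in>{1..n i \<omega>}. \<zeta> (i @ [j]) \<omega> < U l (i @ [j]) \<omega>) \<longleftrightarrow>
     (\<exists>j\<in>{1..}. j \<le> n i \<omega> \<and> \<zeta> (i @ [j]) \<omega> < U l (i @ [j]) \<omega>)" for \<omega>
    by auto
  ultimately show ?thesis by simp
qed

text \<open>All vertices other than the root have the same degree law, so the induction hypothesis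
  supplies one function \<open>W\<close> for every child. Both cases integrate \<open>min x\<close>
  against the law of \<open>v i\<close>: on the whole space for l = 0, and on the event that some
  child edge succeeds otherwise.\<close>

lemma expectation_U:
  "i \<in> vertices \<Longrightarrow> i \<noteq> [] \<Longrightarrow> 0 \<le> x \<Longrightarrow> expectation (\<lambda>\<omega>. min x (U l i \<omega>)) = W (offspring P) l x"
proof (induction l arbitrary: i x)
  case 0
  note [measurable] = v_measurable[OF 0(1)]
  have "expectation (\<lambda>\<omega>. min x (U 0 i \<omega>)) = enn2real (\<integral>\<^sup>+\<omega>. indicator {\<omega>. True} \<omega> * ennreal (min x (max 0 (v i \<omega>))) \<partial>M)"
    using 0(3) by (subst integral_eq_nn_integral) (auto simp: U_def)
  also have "(\<integral>\<^sup>+\<omega>. indicator {\<omega>. True} \<omega> * ennreal (min x (max 0 (v i \<omega>))) \<partial>M) =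
      (\<integral>\<^sup>+z. ennreal (dens (offspring P) z) * ennreal (min x (max 0 z)) \<partial>half)"
    by (rule nn_integral_type[OF 0(1), where E = "\<lambda>_. True" and f = "\<lambda>z. ennreal (min x (max 0 z))"])
      (auto simp: emeasure_type[OF 0(1)] child_law_offspring[OF 0(2)])
  also have "\<dots> = (\<integral>\<^sup>+z. ennreal (min x z * dens (offspring P) z) \<partial>half)"
    by (rule nn_integral_cong_AE)
      (use AE_half in \<open>eventually_elim, subst mult.commute, simp add: max_absorb2 dens_nonneg[OF offspring_bounds] ennreal_mult''\<close>)
  also have "enn2real \<dots> = W (offspring P) 0 x"
    unfolding W.simps by (subst integral_eq_nn_integral)
      (use AE_half in \<open>auto intro!: mult_nonneg_nonneg dens_nonneg offspring_bounds simp: 0(3) elim!: eventually_mono\<close>)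
  finally show ?case .
next
  case (Suc l)
  note i = Suc.prems(1)
  note [measurable] = v_measurable[OF i] sets_some_child[OF i]
  let ?E = "\<lambda>\<omega>. \<exists>j\<in>{1..n i \<omega>}. \<zeta> (i @ [j]) \<omega> < U l (i @ [j]) \<omega>"
  have w: "expectation (\<lambda>\<omega>. min x (U l (i @ [j]) \<omega>)) = W (offspring P) l x" if "1 \<le> j" "0 \<le> x" for j x
    using that i by (intro Suc.IH child_vertices) auto
  have w_bounds: "0 \<le> W (offspring P) l x" "W (offspring P) l x \<le> x" if "0 \<le> x" for x
    using expectation_U_bounds[OF child_vertices[OF i order_refl] that, of l] w[OF order_refl that] by auto
  have nn: "0 \<le> surv (offspring P) z (W (offspring P) l z)" if "0 \<le> z" for z
    using that by (intro surv_nonneg offspring_bounds w_bounds)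
  have "expectation (\<lambda>\<omega>. min x (U (Suc l) i \<omega>)) = enn2real (\<integral>\<^sup>+\<omega>. ennreal (min x (U (Suc l) i \<omega>)) \<partial>M)"
    using Suc.prems(3) measurable_U[OF i, of "Suc l"] U_bounds[of "Suc l" i]
    by (subst integral_eq_nn_integral) auto
  also have "(\<integral>\<^sup>+\<omega>. ennreal (min x (U (Suc l) i \<omega>)) \<partial>M) =
     (\<integral>\<^sup>+\<omega>. indicator {\<omega>. ?E \<omega>} \<omega> * ennreal (min x (max 0 (v i \<omega>))) \<partial>M)"
    using Suc.prems(3) by (intro nn_integral_cong) (simp add: U_Suc)
  also have "\<dots> = (\<integral>\<^sup>+z. ennreal (surv (offspring P) z (W (offspring P) l z)) * ennreal (min x (max 0 z)) \<partial>half)"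
    by (rule nn_integral_type[OF i, where E = ?E and f = "\<lambda>z. ennreal (min x (max 0 z))"])
      (use emeasure_some_child[OF i _ w w_bounds] sets_some_child[OF i] in \<open>auto simp: child_law_offspring[OF Suc.prems(2)]\<close>)
  also have "\<dots> = (\<integral>\<^sup>+z. ennreal (min x z * surv (offspring P) z (W (offspring P) l z)) \<partial>half)"
    by (rule nn_integral_cong_AE)
      (use AE_half in \<open>eventually_elim, subst mult.commute, simp add: max_absorb2 nn ennreal_mult''\<close>)
  also have "enn2real \<dots> = W (offspring P) (Suc l) x"
    unfolding W.simps by (subst integral_eq_nn_integral)
      (use AE_half in \<open>auto intro!: mult_nonneg_nonneg nn simp: Suc.prems(3) elim!: eventually_mono\<close>)
  finally show ?case .
qed

text \<open>Read off from the tree: at the vertex [1] the iterate is an expectation of a variable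
  with values in [0, x].\<close>

lemma W_bounds:
  assumes "0 \<le> x"
  shows "0 \<le> W (offspring P) l x" "W (offspring P) l x \<le> x"
  using expectation_U[of "[1]" x l] expectation_U_bounds[of "[1]" x l] assms
  by (auto simp: vertices_def)

text \<open>Reaching depth l + 1 is harder than reaching depth l, so the lifetimes decrease at every
  sample point, and their expectations with them.\<close>

lemma W_Suc_le: "0 \<le> x \<Longrightarrow> W (offspring P) (Suc l) x \<le> W (offspring P) l x"
proof -
  assume x: "0 \<le> x"
  have le: "U (Suc l) i \<omega> \<le> U l i \<omega>" for i \<omega>
  proof (induction l arbitrary: i)
    case 0
    then show ?case by (auto simp: U_def)
  next
    case (Suc l)
    then have "(\<exists>j\<in>{1..n i \<omega>}. \<zeta> (i @ [j]) \<omega> < U (Suc l) (i @ [j]) \<omega>) \<Longrightarrow>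
      (\<exists>j\<in>{1..n i \<omega>}. \<zeta> (i @ [j]) \<omega> < U l (i @ [j]) \<omega>)"
      by (meson less_le_trans)
    then show ?case unfolding U_Suc by (smt (verit))
  qed
  have v: "[Suc 0] \<in> vertices" by (simp add: vertices_def)
  note [measurable] = measurable_U[OF v]
  have le': "min x (U (Suc l) [Suc 0] \<omega>) \<le> min x (U l [Suc 0] \<omega>)" for \<omega>
    using le by (intro min.mono) auto
  have "expectation (\<lambda>\<omega>. min x (U (Suc l) [Suc 0] \<omega>)) \<le> expectation (\<lambda>\<omega>. min x (U l [Suc 0] \<omega>))"
    using x le' U_bounds
    by (intro integral_mono integrable_const_bound[where B = x]) auto
  then show ?thesis using x v by (simp add: expectation_U)
qed

text \<open>A negative cost would lie below the lifetime 0 of a child that fails, and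
  \<open>U\<close> would then disagree with \<open>reach\<close>. For fixed vertex, degree and j,
  one factor in \<open>node_law\<close> vanishes; there are only countably many choices.\<close>

lemma AE_cost_nonneg: "AE \<omega> in M. \<forall>i\<in>vertices. \<forall>j\<in>{1..n i \<omega>}. 0 \<le> \<zeta> (i @ [j]) \<omega>"
proof -
  have "AE \<omega> in M. n i \<omega> = k \<longrightarrow> 0 \<le> \<zeta> (i @ [j]) \<omega>" if i: "i \<in> vertices" and j: "j \<in> {1..k}" for i j k
  proof -
    have "emeasure (uniform_measure lborel {0..x}) {..<0::real} = 0" for x
    proof -
      have "{0..x} \<inter> {..<0} = {}" by auto
      then show ?thesis by (cases "x < 0") (auto simp: uniform_measure_def emeasure_density nn_integral_0_iff_AE indicator_def)
    qed
    then have P0: "(\<Prod>j'\<in>{1..k}. emeasure (uniform_measure lborel {0..x}) (if j' = j then {..<0::real} else UNIV)) = 0" for x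
      using j by (intro prod_zero) (auto intro!: bexI[of _ j])
    have "emeasure M {\<omega> \<in> space M. n i \<omega> = k \<and> v i \<omega> \<in> UNIV \<and> (\<forall>j'\<in>{1..k}. \<zeta> (i @ [j']) \<omega> \<in> (if j' = j then {..<0} else UNIV))} =
      ennreal (child_law P i k) * (\<integral>\<^sup>+x\<in>UNIV. ennreal (erlang_density k 1 x) *
        (\<Prod>j'\<in>{1..k}. emeasure (uniform_measure lborel {0..x}) (if j' = j then {..<0} else UNIV)) \<partial>lborel)"
      by (rule node_law[OF i]) auto
    also have "\<dots> = 0" unfolding P0 by simp
    finally have "emeasure M {\<omega> \<in> space M. n i \<omega> = k \<and> v i \<omega> \<in> UNIV \<and> (\<forall>j'\<in>{1..k}. \<zeta> (i @ [j']) \<omega> \<in> (if j' = j then {..<0} else UNIV))} = 0" .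
    moreover have "{\<omega> \<in> space M. n i \<omega> = k \<and> v i \<omega> \<in> UNIV \<and> (\<forall>j'\<in>{1..k}. \<zeta> (i @ [j']) \<omega> \<in> (if j' = j then {..<0} else UNIV))} =
      {\<omega> \<in> space M. \<not> (n i \<omega> = k \<longrightarrow> 0 \<le> \<zeta> (i @ [j]) \<omega>)}"
      using j by auto
    ultimately have "emeasure M {\<omega> \<in> space M. \<not> (n i \<omega> = k \<longrightarrow> 0 \<le> \<zeta> (i @ [j]) \<omega>)} = 0" by simp
    moreover have "{\<omega> \<in> space M. \<not> (n i \<omega> = k \<longrightarrow> 0 \<le> \<zeta> (i @ [j]) \<omega>)} \<in> events"
    proof -
      have [measurable]: "random_variable (count_space UNIV) (n i)" "random_variable borel (\<zeta> (i @ [j]))"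
        using n_measurable[OF i] measurable_zeta[OF i j] by auto
      show ?thesis by measurable
    qed
    ultimately show ?thesis by (intro AE_iff_measurable[OF _ refl, THEN iffD2])
  qed
  then have "AE \<omega> in M. \<forall>i\<in>vertices. \<forall>k. \<forall>j\<in>{1..k}. n i \<omega> = k \<longrightarrow> 0 \<le> \<zeta> (i @ [j]) \<omega>"
    unfolding AE_ball_countable[OF countableI_type] AE_all_countable by blast
  then show ?thesis by eventually_elim auto
qed

lemma AE_U_reach:
  "AE \<omega> in M. \<forall>l. \<forall>i\<in>vertices. U l i \<omega> =
     (if reach l (\<lambda>i. n i \<omega>) (\<lambda>i. v i \<omega>) (\<lambda>i. \<zeta> i \<omega>) i then max 0 (v i \<omega>) else 0)"
  using AE_cost_nonneg
proof eventually_elim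
  case (elim \<omega>)
  have "U l i \<omega> = (if reach l (\<lambda>i. n i \<omega>) (\<lambda>i. v i \<omega>) (\<lambda>i. \<zeta> i \<omega>) i then max 0 (v i \<omega>) else 0)"
    if "i \<in> vertices" for l i
    using that
  proof (induction l arbitrary: i)
    case 0
    then show ?case by (simp add: U_def)
  next
    case (Suc l)
    have "\<zeta> (i @ [j]) \<omega> < U l (i @ [j]) \<omega> \<longleftrightarrow> \<zeta> (i @ [j]) \<omega> < v (i @ [j]) \<omega> \<and>
        reach l (\<lambda>i. n i \<omega>) (\<lambda>i. v i \<omega>) (\<lambda>i. \<zeta> i \<omega>) (i @ [j])"
      if "j \<in> {1..n i \<omega>}" for j
    proof -
      have "0 \<le> \<zeta> (i @ [j]) \<omega>" using elim Suc.prems that by blast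
      moreover have "i @ [j] \<in> vertices" using Suc.prems that by (intro child_vertices) auto
      note Suc.IH[OF this]
      ultimately show ?thesis by (auto simp: less_max_iff_disj)
    qed
    then have "(\<exists>j\<in>{1..n i \<omega>}. \<zeta> (i @ [j]) \<omega> < U l (i @ [j]) \<omega>) \<longleftrightarrow>
        (\<exists>j\<in>{1..n i \<omega>}. \<zeta> (i @ [j]) \<omega> < v (i @ [j]) \<omega> \<and>
          reach l (\<lambda>i. n i \<omega>) (\<lambda>i. v i \<omega>) (\<lambda>i. \<zeta> i \<omega>) (i @ [j]))"
      by (intro bex_cong refl)
    then show ?case unfolding U_Suc reach.simps by (rule if_cong) (rule refl)+
  qed
  then show ?case by blast
qed

lemma pred_reach:
  "i \<in> vertices \<Longrightarrow> Measurable.pred M (\<lambda>\<omega>. reach l (\<lambda>i. n i \<omega>) (\<lambda>i. v i \<omega>) (\<lambda>i. \<zeta> i \<omega>) i)"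
proof (induction l arbitrary: i)
  case (Suc l)
  note [measurable] = n_measurable[OF Suc.prems]
  have [measurable]: "random_variable borel (v (i @ [j]))" "random_variable borel (\<zeta> (i @ [j]))"
     "Measurable.pred M (\<lambda>\<omega>. reach l (\<lambda>i. n i \<omega>) (\<lambda>i. v i \<omega>) (\<lambda>i. \<zeta> i \<omega>) (i @ [j]))" if "1 \<le> j" for j
    using Suc.prems that by (auto intro!: v_measurable child_vertices cost_measurable Suc.IH)
  have "Measurable.pred M (\<lambda>\<omega>. \<exists>j\<in>{1..}. j \<le> n i \<omega> \<and> \<zeta> (i @ [j]) \<omega> < v (i @ [j]) \<omega> \<and>
     reach l (\<lambda>i. n i \<omega>) (\<lambda>i. v i \<omega>) (\<lambda>i. \<zeta> i \<omega>) (i @ [j]))"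
    by measurable
  moreover have "reach (Suc l) (\<lambda>i. n i \<omega>) (\<lambda>i. v i \<omega>) (\<lambda>i. \<zeta> i \<omega>) i \<longleftrightarrow>
    (\<exists>j\<in>{1..}. j \<le> n i \<omega> \<and> \<zeta> (i @ [j]) \<omega> < v (i @ [j]) \<omega> \<and>
     reach l (\<lambda>i. n i \<omega>) (\<lambda>i. v i \<omega>) (\<lambda>i. \<zeta> i \<omega>) (i @ [j]))" for \<omega>
    by auto
  ultimately show ?case by simp
qed simp

definition survive_prob :: "nat \<Rightarrow> real" where
  "survive_prob l = (\<integral>z. surv (pmf P) z (W (offspring P) l z) \<partial>half)"

text \<open>Only the root has degree law P, so the last step applies \<open>surv\<close> with
  \<open>pmf P\<close> to the l-th iterate of its children. Index l therefore belongs to depth l +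
  1.\<close>

lemma prob_reach_root:
  "prob {\<omega> \<in> space M. reach (Suc l) (\<lambda>i. n i \<omega>) (\<lambda>i. v i \<omega>) (\<lambda>i. \<zeta> i \<omega>) []} = survive_prob l"
proof -
  have o: "[] \<in> vertices" by (simp add: vertices_def)
  have w: "expectation (\<lambda>\<omega>. min x (U l ([] @ [j]) \<omega>)) = W (offspring P) l x" if "1 \<le> j" "0 \<le> x" for j x
    using that o by (intro expectation_U child_vertices) auto
  let ?E = "\<lambda>\<omega>. \<exists>j\<in>{1..n [] \<omega>}. \<zeta> ([] @ [j]) \<omega> < U l ([] @ [j]) \<omega>"
  have nn: "AE z in half. 0 \<le> surv (pmf P) z (W (offspring P) l z)"
    using AE_half by eventually_elim (auto intro!: surv_nonneg W_bounds pmf_le_1)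
  have "emeasure M {\<omega> \<in> space M. ?E \<omega>} = (\<integral>\<^sup>+z. ennreal (surv (pmf P) z (W (offspring P) l z)) \<partial>half)"
    using emeasure_some_child[OF o _ w W_bounds, of UNIV] by (simp add: child_law_root)
  then have "prob {\<omega> \<in> space M. ?E \<omega>} = survive_prob l"
    unfolding survive_prob_def using nn by (simp add: integral_eq_nn_integral measure_def)
  moreover have "prob {\<omega> \<in> space M. ?E \<omega>} =
      prob {\<omega> \<in> space M. reach (Suc l) (\<lambda>i. n i \<omega>) (\<lambda>i. v i \<omega>) (\<lambda>i. \<zeta> i \<omega>) []}"
  proof (rule measure_eq_AE)
    show "AE \<omega> in M. (\<omega> \<in> {\<omega> \<in> space M. ?E \<omega>}) \<longleftrightarrow>
       (\<omega> \<in> {\<omega> \<in> space M. reach (Suc l) (\<lambda>i. n i \<omega>) (\<lambda>i. v i \<omega>) (\<lambda>i. \<zeta> i \<omega>) []})"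
      using AE_U_reach AE_cost_nonneg
    proof eventually_elim
      case (elim \<omega>)
      have "\<zeta> [j] \<omega> < U l [j] \<omega> \<longleftrightarrow> \<zeta> [j] \<omega> < v [j] \<omega> \<and>
          reach l (\<lambda>i. n i \<omega>) (\<lambda>i. v i \<omega>) (\<lambda>i. \<zeta> i \<omega>) [j]" if "j \<in> {1..n [] \<omega>}" for j
        using elim(1)[rule_format, of "[j]" l] elim(2)[rule_format, OF o that] that
        by (auto simp: vertices_def)
      then have "(\<exists>j\<in>{1..n [] \<omega>}. \<zeta> [j] \<omega> < U l [j] \<omega>) \<longleftrightarrow> (\<exists>j\<in>{1..n [] \<omega>}. \<zeta> [j] \<omega> < v [j] \<omega> \<and>
          reach l (\<lambda>i. n i \<omega>) (\<lambda>i. v i \<omega>) (\<lambda>i. \<zeta> i \<omega>) [j])"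
        by (intro bex_cong refl)
      then show ?case by simp
    qed
  qed (intro predE sets_some_child[OF o] pred_reach[OF o])+
  ultimately show ?thesis by simp
qed

text \<open>Extinction by depth l + 1 is an increasing event in l, by \<open>reach_Suc_imp\<close>,
  so continuity from below applies. The shift matches the union over l \<ge> 1.\<close>

lemma extinction_limit: "(\<lambda>l. 1 - survive_prob l) \<longlonglongrightarrow> extinction_prob M n v \<zeta>"
proof -
  have o: "[] \<in> vertices" by (simp add: vertices_def)
  let ?R = "\<lambda>l \<omega>. reach l (\<lambda>i. n i \<omega>) (\<lambda>i. v i \<omega>) (\<lambda>i. \<zeta> i \<omega>) []"
  define E where "E l = {\<omega> \<in> space M. \<not> ?R (Suc l) \<omega>}" for l
  have "range E \<subseteq> events"
    unfolding E_def by (intro image_subsetI sets.sets_Collect_neg predE pred_reach o)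
  moreover have "incseq E"
  proof (rule incseq_SucI)
    show "E l \<subseteq> E (Suc l)" for l
    proof
      fix \<omega> assume "\<omega> \<in> E l"
      then have "\<omega> \<in> space M" "\<not> ?R (Suc l) \<omega>" by (auto simp only: E_def)
      then show "\<omega> \<in> E (Suc l)" unfolding E_def using reach_Suc_imp[of "Suc l"] by blast
    qed
  qed
  ultimately have "(\<lambda>l. prob (E l)) \<longlonglongrightarrow> prob (\<Union>l. E l)"
    by (rule finite_Lim_measure_incseq)
  moreover have "prob (E l) = 1 - survive_prob l" for l
  proof -
    have "E l = space M - {\<omega> \<in> space M. ?R (Suc l) \<omega>}" unfolding E_def by blast
    then show ?thesis
      by (simp only: prob_compl[OF predE[OF pred_reach[OF o]]] prob_reach_root)
  qed
  moreover have "(\<Union>l. E l) = (\<Union>l\<in>{1..}. {\<omega> \<in> space M. ewt_Z (\<lambda>i. n i \<omega>) (\<lambda>i. v i \<omega>) (\<lambda>i. \<zeta> i \<omega>) l = 0})"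
  proof -
    have "{1..} = range Suc" by (auto simp: image_iff Suc_le_eq gr0_conv_Suc)
    then show ?thesis by (simp add: E_def ewt_Z_eq_0_iff del: reach.simps)
  qed
  ultimately show ?thesis by (simp add: extinction_prob_def)
qed

end

subsection \<open>The linearised equation\<close>

text \<open>After the shift z - x this is the total mass of the Erlang density of shape 2 and rate
  a, up to the factor e^(-a x) / a^2.\<close>

lemma nn_integral_linear_exp:
  fixes a x :: real
  assumes "0 < a"
  shows "(\<integral>\<^sup>+z. ennreal (max 0 (z - x) * exp (- a * z)) \<partial>lborel) = ennreal (exp (- a * x) / a\<^sup>2)"
proof -
  interpret E: prob_space "density lborel (erlang_density 1 a)"
    using assms by (rule prob_space_erlang_density)
  have "(\<integral>\<^sup>+t. ennreal (erlang_density 1 a t) \<partial>lborel) = 1"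
    using E.emeasure_space_1 by (simp add: emeasure_density)
  then have "ennreal (exp (- a * x) / a\<^sup>2) = ennreal (exp (- a * x) / a\<^sup>2) * (\<integral>\<^sup>+t. ennreal (erlang_density 1 a t) \<partial>lborel)"
    by simp
  also have "\<dots> = (\<integral>\<^sup>+t. ennreal (exp (- a * x) / a\<^sup>2) * ennreal (erlang_density 1 a t) \<partial>lborel)"
    by (subst nn_integral_cmult) auto
  also have "\<dots> = (\<integral>\<^sup>+z. ennreal (exp (- a * x) / a\<^sup>2) * ennreal (erlang_density 1 a (z - x)) \<partial>lborel)"
    by (subst nn_integral_real_affine[of _ 1 "- x"]) (auto simp: ac_simps)
  also have "\<dots> = (\<integral>\<^sup>+z. ennreal (max 0 (z - x) * exp (- a * z)) \<partial>lborel)"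
  proof (rule nn_integral_cong)
    fix z :: real
    have "exp (- a * x) / a\<^sup>2 * erlang_density 1 a (z - x) = max 0 (z - x) * exp (- a * z)"
      using assms
      by (auto simp: erlang_density_def max_def power2_eq_square field_simps simp flip: exp_add)
    then show "ennreal (exp (- a * x) / a\<^sup>2) * ennreal (erlang_density 1 a (z - x)) =
       ennreal (max 0 (z - x) * exp (- a * z))"
      using assms by (simp add: ennreal_mult'[symmetric])
  qed
  finally show ?thesis by simp
qed

lemma nn_integral_exp_Ici:
  fixes a :: real
  assumes "0 < a"
  shows "(\<integral>\<^sup>+z. ennreal (exp (- a * z)) * indicator {0..} z \<partial>lborel) = ennreal (1 / a)"
proof -
  interpret E: prob_space "density lborel (erlang_density 0 a)"
    using assms by (rule prob_space_erlang_density)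
  have "ennreal (1 / a) = ennreal (1 / a) * (\<integral>\<^sup>+t. ennreal (erlang_density 0 a t) \<partial>lborel)"
    using E.emeasure_space_1 by (simp add: emeasure_density)
  also have "\<dots> = (\<integral>\<^sup>+t. ennreal (1 / a) * ennreal (erlang_density 0 a t) \<partial>lborel)"
    by (subst nn_integral_cmult) auto
  also have "\<dots> = (\<integral>\<^sup>+z. ennreal (exp (- a * z)) * indicator {0..} z \<partial>lborel)"
    using assms by (intro nn_integral_cong)
      (auto simp: erlang_density_def indicator_def ennreal_mult'[symmetric])
  finally show ?thesis by simp
qed

text \<open>Tonelli: for fixed z the variable y ranges over [x, z], an interval of length max 0 (z -
  x). The exponential bound keeps everything finite, and its factor 1 / a^2 is what later makes the
  \<open>G\<close> decay factorially.\<close>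

lemma double_tail_integral:
  fixes h :: "real \<Rightarrow> real"
  assumes [measurable]: "h \<in> borel_measurable borel"
    and h: "\<And>z. 0 \<le> z \<Longrightarrow> 0 \<le> h z" "\<And>z. 0 \<le> z \<Longrightarrow> h z \<le> K * exp (- a * z)"
    and a: "0 < a" and x: "0 \<le> x"
  shows "(LBINT y:{x..}. LBINT z:{y..}. h z) = (\<integral>z. max 0 (z - x) * h z \<partial>half)" (is "?I = ?J")
    and "integrable half (\<lambda>z. max 0 (z - x) * h z)"
    and "0 \<le> (\<integral>z. max 0 (z - x) * h z \<partial>half)"
    and "(\<integral>z. max 0 (z - x) * h z \<partial>half) \<le> K / a\<^sup>2 * exp (- a * x)"
proof -
  have K: "0 \<le> K" using h[of 0] by simp
  define T where "T = (\<integral>\<^sup>+z. ennreal (max 0 (z - x) * h z) * indicator {0..} z \<partial>lborel)"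
  have T_half: "T = (\<integral>\<^sup>+z. ennreal (max 0 (z - x) * h z) \<partial>half)"
    unfolding T_def by (subst nn_integral_half) auto
  have nn: "AE z in half. 0 \<le> max 0 (z - x) * h z"
    using AE_half by eventually_elim (simp add: h)
  have "T \<le> (\<integral>\<^sup>+z. ennreal K * ennreal (max 0 (z - x) * exp (- a * z)) \<partial>lborel)"
    unfolding T_def
  proof (rule nn_integral_mono)
    fix z :: real
    have "max 0 (z - x) * h z \<le> K * (max 0 (z - x) * exp (- a * z))" if "0 \<le> z"
      using mult_left_mono[OF h(2)[OF that], of "max 0 (z - x)"] by (simp add: mult_ac)
    then show "ennreal (max 0 (z - x) * h z) * indicator {0..} z \<le> ennreal K * ennreal (max 0 (z - x) * exp (- a * z))"
      using K by (auto simp: indicator_def ennreal_leI simp flip: ennreal_mult')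
  qed
  also have "\<dots> = ennreal (K / a\<^sup>2 * exp (- a * x))"
    using K by (subst nn_integral_cmult)
      (auto simp: nn_integral_linear_exp[OF a, simplified] simp flip: ennreal_mult')
  finally have T_le: "T \<le> ennreal (K / a\<^sup>2 * exp (- a * x))" .
  then have T_fin: "T < \<infinity>" by (auto simp: less_top[symmetric] top_unique)
  show "integrable half (\<lambda>z. max 0 (z - x) * h z)"
    using T_fin nn by (intro integrableI_nonneg) (auto simp: T_half)
  have J: "?J = enn2real T"
    unfolding T_half using nn by (intro integral_eq_nn_integral) auto
  then show "0 \<le> ?J" by simp
  show "?J \<le> K / a\<^sup>2 * exp (- a * x)"
    unfolding J using T_le K by (intro enn2real_leI) auto
  \<comment> \<open>A Bochner integral defaults to 0 when it diverges, so the tails must be shown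
    finite before they can be exchanged as nonnegative integrals.\<close>
  have inner: "ennreal (LBINT z:{y..}. h z) = (\<integral>\<^sup>+z. ennreal (h z) * indicator {y..} z \<partial>lborel)"
    and inner_nonneg: "0 \<le> (LBINT z:{y..}. h z)" if y: "0 \<le> y" for y
  proof -
    have nny: "0 \<le> indicator {y..} z *\<^sub>R h z" for z using y h(1)[of z] by (auto simp: indicator_def)
    have e: "ennreal (indicator {y..} z *\<^sub>R h z) = ennreal (h z) * indicator {y..} z" for z
      by (auto simp: indicator_def)
    have "(\<integral>\<^sup>+z. ennreal (h z) * indicator {y..} z \<partial>lborel) \<le>
      (\<integral>\<^sup>+z. ennreal K * (ennreal (exp (- a * z)) * indicator {0..} z) \<partial>lborel)"
    proof (rule nn_integral_mono)
      fix z :: real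
      show "ennreal (h z) * indicator {y..} z \<le> ennreal K * (ennreal (exp (- a * z)) * indicator {0..} z)"
        using y K h(2)[of z] by (auto simp: indicator_def ennreal_leI simp flip: ennreal_mult')
    qed
    also have "\<dots> = ennreal K * ennreal (1 / a)"
      by (subst nn_integral_cmult) (auto simp: nn_integral_exp_Ici[OF a, simplified])
    finally have fin: "(\<integral>\<^sup>+z. ennreal (h z) * indicator {y..} z \<partial>lborel) < \<infinity>"
      by (auto simp: less_top[symmetric] top_unique ennreal_mult_eq_top_iff)
    have "(LBINT z:{y..}. h z) = enn2real (\<integral>\<^sup>+z. ennreal (h z) * indicator {y..} z \<partial>lborel)"
      unfolding set_lebesgue_integral_def using nny by (subst integral_eq_nn_integral) (auto simp only: e AE_I2, auto)
    then show "ennreal (LBINT z:{y..}. h z) = (\<integral>\<^sup>+z. ennreal (h z) * indicator {y..} z \<partial>lborel)"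
      and "0 \<le> (LBINT z:{y..}. h z)"
      using fin by simp_all
  qed
  have meas: "(\<lambda>y. LBINT z:{y..}. h z) \<in> borel_measurable borel"
  proof -
    have "(\<lambda>y. \<integral>z. (if y \<le> z then h z else 0) \<partial>lborel) \<in> borel_measurable borel"
      by (rule lborel.borel_measurable_lebesgue_integral) measurable
    moreover have "(LBINT z:{y..}. h z) = (\<integral>z. (if y \<le> z then h z else 0) \<partial>lborel)" for y
      unfolding set_lebesgue_integral_def by (rule Bochner_Integration.integral_cong) auto
    ultimately show ?thesis by simp
  qed
  have "?I = enn2real (\<integral>\<^sup>+y. ennreal (indicator {x..} y *\<^sub>R (LBINT z:{y..}. h z)) \<partial>lborel)"
    unfolding set_lebesgue_integral_def[of _ "{x..}"]
    using meas inner_nonneg x by (intro integral_eq_nn_integral AE_I2) (auto simp: indicator_def)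
  also have "(\<integral>\<^sup>+y. ennreal (indicator {x..} y *\<^sub>R (LBINT z:{y..}. h z)) \<partial>lborel) =
      (\<integral>\<^sup>+y. (\<integral>\<^sup>+z. (if x \<le> y \<and> y \<le> z then ennreal (h z) else 0) \<partial>lborel) \<partial>lborel)"
  proof (rule nn_integral_cong)
    fix y :: real
    show "ennreal (indicator {x..} y *\<^sub>R (LBINT z:{y..}. h z)) =
      (\<integral>\<^sup>+z. (if x \<le> y \<and> y \<le> z then ennreal (h z) else 0) \<partial>lborel)"
      using x inner[of y] by (cases "x \<le> y") (auto intro!: nn_integral_cong simp: indicator_def)
  qed
  also have "\<dots> = (\<integral>\<^sup>+z. (\<integral>\<^sup>+y. (if x \<le> y \<and> y \<le> z then ennreal (h z) else 0) \<partial>lborel) \<partial>lborel)"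
    by (rule lborel_pair.Fubini'[symmetric]) measurable
  also have "\<dots> = T"
    unfolding T_def
  proof (rule nn_integral_cong)
    fix z :: real
    have "(\<integral>\<^sup>+y. (if x \<le> y \<and> y \<le> z then ennreal (h z) else 0) \<partial>lborel) =
      (\<integral>\<^sup>+y. ennreal (h z) * indicator {x..z} y \<partial>lborel)"
      by (intro nn_integral_cong) (auto simp: indicator_def)
    also have "\<dots> = ennreal (h z) * emeasure lborel {x..z}"
      by (rule nn_integral_cmult_indicator) simp
    also have "\<dots> = ennreal (max 0 (z - x) * h z) * indicator {0..} z"
      using x h(1)[of z] by (auto simp: emeasure_lborel_Icc_eq indicator_def max_def mult.commute simp flip: ennreal_mult')
    finally show "(\<integral>\<^sup>+y. (if x \<le> y \<and> y \<le> z then ennreal (h z) else 0) \<partial>lborel) =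
      ennreal (max 0 (z - x) * h z) * indicator {0..} z" .
  qed
  finally show "?I = ?J" unfolding J .
qed

section \<open>Decay of \<open>g2\<close> and of the iterated tail integrals\<close>

locale light_degree_law =
  fixes P :: "nat pmf"
  assumes P_support: "pmf P 0 = 0"
    and P_nontrivial: "pmf P 1 < 1"
    and exp_moment: "\<exists>\<theta>>0. integrable (measure_pmf P) (\<lambda>k. exp (\<theta> * real k))"
begin

lemma g2_eq: "g2 P = dens (\<lambda>k. pmf P (k + 2))"
proof
  fix x
  have s: "summable (\<lambda>k. norm (pmf P (k + 2) * (x ^ k / fact k)))"
    using summable_coeff_power[of "\<lambda>k. pmf P (k + 2)" "\<bar>x\<bar>"]
    by (simp add: abs_mult power_abs pmf_le_1)
  have "((\<lambda>k. pmf P (k + 2) * (x ^ k / fact k)) has_sum (\<Sum>k. pmf P (k + 2) * (x ^ k / fact k))) UNIV"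
    by (rule norm_summable_imp_has_sum[OF s summable_sums[OF summable_norm_cancel[OF s]]])
  then have "(\<Sum>\<^sub>\<infinity>k. pmf P (k + 2) * (x ^ k / fact k)) = (\<Sum>k. pmf P (k + 2) * (x ^ k / fact k))"
    by (rule infsumI)
  moreover have "(\<Sum>\<^sub>\<infinity>k\<in>{2..}. pmf P k * x ^ (k - 2) / fact (k - 2)) =
    (\<Sum>\<^sub>\<infinity>k. pmf P (k + 2) * (x ^ k / fact k))"
  proof -
    have "{2..} = (\<lambda>k. k + 2) ` (UNIV :: nat set)"
    proof (intro equalityI subsetI)
      fix k :: nat assume "k \<in> {2..}"
      then show "k \<in> range (\<lambda>k. k + 2)" by (intro image_eqI[of _ _ "k - 2"]) auto
    qed auto
    then have "(\<Sum>\<^sub>\<infinity>k\<in>{2..}. pmf P k * x ^ (k - 2) / fact (k - 2)) =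
      (\<Sum>\<^sub>\<infinity>k\<in>(\<lambda>k. k + 2) ` UNIV. pmf P k * x ^ (k - 2) / fact (k - 2))"
      by (rule arg_cong)
    also have "\<dots> = infsum ((\<lambda>k. pmf P k * x ^ (k - 2) / fact (k - 2)) \<circ> (\<lambda>k. k + 2)) UNIV"
      by (rule infsum_reindex) (simp add: inj_on_def)
    also have "\<dots> = (\<Sum>\<^sub>\<infinity>k. pmf P (k + 2) * (x ^ k / fact k))"
      unfolding o_def by (rule infsum_cong) simp
    finally show ?thesis .
  qed
  ultimately show "g2 P x = dens (\<lambda>k. pmf P (k + 2)) x"
    by (simp add: g2_def dens_def)
qed

lemma measurable_g2 [measurable]: "g2 P \<in> borel_measurable borel"
  unfolding g2_eq by measurable

lemma g2_nonneg: "0 \<le> x \<Longrightarrow> 0 \<le> g2 P x"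
  unfolding g2_eq by (rule dens_nonneg) (auto simp: pmf_le_1)

lemma ex_branching: "\<exists>k. 0 < pmf P (k + 2)"
proof (rule ccontr)
  assume "\<not> ?thesis"
  then have "pmf P (k + 2) = 0" for k using pmf_nonneg[of P "k + 2"] by (auto simp: less_le)
  note P2 = this
  have "set_pmf P \<subseteq> {1}"
  proof
    fix k assume "k \<in> set_pmf P"
    moreover have "pmf P k = 0" if "2 \<le> k"
      using P2[of "k - 2"] unfolding le_add_diff_inverse2[OF that] .
    ultimately show "k \<in> {1}"
      using P_support by (cases "k = 0"; cases "k = 1") (auto simp: set_pmf_iff)
  qed
  then have "P = return_pmf 1" by (simp add: set_pmf_subset_singleton)
  then show False using P_nontrivial by simp
qed

lemma g2_pos: assumes "0 < x" shows "0 < g2 P x"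
proof -
  obtain k where k: "0 < pmf P (k + 2)" using ex_branching by blast
  have "summable (\<lambda>k. pmf P (k + 2) * (x ^ k / fact k))"
    by (rule summable_coeff_power) (simp add: pmf_le_1)
  then have "0 < (\<Sum>k. pmf P (k + 2) * (x ^ k / fact k))"
    using k assms by (intro suminf_pos2[where i = k]) auto
  then show ?thesis by (simp add: g2_eq dens_def)
qed

text \<open>The exponential moment bounds \<open>pmf P (k + 2)\<close> by C r^k with r =
  e^(-\<theta>) < 1. The series is then at most C e^(r x), and the prefactor e^(-x) leaves decay at
  rate 1 - r.\<close>

lemma g2_exp_bound: "\<exists>C c. 0 < c \<and> (\<forall>x\<ge>0. g2 P x \<le> C * exp (- c * x))"
proof -
  obtain \<theta> where \<theta>: "\<theta> > 0" "integrable (measure_pmf P) (\<lambda>k. exp (\<theta> * real k))"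
    using exp_moment by blast
  define C where "C = measure_pmf.expectation P (\<lambda>k. exp (\<theta> * real k))"
  have C: "pmf P k * exp (\<theta> * real k) \<le> C" for k
  proof -
    have "ennreal (pmf P k * exp (\<theta> * real k)) \<le> (\<integral>\<^sup>+k. ennreal (pmf P k * exp (\<theta> * real k)) \<partial>count_space UNIV)"
      by (rule nn_integral_ge_point) simp
    also have "\<dots> = (\<integral>\<^sup>+k. ennreal (exp (\<theta> * real k)) \<partial>measure_pmf P)"
      by (simp add: nn_integral_measure_pmf ennreal_mult)
    also have "\<dots> = ennreal C"
      unfolding C_def using \<theta>(2) by (intro nn_integral_eq_integral) auto
    finally show ?thesis
      by (subst (asm) ennreal_le_iff) (auto simp: C_def intro!: integral_nonneg_AE)
  qed
  have C0: "0 \<le> C" using C[of 0] order_trans[OF _ C[of 0], of 0] by simp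
  define r where "r = exp (- \<theta>)"
  have r: "0 < r" "r < 1" using \<theta> by (auto simp: r_def)
  have bound: "pmf P (k + 2) \<le> C * r ^ k" for k
  proof -
    have "pmf P (k + 2) * exp (\<theta> * real k) \<le> pmf P (k + 2) * exp (\<theta> * real (k + 2))"
      using \<theta> by (intro mult_left_mono) auto
    also have "\<dots> \<le> C" by (rule C)
    finally show ?thesis
      by (simp add: r_def exp_minus field_simps exp_of_nat_mult[symmetric])
  qed
  have "g2 P x \<le> C * exp (- (1 - r) * x)" if x: "0 \<le> x" for x
  proof -
    have s: "summable (\<lambda>k. (r * x) ^ k / fact k)"
      using summable_exp[of "r * x"] by (simp add: field_simps)
    have "(\<Sum>k. pmf P (k + 2) * (x ^ k / fact k)) \<le> (\<Sum>k. C * ((r * x) ^ k / fact k))"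
    proof (rule suminf_le)
      show "pmf P (k + 2) * (x ^ k / fact k) \<le> C * ((r * x) ^ k / fact k)" for k
        using mult_right_mono[OF bound[of k], of "x ^ k / fact k"] x by (simp add: power_mult_distrib mult_ac)
      show "summable (\<lambda>k. pmf P (k + 2) * (x ^ k / fact k))"
        by (rule summable_coeff_power) (simp add: pmf_le_1)
      show "summable (\<lambda>k. C * ((r * x) ^ k / fact k))" using s by (rule summable_mult)
    qed
    also have "\<dots> = C * exp (r * x)"
      using s by (simp add: suminf_mult exp_def scaleR_conv_of_real divide_inverse mult.commute)
    finally have "g2 P x \<le> exp (- x) * (C * exp (r * x))"
      unfolding g2_eq dens_def by (intro mult_left_mono) auto
    also have "\<dots> = C * exp (- (1 - r) * x)"
      by (simp add: algebra_simps flip: exp_add)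
    finally show ?thesis .
  qed
  then show ?thesis using r by (intro exI[of _ C] exI[of _ "1 - r"]) auto
qed

text \<open>The induction carries the stronger bound D^i / i! times e^(-c i x). Multiplication by
  \<open>g2\<close> raises the rate to c (i + 1), so two tail integrations divide by c^2 (i + 1)^2,
  of which one factor i + 1 is enough to build the next factorial.\<close>

lemma G_properties:
  obtains D where "0 \<le> D"
    and "\<And>i. G P i \<in> borel_measurable borel"
    and "\<And>i x. 0 \<le> x \<Longrightarrow> 0 \<le> G P i x" "\<And>i x. 0 \<le> x \<Longrightarrow> G P i x \<le> D ^ i / fact i"
    and "\<And>i x. 0 \<le> x \<Longrightarrow> G P (Suc i) x = (\<integral>z. max 0 (z - x) * (g2 P z * G P i z) \<partial>half)"
    and "\<And>i x. 0 \<le> x \<Longrightarrow> integrable half (\<lambda>z. max 0 (z - x) * (g2 P z * G P i z))"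
proof -
  obtain C c where c: "0 < c" and C: "\<And>x. 0 \<le> x \<Longrightarrow> g2 P x \<le> C * exp (- c * x)"
    using g2_exp_bound by blast
  define D where "D = C / c\<^sup>2"
  have C0: "0 \<le> C" using C[of 0] g2_nonneg[of 0] by simp
  have D0: "0 \<le> D" using C0 by (simp add: D_def)
  let ?b = "\<lambda>i x. D ^ i / fact i * exp (- (c * real i) * x)"
  have step_bound: "g2 P z * G P i z \<le> C * (D ^ i / fact i) * exp (- (c * real (Suc i)) * z)"
    if "0 \<le> z" "0 \<le> G P i z" "G P i z \<le> ?b i z" for i z
  proof -
    have "g2 P z * G P i z \<le> (C * exp (- c * z)) * ?b i z"
      using that C g2_nonneg C0 D0 by (intro mult_mono) auto
    also have "\<dots> = C * (D ^ i / fact i) * exp (- (c * real (Suc i)) * z)"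
      by (simp add: algebra_simps flip: exp_add)
    finally show ?thesis .
  qed
  have main: "G P i \<in> borel_measurable borel \<and> (\<forall>x\<ge>0. 0 \<le> G P i x \<and> G P i x \<le> ?b i x)" for i
  proof (induction i)
    case (Suc i)
    then have [measurable]: "G P i \<in> borel_measurable borel" by blast
    have h: "0 \<le> g2 P z * G P i z" "g2 P z * G P i z \<le> C * (D ^ i / fact i) * exp (- (c * real (Suc i)) * z)"
      if "0 \<le> z" for z
    proof -
      have Gi: "0 \<le> G P i z" "G P i z \<le> ?b i z" using Suc.IH that by blast+
      show "0 \<le> g2 P z * G P i z" using g2_nonneg[OF that] Gi(1) by (rule mult_nonneg_nonneg)
      show "g2 P z * G P i z \<le> C * (D ^ i / fact i) * exp (- (c * real (Suc i)) * z)"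
        by (rule step_bound[OF that Gi])
    qed
    have a: "0 < c * real (Suc i)" using c by simp
    have hm: "(\<lambda>z. g2 P z * G P i z) \<in> borel_measurable borel" by measurable
    have "0 \<le> G P (Suc i) x \<and> G P (Suc i) x \<le> ?b (Suc i) x" if x: "0 \<le> x" for x
    proof -
      have "C * (D ^ i / fact i) / (c * real (Suc i))\<^sup>2 = D ^ Suc i / (fact i * (real (Suc i))\<^sup>2)"
        by (simp add: D_def power_mult_distrib mult_ac del: of_nat_Suc)
      also have "\<dots> \<le> D ^ Suc i / fact (Suc i)"
        using D0 by (intro divide_left_mono) (auto simp: power2_eq_square)
      finally have "C * (D ^ i / fact i) / (c * real (Suc i))\<^sup>2 * exp (- (c * real (Suc i)) * x) \<le> ?b (Suc i) x"
        by (intro mult_right_mono) auto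
      then show ?thesis
        using double_tail_integral[OF hm h a x] by (auto simp del: of_nat_Suc fact_Suc)
    qed
    moreover have "G P (Suc i) \<in> borel_measurable borel"
    proof -
      have m1: "(\<lambda>y. LBINT z:{y..}. g2 P z * G P i z) \<in> borel_measurable borel"
      proof -
        have "(\<lambda>y. \<integral>z. (if y \<le> z then g2 P z * G P i z else 0) \<partial>lborel) \<in> borel_measurable borel"
          by (rule lborel.borel_measurable_lebesgue_integral) measurable
        moreover have "(LBINT z:{y..}. g2 P z * G P i z) = (\<integral>z. (if y \<le> z then g2 P z * G P i z else 0) \<partial>lborel)" for y
          unfolding set_lebesgue_integral_def by (rule Bochner_Integration.integral_cong) auto
        ultimately show ?thesis by simp
      qed
      have "(\<lambda>x. \<integral>y. (if x \<le> y then (LBINT z:{y..}. g2 P z * G P i z) else 0) \<partial>lborel) \<in> borel_measurable borel"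
      proof (rule lborel.borel_measurable_lebesgue_integral)
        note [measurable] = m1
        show "(\<lambda>(x, y). if x \<le> y then (LBINT z:{y..}. g2 P z * G P i z) else 0) \<in> borel_measurable (borel \<Otimes>\<^sub>M lborel)"
          by measurable
      qed
      moreover have "G P (Suc i) x = (\<integral>y. (if x \<le> y then (LBINT z:{y..}. g2 P z * G P i z) else 0) \<partial>lborel)" for x
        unfolding G.simps set_lebesgue_integral_def[of _ "{x..}"] by (rule Bochner_Integration.integral_cong) auto
      ultimately show ?thesis by (simp del: G.simps cong: measurable_cong)
    qed
    ultimately show ?case by blast
  qed (use D0 in auto)
  have h: "0 \<le> g2 P z * G P i z" "g2 P z * G P i z \<le> C * (D ^ i / fact i) * exp (- (c * real (Suc i)) * z)"
    if "0 \<le> z" for z i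
  proof -
    have Gi: "0 \<le> G P i z" "G P i z \<le> ?b i z" using main that by blast+
    show "0 \<le> g2 P z * G P i z" using g2_nonneg[OF that] Gi(1) by (rule mult_nonneg_nonneg)
    show "g2 P z * G P i z \<le> C * (D ^ i / fact i) * exp (- (c * real (Suc i)) * z)"
      by (rule step_bound[OF that Gi])
  qed
  have a: "0 < c * real (Suc i)" for i using c by simp
  have hm: "(\<lambda>z. g2 P z * G P i z) \<in> borel_measurable borel" for i
  proof -
    have [measurable]: "G P i \<in> borel_measurable borel" using main by blast
    show ?thesis by measurable
  qed
  show ?thesis
  proof (rule that[of D])
    show "G P i \<in> borel_measurable borel" "0 \<le> x \<Longrightarrow> 0 \<le> G P i x" for i x using main by blast+
    show "G P i x \<le> D ^ i / fact i" if "0 \<le> x" for i x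
    proof -
      have "G P i x \<le> ?b i x" using main that by blast
      also have "\<dots> \<le> D ^ i / fact i * 1" using c that D0 by (intro mult_left_mono) auto
      finally show ?thesis by simp
    qed
    show "G P (Suc i) x = (\<integral>z. max 0 (z - x) * (g2 P z * G P i z) \<partial>half)" if "0 \<le> x" for i x
      using double_tail_integral(1)[OF hm h a that] by simp
    show "integrable half (\<lambda>z. max 0 (z - x) * (g2 P z * G P i z))" if "0 \<le> x" for i x
      by (rule double_tail_integral(2)[OF hm h a that])
  qed (fact D0)
qed

text \<open>Choosing the constant once and for all allows it to appear in the statements of later
  lemmas.\<close>

definition growth :: real where
  "growth = (SOME d. 0 \<le> d \<and> (\<forall>i. G P i \<in> borel_measurable borel) \<and>
     (\<forall>i x. 0 \<le> x \<longrightarrow> 0 \<le> G P i x \<and> G P i x \<le> d ^ i / fact i))"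

lemma growth: "0 \<le> growth" "G P i \<in> borel_measurable borel"
    "0 \<le> x \<Longrightarrow> 0 \<le> G P i x" "0 \<le> x \<Longrightarrow> G P i x \<le> growth ^ i / fact i"
proof -
  have "\<exists>d. 0 \<le> d \<and> (\<forall>i. G P i \<in> borel_measurable borel) \<and>
     (\<forall>i x. 0 \<le> x \<longrightarrow> 0 \<le> G P i x \<and> G P i x \<le> d ^ i / fact i)"
    using G_properties by metis
  from someI_ex[OF this, folded growth_def]
  show "0 \<le> growth" "G P i \<in> borel_measurable borel"
    "0 \<le> x \<Longrightarrow> 0 \<le> G P i x" "0 \<le> x \<Longrightarrow> G P i x \<le> growth ^ i / fact i"
    by auto
qed

lemmas measurable_G [measurable] = growth(2)

lemma G_Suc:
  assumes "0 \<le> x"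
  shows "G P (Suc i) x = (\<integral>z. max 0 (z - x) * (g2 P z * G P i z) \<partial>half)"
    and "integrable half (\<lambda>z. max 0 (z - x) * (g2 P z * G P i z))"
  using assms G_properties by metis+

text \<open>\<open>L\<close> in the variable s = 1/\<beta>. It becomes a power series that also
  makes sense at s = 0, the starting point of the continuity argument, and the largest root in
  \<beta> becomes the smallest root in s.\<close>

definition ell :: "real \<Rightarrow> real \<Rightarrow> real" where
  "ell s x = (\<Sum>i. G P i x * (- s) ^ i)"

lemma L_eq_ell: "L P \<beta> x = ell (1 / \<beta>) x"
  by (simp add: L_def ell_def)

lemma G_term_bound: "0 \<le> x \<Longrightarrow> \<bar>G P i x * (- s) ^ i\<bar> \<le> (growth * \<bar>s\<bar>) ^ i / fact i"
  using mult_right_mono[OF growth(4)[of x i], of "\<bar>s\<bar> ^ i"] growth(3)[of x i]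
  by (simp add: abs_mult power_abs power_mult_distrib)

lemma summable_exp_D: "summable (\<lambda>i. (r::real) ^ i / fact i)"
  using summable_exp[of r] by (simp add: field_simps)

lemma suminf_exp_eq: "(\<Sum>i. (r::real) ^ i / fact i) = exp r"
  by (simp add: exp_def scaleR_conv_of_real divide_inverse mult.commute)

lemma summable_ell: "0 \<le> x \<Longrightarrow> summable (\<lambda>i. \<bar>G P i x * (- s) ^ i\<bar>)"
  by (rule summable_comparison_test'[OF summable_exp_D[of "growth * \<bar>s\<bar>"]]) (simp add: G_term_bound)

lemma ell_bound: "0 \<le> x \<Longrightarrow> \<bar>ell s x\<bar> \<le> exp (growth * \<bar>s\<bar>)"
proof -
  assume x: "0 \<le> x"
  have "\<bar>ell s x\<bar> \<le> (\<Sum>i. \<bar>G P i x * (- s) ^ i\<bar>)"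
    unfolding ell_def by (rule summable_rabs[OF summable_ell[OF x]])
  also have "\<dots> \<le> (\<Sum>i. (growth * \<bar>s\<bar>) ^ i / fact i)"
    using x by (intro suminf_le summable_ell summable_exp_D G_term_bound)
  finally show ?thesis by (simp add: suminf_exp_eq)
qed

lemma measurable_ell [measurable]: "ell s \<in> borel_measurable borel"
  unfolding ell_def by measurable

lemma ell_0 [simp]: "ell 0 x = 1"
  unfolding ell_def by (subst suminf_finite[of "{0}"]) auto

lemma integrable_z_g2: "integrable half (\<lambda>z. z * g2 P z)"
proof -
  have "integrable half (\<lambda>z. max 0 (z - 0) * (g2 P z * G P 0 z))"
    by (rule G_Suc(2)) simp
  then show ?thesis
    by (rule Bochner_Integration.integrable_bound) (use AE_half in \<open>auto elim!: eventually_mono simp: g2_nonneg\<close>)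
qed

lemma integrable_kernel:
  assumes [measurable]: "k \<in> borel_measurable borel" "f \<in> borel_measurable borel"
    and k: "\<And>z. 0 \<le> z \<Longrightarrow> \<bar>k z\<bar> \<le> z" and f: "\<And>z. 0 \<le> z \<Longrightarrow> \<bar>f z\<bar> \<le> B"
  shows "integrable half (\<lambda>z. k z * (g2 P z * f z))"
proof (rule Bochner_Integration.integrable_bound)
  show "integrable half (\<lambda>z. B * (z * g2 P z))"
    using integrable_z_g2 by simp
  show "AE z in half. norm (k z * (g2 P z * f z)) \<le> norm (B * (z * g2 P z))"
    using AE_half
  proof eventually_elim
    case (elim z)
    have "\<bar>k z\<bar> * (g2 P z * \<bar>f z\<bar>) \<le> z * (g2 P z * B)"
      using elim k f g2_nonneg by (intro mult_mono mult_left_mono mult_nonneg_nonneg) auto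
    moreover have "0 \<le> B" using f[of 0] by simp
    ultimately show ?case using elim g2_nonneg[OF elim] by (simp add: abs_mult mult_ac)
  qed
qed measurable

text \<open>Summing the recursion for \<open>G\<close> with weights (-s)^i; the factorial bounds
  justify integrating term by term.\<close>

lemma ell_eq:
  assumes x: "0 \<le> x"
  shows "ell s x = 1 - s * (\<integral>z. max 0 (z - x) * (g2 P z * ell s z) \<partial>half)"
proof -
  let ?f = "\<lambda>i z. max 0 (z - x) * (g2 P z * G P i z) * (- s) ^ i"
  have int: "integrable half (?f i)" for i
    using G_Suc(2)[OF x] by simp
  have norm_eq: "(\<integral>z. norm (?f i z) \<partial>half) = G P (Suc i) x * \<bar>s\<bar> ^ i" for i
  proof -
    have "(\<integral>z. norm (?f i z) \<partial>half) = (\<integral>z. max 0 (z - x) * (g2 P z * G P i z) * \<bar>s\<bar> ^ i \<partial>half)"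
    proof (rule integral_cong_AE)
      show "AE z in half. norm (?f i z) = max 0 (z - x) * (g2 P z * G P i z) * \<bar>s\<bar> ^ i"
        using AE_half by eventually_elim (simp add: abs_mult power_abs g2_nonneg growth)
    qed measurable
    then show ?thesis by (simp del: G.simps add: G_Suc(1)[OF x])
  qed
  \<comment> \<open>For s \<noteq> 0 this is the tail of the absolute series of \<open>ell\<close>
    divided by \<bar>s\<bar>; for s = 0 only one term survives.\<close>
  have sum1: "summable (\<lambda>i. G P (Suc i) x * \<bar>s\<bar> ^ i)"
  proof (cases "s = 0")
    case False
    have "summable (\<lambda>i. \<bar>G P (Suc i) x * (- s) ^ Suc i\<bar>)"
      using summable_ell[OF x, of s] by (subst summable_Suc_iff)
    then have "summable (\<lambda>i. \<bar>G P (Suc i) x * (- s) ^ Suc i\<bar> / \<bar>s\<bar>)"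
      by (rule summable_divide)
    then show ?thesis
      using False growth(3)[OF x] by (simp add: abs_mult power_abs del: G.simps)
  qed (auto intro!: summable_finite[of "{0}"] simp: power_0_left split: if_splits)
  have "(\<integral>z. (\<Sum>i. ?f i z) \<partial>half) = (\<Sum>i. (\<integral>z. ?f i z \<partial>half))"
  proof (rule integral_suminf[OF int])
    show "AE z in half. summable (\<lambda>i. norm (?f i z))"
      using AE_half
    proof eventually_elim
      case (elim z)
      show ?case
        using summable_mult[OF summable_ell[OF elim, of s], of "\<bar>max 0 (z - x) * g2 P z\<bar>"]
        by (simp add: abs_mult mult_ac)
    qed
    show "summable (\<lambda>i. \<integral>z. norm (?f i z) \<partial>half)"
      unfolding norm_eq by (rule sum1)
  qed
  also have "(\<integral>z. (\<Sum>i. ?f i z) \<partial>half) = (\<integral>z. max 0 (z - x) * (g2 P z * ell s z) \<partial>half)"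
  proof (rule integral_cong_AE)
    show "AE z in half. (\<Sum>i. ?f i z) = max 0 (z - x) * (g2 P z * ell s z)"
      using AE_half
    proof eventually_elim
      case (elim z)
      show ?case
        unfolding ell_def
        using suminf_mult[OF summable_rabs_cancel[OF summable_ell[OF elim, of s]], of "max 0 (z - x) * g2 P z"]
        by (simp add: mult_ac)
    qed
  qed measurable
  finally have "s * (\<integral>z. max 0 (z - x) * (g2 P z * ell s z) \<partial>half) = s * (\<Sum>i. G P (Suc i) x * (- s) ^ i)"
    by (simp add: G_Suc(1)[OF x] del: G.simps)
  also have "\<dots> = - (\<Sum>i. G P (Suc i) x * (- s) ^ Suc i)"
  proof -
    have "summable (\<lambda>i. G P (Suc i) x * (- s) ^ i)"
      by (rule summable_rabs_cancel) (use sum1 growth(3)[OF x] in \<open>simp add: abs_mult power_abs del: G.simps\<close>)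
    from suminf_mult[OF this, of "- s"] show ?thesis by (simp add: mult_ac del: G.simps)
  qed
  also have "(\<Sum>i. G P (Suc i) x * (- s) ^ Suc i) = ell s x - 1"
    unfolding ell_def by (subst suminf_split_head[OF summable_rabs_cancel[OF summable_ell[OF x]]]) simp
  finally show ?thesis by simp
qed

text \<open>Subtract \<open>ell_eq\<close> at x from \<open>ell_eq\<close> at 0: for x, z \<ge> 0
  the kernels combine as z - max 0 (z - x) = min x z.\<close>

lemma ell_eq_min:
  assumes x: "0 \<le> x"
  shows "ell s x = ell s 0 + s * (\<integral>z. min x z * (g2 P z * ell s z) \<partial>half)"
proof -
  have b: "0 \<le> z \<Longrightarrow> \<bar>ell s z\<bar> \<le> exp (growth * \<bar>s\<bar>)" for z by (rule ell_bound)
  have "(\<integral>z. min x z * (g2 P z * ell s z) \<partial>half) =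
    (\<integral>z. max 0 (z - 0) * (g2 P z * ell s z) - max 0 (z - x) * (g2 P z * ell s z) \<partial>half)"
    by (rule integral_cong_AE)
      (use AE_half x in \<open>auto elim!: eventually_mono simp: left_diff_distrib[symmetric]\<close>)
  also have "\<dots> = (\<integral>z. max 0 (z - 0) * (g2 P z * ell s z) \<partial>half) - (\<integral>z. max 0 (z - x) * (g2 P z * ell s z) \<partial>half)"
    using x by (intro Bochner_Integration.integral_diff integrable_kernel[OF _ _ _ b]) auto
  finally have "s * (\<integral>z. min x z * (g2 P z * ell s z) \<partial>half) =
      s * (\<integral>z. max 0 (z - 0) * (g2 P z * ell s z) \<partial>half) - s * (\<integral>z. max 0 (z - x) * (g2 P z * ell s z) \<partial>half)"
    by (simp only: right_diff_distrib)
  then show ?thesis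
    using ell_eq[OF x, of s] ell_eq[OF order_refl, of s] by linarith
qed

end

lemma AE_half_pos: "AE z in half. 0 < z"
proof -
  have "AE z in lborel. z \<noteq> (0::real)" by (rule AE_lborel_singleton)
  then show ?thesis
    unfolding half_def by (subst AE_density) (auto simp: indicator_def elim!: eventually_mono)
qed

text \<open>Turns an almost everywhere identity into one at a single point beyond a, where it can be
  refuted by strict positivity.\<close>

lemma AE_half_witness:
  assumes "AE z in half. Q z" "0 \<le> a"
  shows "\<exists>z>a. Q z"
proof (rule ccontr)
  assume "\<not> ?thesis"
  then have no: "\<And>z. z > a \<Longrightarrow> \<not> Q z" by blast
  have "AE z in lborel. 0 \<le> z \<longrightarrow> Q z"
    using assms(1) unfolding half_def by (subst (asm) AE_density) (auto simp: indicator_def elim!: eventually_mono split: if_splits)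
  then have "AE z in lborel. z \<notin> {a<..<a + 1}"
    by eventually_elim (use no assms(2) in force)
  then have "emeasure lborel {a<..<a + 1} = 0"
    by (subst (asm) AE_iff_null_sets[symmetric]) (auto simp: null_sets_def)
  then show False by simp
qed

lemma integral_eq_0_AE_half:
  assumes "integrable half f" "\<And>z. 0 \<le> z \<Longrightarrow> 0 \<le> f z" "(\<integral>z. f z \<partial>half) = 0"
  shows "AE z in half. f z = (0::real)"
proof -
  have "AE z in half. 0 \<le> f z" using AE_half by eventually_elim (rule assms)
  then show ?thesis
    using integral_nonneg_eq_0_iff_AE[OF assms(1)] assms(3) by simp
qed

lemma integral_mono_half:
  fixes f g :: "real \<Rightarrow> real"
  assumes "integrable half f" "integrable half g" "\<And>z. 0 \<le> z \<Longrightarrow> f z \<le> g z"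
  shows "(\<integral>z. f z \<partial>half) \<le> (\<integral>z. g z \<partial>half)"
  using assms AE_half by (intro integral_mono_AE) (auto elim!: eventually_mono)

lemma integral_nonneg_half:
  fixes f :: "real \<Rightarrow> real"
  assumes "\<And>z. 0 \<le> z \<Longrightarrow> 0 \<le> f z"
  shows "0 \<le> (\<integral>z. f z \<partial>half)"
  using assms AE_half by (intro integral_nonneg_AE) (auto elim!: eventually_mono)

section \<open>Sign of \<open>ell\<close> up to its first root, and the meaning of
  \<open>beta0\<close>\<close>

context light_degree_law
begin

lemma integrable_kernel_ell:
  assumes "k \<in> borel_measurable borel" "\<And>z. 0 \<le> z \<Longrightarrow> \<bar>k z\<bar> \<le> z"
  shows "integrable half (\<lambda>z. k z * (g2 P z * ell s z))"
  by (rule integrable_kernel[OF assms(1) _ assms(2) ell_bound]) auto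

text \<open>Comparing the series term by term with that of e^(growth s) gives a modulus of
  continuity in s that does not depend on x; this uniformity is what the infimum over x
  needs.\<close>

lemma ell_diff:
  assumes "0 \<le> s" "0 \<le> t" "0 \<le> x"
  shows "\<bar>ell s x - ell t x\<bar> \<le> \<bar>exp (growth * s) - exp (growth * t)\<bar>"
  using assms
proof (induction s t rule: linorder_wlog)
  case (le t s)
  let ?f = "\<lambda>s i. G P i x * (- s) ^ i" and ?e = "\<lambda>s i. (growth * s) ^ i / fact i :: real"
  note sf = summable_rabs_cancel[OF summable_ell[OF le(4)]]
  have se: "summable (\<lambda>i. ?e s i - ?e t i)" by (intro summable_diff summable_exp_D)
  have b: "\<bar>?f t i - ?f s i\<bar> \<le> ?e s i - ?e t i" for i
  proof -
    have p: "t ^ i \<le> s ^ i" using le by (intro power_mono) auto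
    have "\<bar>?f t i - ?f s i\<bar> = G P i x * (s ^ i - t ^ i)"
      using p growth(3)[OF le(4)]
      by (simp add: power_minus[of s] power_minus[of t] abs_mult mult.left_commute right_diff_distrib[symmetric] flip: right_diff_distrib)
    also have "\<dots> \<le> growth ^ i / fact i * (s ^ i - t ^ i)"
      using p growth(4)[OF le(4)] by (intro mult_right_mono) auto
    also have "\<dots> = ?e s i - ?e t i" by (simp add: power_mult_distrib right_diff_distrib)
    finally show ?thesis .
  qed
  have "ell t x - ell s x = (\<Sum>i. ?f t i - ?f s i)"
    unfolding ell_def by (rule suminf_diff[OF sf sf])
  also have "\<bar>\<dots>\<bar> \<le> (\<Sum>i. \<bar>?f t i - ?f s i\<bar>)"
    by (rule summable_rabs, rule summable_comparison_test'[OF se]) (use b in simp)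
  also have "\<dots> \<le> (\<Sum>i. ?e s i - ?e t i)"
    by (rule suminf_le[OF b summable_comparison_test'[OF se] se]) (use b in simp)
  also have "\<dots> = exp (growth * s) - exp (growth * t)"
    by (subst suminf_diff[symmetric]) (auto intro: summable_exp_D simp: suminf_exp_eq)
  finally show ?case by linarith
next
  case (sym t s)
  then show ?case by (simp add: abs_minus_commute)
qed

definition ell_inf :: "real \<Rightarrow> real" where
  "ell_inf s = (INF x\<in>{0..}. ell s x)"

lemma ell_inf_le: "0 \<le> x \<Longrightarrow> ell_inf s \<le> ell s x"
  unfolding ell_inf_def
proof (rule cINF_lower)
  show "bdd_below (ell s ` {0..})"
    using ell_bound[of _ s] by (intro bdd_belowI2[of _ "- exp (growth * \<bar>s\<bar>)"]) (auto simp: abs_le_iff minus_le_iff)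
qed simp

lemma ell_inf_ge: "(\<And>x. 0 \<le> x \<Longrightarrow> b \<le> ell s x) \<Longrightarrow> b \<le> ell_inf s"
  unfolding ell_inf_def by (rule cINF_greatest) auto

text \<open>An infimum of functions with a common modulus of continuity inherits that
  modulus.\<close>

lemma continuous_ell_inf: "continuous_on {0..} ell_inf"
proof -
  have le: "ell_inf s - \<bar>exp (growth * s) - exp (growth * t)\<bar> \<le> ell_inf t" if "0 \<le> s" "0 \<le> t" for s t
    using ell_diff[OF that] ell_inf_le[of _ s] by (intro ell_inf_ge) (smt (verit))
  have "(ell_inf \<longlongrightarrow> ell_inf s) (at s within {0..})" if s: "s \<in> {0..}" for s
  proof (rule LIM_zero_cancel)
    have "((\<lambda>t. \<bar>exp (growth * t) - exp (growth * s)\<bar>) \<longlongrightarrow> \<bar>exp (growth * s) - exp (growth * s)\<bar>) (at s within {0..})"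
      by (intro tendsto_intros)
    then have lim: "((\<lambda>t. \<bar>exp (growth * t) - exp (growth * s)\<bar>) \<longlongrightarrow> 0) (at s within {0..})" by simp
    show "((\<lambda>t. ell_inf t - ell_inf s) \<longlongrightarrow> 0) (at s within {0..})"
    proof (rule Lim_null_comparison[OF _ lim])
      show "\<forall>\<^sub>F t in at s within {0..}. norm (ell_inf t - ell_inf s) \<le> \<bar>exp (growth * t) - exp (growth * s)\<bar>"
        unfolding eventually_at_filter
      proof (intro always_eventually allI impI)
        fix t :: real assume "t \<in> {0..}"
        then show "norm (ell_inf t - ell_inf s) \<le> \<bar>exp (growth * t) - exp (growth * s)\<bar>"
          using le[of s t] le[of t s] s by (simp add: abs_minus_commute[of "exp (growth * s)"] abs_le_iff)
      qed
    qed
  qed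
  then show ?thesis by (simp add: continuous_on_def)
qed

lemma continuous_ell_0: "continuous_on {0..} (\<lambda>s. ell s 0)"
proof -
  have "((\<lambda>t. ell t 0) \<longlongrightarrow> ell s 0) (at s within {0..})" if s: "s \<in> {0..}" for s
  proof (rule LIM_zero_cancel)
    have "((\<lambda>t. \<bar>exp (growth * s) - exp (growth * t)\<bar>) \<longlongrightarrow> \<bar>exp (growth * s) - exp (growth * s)\<bar>) (at s within {0..})"
      by (intro tendsto_intros)
    then have lim: "((\<lambda>t. \<bar>exp (growth * s) - exp (growth * t)\<bar>) \<longlongrightarrow> 0) (at s within {0..})" by simp
    show "((\<lambda>t. ell t 0 - ell s 0) \<longlongrightarrow> 0) (at s within {0..})"
    proof (rule Lim_null_comparison[OF _ lim])
      show "\<forall>\<^sub>F t in at s within {0..}. norm (ell t 0 - ell s 0) \<le> \<bar>exp (growth * s) - exp (growth * t)\<bar>"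
        using s ell_diff[of s _ 0] by (auto simp: eventually_at_filter abs_minus_commute intro!: always_eventually)
    qed
  qed
  then show ?thesis by (simp add: continuous_on_def)
qed

text \<open>The kernel max 0 (z - x) in \<open>ell_eq\<close> decreases in x, and nonnegativity of
  \<open>ell s\<close> lets the subtracted integral follow. The infimum of a nonnegative
  \<open>ell s\<close> is therefore its value at 0.\<close>

lemma ell_mono:
  assumes nn: "\<And>x. 0 \<le> x \<Longrightarrow> 0 \<le> ell s x" and "0 \<le> s" "0 \<le> x" "x \<le> y"
  shows "ell s x \<le> ell s y"
proof -
  have "(\<integral>z. max 0 (z - y) * (g2 P z * ell s z) \<partial>half) \<le> (\<integral>z. max 0 (z - x) * (g2 P z * ell s z) \<partial>half)"
    using assms g2_nonneg nn by (intro integral_mono_half integrable_kernel_ell mult_right_mono) auto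
  then have "s * (\<integral>z. max 0 (z - y) * (g2 P z * ell s z) \<partial>half) \<le> s * (\<integral>z. max 0 (z - x) * (g2 P z * ell s z) \<partial>half)"
    using assms by (intro mult_left_mono)
  then show ?thesis
    using ell_eq[of x s] ell_eq[of y s] assms by linarith
qed

lemma ell_le_1:
  assumes nn: "\<And>x. 0 \<le> x \<Longrightarrow> 0 \<le> ell s x" and "0 \<le> s" "0 \<le> x"
  shows "ell s x \<le> 1"
proof -
  have "0 \<le> (\<integral>z. max 0 (z - x) * (g2 P z * ell s z) \<partial>half)"
    using g2_nonneg nn by (intro integral_nonneg_half mult_nonneg_nonneg) auto
  then show ?thesis using ell_eq[of x s] assms by simp
qed

text \<open>\<open>ell_inf\<close> starts at 1. Were it negative at s, it would vanish at some t <
  s; there \<open>ell t\<close> is nonnegative, hence monotone, so its infimum is at 0 and t is an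
  earlier root. Since only t < s are excluded as roots, the lemma also covers s equal to the first
  root.\<close>

lemma ell_nonneg_below_root:
  assumes s: "0 \<le> s" and pos: "\<And>t. 0 \<le> t \<Longrightarrow> t < s \<Longrightarrow> ell t 0 \<noteq> 0" and x: "0 \<le> x"
  shows "0 \<le> ell s x"
proof -
  have "0 \<le> ell_inf s"
  proof (rule ccontr)
    assume neg: "\<not> 0 \<le> ell_inf s"
    have "ell_inf 0 = 1" unfolding ell_inf_def by simp
    then obtain t where t: "0 \<le> t" "t \<le> s" "ell_inf t = 0"
      using IVT2'[of ell_inf s 0 0] neg s continuous_on_subset[OF continuous_ell_inf, of "{0..s}"] by force
    with neg have "t < s" by (cases "t = s") auto
    have nn: "0 \<le> ell t x" if "0 \<le> x" for x using ell_inf_le[OF that, of t] t by simp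
    have "ell t 0 \<le> ell_inf t" using t nn by (intro ell_inf_ge ell_mono) auto
    then have "ell t 0 = 0" using nn[of 0] t by simp
    with pos t \<open>t < s\<close> show False by blast
  qed
  then show ?thesis using ell_inf_le[OF x, of s] by simp
qed

text \<open>At a zero x > 0 both nonnegative terms of \<open>ell_eq_min\<close> vanish, so
  \<open>g2 P * ell s\<close> is 0 almost everywhere; but then \<open>ell_eq\<close> gives the value
  1 at x.\<close>

lemma ell_pos:
  assumes nn: "\<And>x. 0 \<le> x \<Longrightarrow> 0 \<le> ell s x" and s: "0 < s" and x: "0 < x"
  shows "0 < ell s x"
proof (rule ccontr)
  assume "\<not> 0 < ell s x"
  with nn[of x] x have 0: "ell s x = 0" by simp
  let ?I = "\<integral>z. min x z * (g2 P z * ell s z) \<partial>half"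
  have int: "integrable half (\<lambda>z. min x z * (g2 P z * ell s z))"
    using x by (intro integrable_kernel_ell) auto
  have I0: "0 \<le> ?I" using x g2_nonneg nn by (intro integral_nonneg_half mult_nonneg_nonneg) auto
  have "0 = ell s 0 + s * ?I" using ell_eq_min[of x s] 0 x by simp
  with nn[of 0] I0 s have "?I = 0" by (smt (verit) mult_pos_pos)
  with int have "AE z in half. min x z * (g2 P z * ell s z) = 0"
    using x g2_nonneg nn by (intro integral_eq_0_AE_half) auto
  with AE_half_pos have "AE z in half. max 0 (z - x) * (g2 P z * ell s z) = 0"
    by eventually_elim (use x in auto)
  then have "(\<integral>z. max 0 (z - x) * (g2 P z * ell s z) \<partial>half) = 0"
    by (intro integral_eq_zero_AE)
  then show False using ell_eq[of x s] x 0 by simp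
qed

text \<open>Without a root, \<open>ell s\<close> is nonnegative and monotone for every s \<ge> 0.
  Then \<open>ell_eq_min\<close> at x = 1, restricted to z \<ge> 1, gives \<open>ell s 1\<close>
  \<ge> s J \<open>ell s 1\<close> with J > 0, which fails for large s.\<close>

lemma ex_root: "\<exists>s\<ge>0. ell s 0 = 0"
proof (rule ccontr)
  assume no: "\<not> ?thesis"
  have nn: "0 \<le> ell s x" if "0 \<le> s" "0 \<le> x" for s x
    using that no by (intro ell_nonneg_below_root) auto
  define J where "J = (\<integral>z. (if 1 \<le> z then 1 else 0) * (g2 P z * 1) \<partial>half)"
  have intJ: "integrable half (\<lambda>z. (if 1 \<le> z then 1 else 0) * (g2 P z * 1))"
    by (rule integrable_kernel[where B = 1]) auto
  have J0: "0 \<le> J" unfolding J_def using g2_nonneg by (intro integral_nonneg_half) auto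
  have "J \<noteq> 0"
  proof
    assume "J = 0"
    with intJ have "AE z in half. (if 1 \<le> z then 1 else 0) * (g2 P z * 1) = 0"
      unfolding J_def using g2_nonneg by (intro integral_eq_0_AE_half) auto
    from AE_half_witness[OF this, of 1] obtain z where "z > 1" "g2 P z = 0" by auto
    with g2_pos[of z] show False by simp
  qed
  with J0 have J: "0 < J" by simp
  \<comment> \<open>Any s > 1 / J contradicts the inequality below.\<close>
  define s where "s = 2 / J"
  have s: "0 < s" using J by (simp add: s_def)
  have pos: "0 < ell s 1" using nn s by (intro ell_pos) auto
  have "ell s 1 * J \<le> (\<integral>z. min 1 z * (g2 P z * ell s z) \<partial>half)"
  proof -
    have "ell s 1 * J = (\<integral>z. ell s 1 * ((if 1 \<le> z then 1 else 0) * (g2 P z * 1)) \<partial>half)"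
      unfolding J_def by simp
    also have "\<dots> \<le> (\<integral>z. min 1 z * (g2 P z * ell s z) \<partial>half)"
    proof (rule integral_mono_half)
      show "integrable half (\<lambda>z. ell s 1 * ((if 1 \<le> z then 1 else 0) * (g2 P z * 1)))"
        using intJ by (rule integrable_mult_right)
      show "integrable half (\<lambda>z. min 1 z * (g2 P z * ell s z))"
        by (intro integrable_kernel_ell) auto
      fix z :: real assume z: "0 \<le> z"
      show "ell s 1 * ((if 1 \<le> z then 1 else 0) * (g2 P z * 1)) \<le> min 1 z * (g2 P z * ell s z)"
      proof (cases "1 \<le> z")
        case True
        then have "ell s 1 \<le> ell s z" using nn s by (intro ell_mono) auto
        then show ?thesis using True g2_nonneg[OF z] by (simp add: mult.commute[of "ell s 1"] mult_left_mono)
      next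
        case False
        then show ?thesis using nn s z g2_nonneg[OF z] by simp
      qed
    qed
    finally show ?thesis .
  qed
  then have "s * (ell s 1 * J) \<le> s * (\<integral>z. min 1 z * (g2 P z * ell s z) \<partial>half)"
    using s by (intro mult_left_mono) auto
  also have "\<dots> \<le> ell s 1"
    using ell_eq_min[of 1 s] nn[of s 0] s by linarith
  finally have "s * (ell s 1 * J) \<le> ell s 1" .
  then have "2 * ell s 1 \<le> ell s 1" using J by (simp add: s_def)
  with pos show False by simp
qed

text \<open>The root set in s is nonempty and closed, so it has a least element, positive because
  \<open>ell 0\<close> is 1. Inversion reverses the order, so the greatest root in \<beta> exists
  and \<open>GREATEST\<close> denotes it.\<close>

lemma beta0_root:
  obtains s0 where "0 < s0" "ell s0 0 = 0" "\<And>s. 0 \<le> s \<Longrightarrow> s < s0 \<Longrightarrow> ell s 0 \<noteq> 0" "beta0 P = 1 / s0"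
proof -
  define S where "S = {s \<in> {0..}. ell s 0 = 0}"
  have S: "S \<noteq> {}" "bdd_below S" using ex_root by (auto simp: S_def)
  have "closed S"
  proof -
    have "S = {0..} \<inter> (\<lambda>s. ell s 0) -` {0}" by (auto simp: S_def)
    then show ?thesis using continuous_closed_preimage[OF continuous_ell_0, of "{0}"] by simp
  qed
  with S have Inf: "Inf S \<in> S" by (intro closed_contains_Inf)
  define s0 where "s0 = Inf S"
  have s0: "0 \<le> s0" "ell s0 0 = 0" using Inf by (auto simp: S_def s0_def)
  then have pos: "0 < s0" by (cases "s0 = 0") auto
  have least: "s0 \<le> s" if "0 \<le> s" "ell s 0 = 0" for s
    unfolding s0_def using S that by (intro cInf_lower) (auto simp: S_def)
  have "beta0 P = 1 / s0"
    unfolding beta0_def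
  proof (rule Greatest_equality)
    show "1 / s0 > 0 \<and> L P (1 / s0) 0 = 0" using pos s0 by (simp add: L_eq_ell)
    fix \<beta> assume "\<beta> > 0 \<and> L P \<beta> 0 = 0"
    then show "\<beta> \<le> 1 / s0"
      using least[of "1 / \<beta>"] pos by (simp add: L_eq_ell field_simps)
  qed
  with pos s0 least that show ?thesis by force
qed

end

subsection \<open>The nonlinear recursion\<close>

text \<open>Mean value bounds for t^(j+1) on [z - w, z]. The upper one gives the tangent bound on
  \<open>surv\<close>, the lower one the bound for the truncated weight.\<close>

lemma power_Suc_diff_bounds:
  fixes z w :: real
  assumes "0 \<le> w" "w \<le> z"
  shows "real (Suc j) * w * (z - w) ^ j \<le> z ^ Suc j - (z - w) ^ Suc j"
    and "z ^ Suc j - (z - w) ^ Suc j \<le> real (Suc j) * w * z ^ j"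
proof -
  have "real (Suc j) * w * (z - w) ^ j \<le> z ^ Suc j - (z - w) ^ Suc j \<and>
    z ^ Suc j - (z - w) ^ Suc j \<le> real (Suc j) * w * z ^ j"
  proof (induction j)
    case (Suc j)
    have split: "z ^ Suc (Suc j) - (z - w) ^ Suc (Suc j) = z * (z ^ Suc j - (z - w) ^ Suc j) + w * (z - w) ^ Suc j"
      by (simp add: algebra_simps)
    have "z * (z ^ Suc j - (z - w) ^ Suc j) \<le> z * (real (Suc j) * w * z ^ j)"
      using Suc.IH assms by (intro mult_left_mono) auto
    moreover have "w * (z - w) ^ Suc j \<le> w * z ^ Suc j"
      using assms by (intro mult_left_mono power_mono) auto
    moreover have "(z - w) * (real (Suc j) * w * (z - w) ^ j) \<le> z * (z ^ Suc j - (z - w) ^ Suc j)"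
      using Suc.IH assms by (intro mult_mono) (auto simp del: power_Suc of_nat_Suc)
    ultimately show ?case
      unfolding split by (simp add: algebra_simps)
  qed simp
  then show "real (Suc j) * w * (z - w) ^ j \<le> z ^ Suc j - (z - w) ^ Suc j"
    and "z ^ Suc j - (z - w) ^ Suc j \<le> real (Suc j) * w * z ^ j" by blast+
qed

lemma power_Suc_diff_strict:
  fixes z w :: real
  assumes "0 < w" "w \<le> z" "1 \<le> j"
  shows "z ^ Suc j - (z - w) ^ Suc j < real (Suc j) * w * z ^ j"
proof -
  obtain i where j: "j = Suc i" using assms by (cases j) auto
  have split: "z ^ Suc (Suc i) - (z - w) ^ Suc (Suc i) = z * (z ^ Suc i - (z - w) ^ Suc i) + w * (z - w) ^ Suc i"
    by (simp add: algebra_simps)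
  have "z * (z ^ Suc i - (z - w) ^ Suc i) \<le> z * (real (Suc i) * w * z ^ i)"
    using assms power_Suc_diff_bounds(2)[of w z i] by (intro mult_left_mono) auto
  moreover have "w * (z - w) ^ Suc i < w * z ^ Suc i"
    using assms by (intro mult_strict_left_mono power_strict_mono) auto
  ultimately show ?thesis unfolding j split by (simp add: algebra_simps)
qed

lemma surv_eq:
  assumes "\<And>k. \<bar>c k\<bar> \<le> 1"
  shows "surv c z w = exp (- z) * (\<Sum>k. c k * (z ^ k / fact k)) - exp (- z) * (\<Sum>k. c k * ((z - w) ^ k / fact k))"
  unfolding surv_def right_diff_distrib[symmetric]
  using suminf_diff[OF summable_coeff_power[where c = c and z = z, OF assms]
      summable_coeff_power[where c = c and z = "z - w", OF assms]]
  by (simp add: diff_divide_distrib right_diff_distrib)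

lemma surv_shift:
  assumes "\<And>k. \<bar>c k\<bar> \<le> 1"
  shows "surv c z w = exp (- z) * (\<Sum>j. c (Suc j) * ((z ^ Suc j - (z - w) ^ Suc j) / fact (Suc j)))"
  unfolding surv_def
  by (subst suminf_split_head[OF summable_coeff_diff[OF assms]]) (simp add: suminf_split_head)

context
  fixes c :: "nat \<Rightarrow> real"
  assumes c: "\<And>k. 0 \<le> c k" "\<And>k. c k \<le> 1"
begin

lemma abs_coeff: "\<bar>c k\<bar> \<le> 1"
  using c[of k] by simp

lemma surv_mono:
  assumes "0 \<le> w" "w \<le> w'" "w' \<le> z"
  shows "surv c z w \<le> surv c z w'"
  unfolding surv_def using assms
  by (intro mult_left_mono suminf_le summable_coeff_diff abs_coeff divide_right_mono diff_left_mono power_mono c) auto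

lemma surv_le_dens:
  assumes "0 \<le> w" "w \<le> z"
  shows "surv c z w \<le> dens c z"
  unfolding surv_def dens_def using assms c
  by (intro mult_left_mono suminf_le summable_coeff_diff summable_coeff_power abs_coeff divide_right_mono) auto

text \<open>As a function of z - w, \<open>surv\<close> is a constant minus an everywhere convergent
  power series.\<close>

lemma surv_tendsto:
  assumes "(f \<longlonglongrightarrow> w)"
  shows "(\<lambda>l. surv c z (f l)) \<longlonglongrightarrow> surv c z w"
proof -
  have "isCont (\<lambda>y. \<Sum>k. (c k / fact k) * y ^ k) (z - w)"
    by (rule isCont_powser_converges_everywhere) (use summable_coeff_power[OF abs_coeff] in simp)
  moreover have "(\<lambda>l. z - f l) \<longlonglongrightarrow> z - w" using assms by (intro tendsto_intros)
  ultimately have "(\<lambda>l. \<Sum>k. (c k / fact k) * (z - f l) ^ k) \<longlonglongrightarrow> (\<Sum>k. (c k / fact k) * (z - w) ^ k)"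
    by (rule isCont_tendsto_compose)
  then show ?thesis
    unfolding surv_eq[of c, OF abs_coeff] by (intro tendsto_intros) (simp add: mult_ac)
qed

lemma surv_pos:
  assumes "0 < w" "w \<le> z" "0 < c k" "1 \<le> k"
  shows "0 < surv c z w"
proof -
  have "(z - w) ^ k < z ^ k" using assms by (intro power_strict_mono) auto
  then have "0 < (\<Sum>k. c k * ((z ^ k - (z - w) ^ k) / fact k))"
    using assms c
    by (intro suminf_pos2[where i = k] summable_coeff_diff abs_coeff mult_nonneg_nonneg divide_nonneg_nonneg)
      (auto intro!: power_mono)
  then show ?thesis by (simp add: surv_def)
qed

text \<open>Each z^k e^(-z) / k! is a probability density on the half-line, so only the coefficients
  remain.\<close>

lemma nn_integral_dens:
  assumes "summable c"
  shows "(\<integral>\<^sup>+z. ennreal (dens c z) \<partial>half) = ennreal (suminf c)"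
proof -
  have "(\<integral>\<^sup>+z. ennreal (dens c z) \<partial>half) = (\<integral>\<^sup>+z. (\<Sum>k. ennreal (c k * (exp (- z) * (z ^ k / fact k)))) \<partial>half)"
  proof (rule nn_integral_cong_AE)
    show "AE z in half. ennreal (dens c z) = (\<Sum>k. ennreal (c k * (exp (- z) * (z ^ k / fact k))))"
      using AE_half
    proof eventually_elim
      case (elim z)
      have "(\<Sum>k. ennreal (exp (- z) * (c k * (z ^ k / fact k)))) = ennreal (dens c z)"
        unfolding dens_def
        by (rule suminf_ennreal_cmult[OF summable_coeff_power[OF abs_coeff]]) (use elim c in auto)
      then show ?case by (simp add: mult.left_commute)
    qed
  qed
  also have "\<dots> = (\<Sum>k. \<integral>\<^sup>+z. ennreal (c k * (exp (- z) * (z ^ k / fact k))) \<partial>half)"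
    by (rule nn_integral_suminf) measurable
  also have "\<dots> = (\<Sum>k. ennreal (c k))"
  proof (rule suminf_cong)
    fix k
    have "(\<integral>\<^sup>+z. ennreal (c k * (exp (- z) * (z ^ k / fact k))) \<partial>half) =
      (\<integral>\<^sup>+z. ennreal (c k / fact k) * (ennreal (z ^ k * exp (- z)) * indicator {0..} z) \<partial>lborel)"
      using c by (subst nn_integral_half) (auto intro!: nn_integral_cong simp: indicator_def ennreal_mult'[symmetric] mult_ac)
    also have "\<dots> = ennreal (c k / fact k) * real_of_nat (fact k)"
      by (subst nn_integral_cmult) (auto simp: nn_intergal_power_times_exp_Ici[simplified])
    also have "\<dots> = ennreal (c k)"
      using c by (simp add: ennreal_of_nat_eq_real_of_nat ennreal_mult'[symmetric])
    finally show "(\<integral>\<^sup>+z. ennreal (c k * (exp (- z) * (z ^ k / fact k))) \<partial>half) = ennreal (c k)" .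
  qed
  also have "\<dots> = ennreal (suminf c)" using assms c by (intro suminf_ennreal2)
  finally show ?thesis .
qed

lemma integrable_dens: "summable c \<Longrightarrow> integrable half (dens c)"
  using AE_half by (intro integrableI_nonneg) (auto elim!: eventually_mono intro!: dens_nonneg c simp: nn_integral_dens)

lemma integral_dens: "summable c \<Longrightarrow> (\<integral>z. dens c z \<partial>half) = suminf c"
  using AE_half c by (subst integral_eq_nn_integral)
    (auto elim!: eventually_mono intro!: dens_nonneg c simp: nn_integral_dens suminf_nonneg)

lemma integrable_surv:
  assumes "summable c" and [measurable]: "w \<in> borel_measurable borel" "k \<in> borel_measurable borel"
    and w: "\<And>z. 0 \<le> z \<Longrightarrow> 0 \<le> w z" "\<And>z. 0 \<le> z \<Longrightarrow> w z \<le> z"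
    and k: "\<And>z. 0 \<le> z \<Longrightarrow> \<bar>k z\<bar> \<le> B"
  shows "integrable half (\<lambda>z. k z * surv c z (w z))"
proof (rule Bochner_Integration.integrable_bound)
  show "integrable half (\<lambda>z. B * dens c z)"
    using integrable_dens[OF assms(1)] by simp
  show "AE z in half. norm (k z * surv c z (w z)) \<le> norm (B * dens c z)"
    using AE_half
  proof eventually_elim
    case (elim z)
    have "\<bar>k z\<bar> * \<bar>surv c z (w z)\<bar> \<le> B * dens c z"
      using surv_nonneg[OF c w[OF elim]] surv_le_dens[OF w[OF elim]] k[OF elim] k[of 0]
      by (intro mult_mono) auto
    moreover have "0 \<le> B" using k[of 0] by simp
    ultimately show ?case using dens_nonneg[OF c elim] by (simp add: abs_mult)
  qed
qed measurable

end

text \<open>Both sides are \<open>enn2real\<close> of the same double integral by Tonelli. Only the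
  inner integrals have to be finite: an infinite double integral would give 0 on both sides.\<close>

lemma min_kernel_symmetric:
  fixes f h :: "real \<Rightarrow> real"
  assumes [measurable]: "f \<in> borel_measurable borel" "h \<in> borel_measurable borel"
    and nn: "\<And>z. 0 \<le> z \<Longrightarrow> 0 \<le> f z" "\<And>z. 0 \<le> z \<Longrightarrow> 0 \<le> h z"
    and intf: "\<And>x. 0 \<le> x \<Longrightarrow> integrable half (\<lambda>z. min x z * f z)"
    and inth: "\<And>x. 0 \<le> x \<Longrightarrow> integrable half (\<lambda>z. min x z * h z)"
  shows "(\<integral>x. h x * (\<integral>z. min x z * f z \<partial>half) \<partial>half) = (\<integral>z. f z * (\<integral>x. min z x * h x \<partial>half) \<partial>half)"
proof -
  interpret pair_sigma_finite half half ..
  have *: "(\<integral>x. h x * (\<integral>z. min x z * f z \<partial>half) \<partial>half) =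
      enn2real (\<integral>\<^sup>+x. (\<integral>\<^sup>+z. ennreal (h x) * (ennreal (min x z) * ennreal (f z)) \<partial>half) \<partial>half)"
    if [measurable]: "f \<in> borel_measurable borel" "h \<in> borel_measurable borel"
    and nn: "\<And>z. 0 \<le> z \<Longrightarrow> 0 \<le> f z" "\<And>z. 0 \<le> z \<Longrightarrow> 0 \<le> h z"
    and intf: "\<And>x. 0 \<le> x \<Longrightarrow> integrable half (\<lambda>z. min x z * f z)" for f h :: "real \<Rightarrow> real"
  proof -
    note [measurable] = borel_measurable_min_integral[OF that(1)]
    have "(\<integral>x. h x * (\<integral>z. min x z * f z \<partial>half) \<partial>half) =
      enn2real (\<integral>\<^sup>+x. ennreal (h x * (\<integral>z. min x z * f z \<partial>half)) \<partial>half)"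
    proof (rule integral_eq_nn_integral)
      show "AE x in half. 0 \<le> h x * (\<integral>z. min x z * f z \<partial>half)"
        using AE_half by eventually_elim (auto intro!: mult_nonneg_nonneg integral_nonneg_half nn)
    qed measurable
    also have "(\<integral>\<^sup>+x. ennreal (h x * (\<integral>z. min x z * f z \<partial>half)) \<partial>half) =
      (\<integral>\<^sup>+x. (\<integral>\<^sup>+z. ennreal (h x) * (ennreal (min x z) * ennreal (f z)) \<partial>half) \<partial>half)"
    proof (rule nn_integral_cong_AE)
      show "AE x in half. ennreal (h x * (\<integral>z. min x z * f z \<partial>half)) =
        (\<integral>\<^sup>+z. ennreal (h x) * (ennreal (min x z) * ennreal (f z)) \<partial>half)"
        using AE_half
      proof eventually_elim
        case (elim x)
        have "AE z in half. 0 \<le> min x z * f z"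
          using AE_half by eventually_elim (use elim nn in auto)
        then have "(\<integral>\<^sup>+z. ennreal (min x z * f z) \<partial>half) = ennreal (\<integral>z. min x z * f z \<partial>half)"
          by (rule nn_integral_eq_integral[OF intf[OF elim]])
        moreover have "(\<integral>\<^sup>+z. ennreal (min x z * f z) \<partial>half) = (\<integral>\<^sup>+z. ennreal (min x z) * ennreal (f z) \<partial>half)"
          by (rule nn_integral_cong_AE) (use AE_half in \<open>eventually_elim, simp add: elim nn ennreal_mult\<close>)
        ultimately have "ennreal (h x) * (\<integral>\<^sup>+z. ennreal (min x z) * ennreal (f z) \<partial>half) =
            ennreal (h x * (\<integral>z. min x z * f z \<partial>half))"
          using nn(2)[OF elim] by (simp add: ennreal_mult')
        then show ?case by (subst nn_integral_cmult) auto
      qed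
    qed
    finally show ?thesis .
  qed
  have "(\<integral>\<^sup>+x. (\<integral>\<^sup>+z. ennreal (h x) * (ennreal (min x z) * ennreal (f z)) \<partial>half) \<partial>half) =
    (\<integral>\<^sup>+z. (\<integral>\<^sup>+x. ennreal (h x) * (ennreal (min x z) * ennreal (f z)) \<partial>half) \<partial>half)"
    by (rule Fubini') measurable
  also have "\<dots> = (\<integral>\<^sup>+z. (\<integral>\<^sup>+x. ennreal (f z) * (ennreal (min z x) * ennreal (h x)) \<partial>half) \<partial>half)"
    by (simp add: min.commute mult_ac)
  finally show ?thesis
    using *[of f h] *[of h f] nn intf inth by simp
qed

lemma summable_pmf_shift: "summable (\<lambda>k. pmf P (k + m))" for P :: "nat pmf"
proof -
  have "(\<integral>\<^sup>+k. ennreal (pmf P k) \<partial>count_space UNIV) = 1"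
    using measure_pmf.emeasure_space_1[of P] by (simp add: nn_integral_pmf)
  then have "(\<Sum>k. ennreal (pmf P k)) \<noteq> \<infinity>" by (simp add: nn_integral_count_space_nat)
  then have "summable (\<lambda>k. pmf P k)" by (intro summable_suminf_not_top) auto
  then show ?thesis by (rule summable_ignore_initial_segment)
qed

section \<open>Comparison of \<open>surv\<close> with its linearisation, and the subcritical
  case\<close>

context light_degree_law
begin

lemma summable_offspring: "summable (offspring P)"
  using summable_pmf_shift[of P 1] by (simp add: offspring_def[abs_def])

lemma summable_law: "summable (pmf P)"
  using summable_pmf_shift[of P 0] by simp

lemma g2_series_summable: "summable (\<lambda>j. pmf P (j + 2) * (z ^ j / fact j))"
  by (rule summable_coeff_power) (simp add: pmf_le_1)

text \<open>The term of degree 0 drops out, which aligns the remaining series with the one for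
  \<open>g2 P\<close>.\<close>

lemma surv_offspring_shift:
  "surv (offspring P) z y = exp (- z) * (\<Sum>j. pmf P (j + 2) * ((z ^ Suc j - (z - y) ^ Suc j) / fact (Suc j)))"
  "summable (\<lambda>j. pmf P (j + 2) * ((z ^ Suc j - (z - y) ^ Suc j) / fact (Suc j)))"
proof -
  have *: "\<bar>offspring P k\<bar> \<le> 1" for k using offspring_bounds[of P k] by simp
  show "surv (offspring P) z y = exp (- z) * (\<Sum>j. pmf P (j + 2) * ((z ^ Suc j - (z - y) ^ Suc j) / fact (Suc j)))"
    by (subst surv_shift[OF *]) (simp add: offspring_def)
  show "summable (\<lambda>j. pmf P (j + 2) * ((z ^ Suc j - (z - y) ^ Suc j) / fact (Suc j)))"
    using summable_coeff_diff[of "offspring P" z "z - y", OF *]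
    by (subst (asm) summable_Suc_iff[symmetric]) (simp add: offspring_def)
qed

lemma fact_ratio: "real (Suc j) * a / fact (Suc j) = a / fact j"
  by simp

lemma surv_le_linear:
  assumes "0 \<le> y" "y \<le> z"
  shows "surv (offspring P) z y \<le> g2 P z * y"
proof -
  have "(\<Sum>j. pmf P (j + 2) * ((z ^ Suc j - (z - y) ^ Suc j) / fact (Suc j))) \<le>
    (\<Sum>j. y * (pmf P (j + 2) * (z ^ j / fact j)))"
  proof (intro suminf_le surv_offspring_shift summable_mult g2_series_summable)
    fix j
    have "(z ^ Suc j - (z - y) ^ Suc j) / fact (Suc j) \<le> real (Suc j) * (y * z ^ j) / fact (Suc j)"
      using power_Suc_diff_bounds(2)[OF assms, of j] by (intro divide_right_mono) (auto simp: mult_ac)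
    then have "pmf P (j + 2) * ((z ^ Suc j - (z - y) ^ Suc j) / fact (Suc j)) \<le> pmf P (j + 2) * (y * z ^ j / fact j)"
      unfolding fact_ratio by (rule mult_left_mono) simp
    also have "\<dots> = y * (pmf P (j + 2) * (z ^ j / fact j))" by simp
    finally show "pmf P (j + 2) * ((z ^ Suc j - (z - y) ^ Suc j) / fact (Suc j)) \<le> y * (pmf P (j + 2) * (z ^ j / fact j))" .
  qed
  also have "\<dots> = y * (\<Sum>j. pmf P (j + 2) * (z ^ j / fact j))"
    by (rule suminf_mult[OF g2_series_summable])
  finally show ?thesis
    unfolding surv_offspring_shift(1) g2_eq dens_def
    using mult_left_mono[of _ _ "exp (- z)"] by (simp add: mult_ac)
qed

text \<open>A single strict term suffices. The condition 1 \<le> i is where the power z^(i+1) stops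
  being linear, and corresponds to P charging a degree at least 3.\<close>

lemma surv_less_linear:
  assumes "0 < y" "y \<le> z" and i: "1 \<le> i" "0 < pmf P (i + 2)"
  shows "surv (offspring P) z y < g2 P z * y"
proof -
  let ?a = "\<lambda>j. y * (pmf P (j + 2) * (z ^ j / fact j)) - pmf P (j + 2) * ((z ^ Suc j - (z - y) ^ Suc j) / fact (Suc j))"
  have eq: "?a j = pmf P (j + 2) / fact (Suc j) * (real (Suc j) * y * z ^ j - (z ^ Suc j - (z - y) ^ Suc j))" for j
    unfolding fact_ratio[of j "z ^ j", symmetric]
    by (simp add: right_diff_distrib diff_divide_distrib mult_ac del: of_nat_Suc fact_Suc power_Suc)
  have "0 < suminf ?a"
  proof (rule suminf_pos2[where i = i])
    show "summable ?a" by (intro summable_diff summable_mult g2_series_summable surv_offspring_shift)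
    show "0 \<le> ?a j" for j
      unfolding eq using power_Suc_diff_bounds(2)[of y z j] assms by (intro mult_nonneg_nonneg) (auto simp del: power_Suc)
    show "0 < ?a i"
      unfolding eq using power_Suc_diff_strict[of y z i] assms by (intro mult_pos_pos) (auto simp del: power_Suc)
  qed
  also have "suminf ?a = y * (\<Sum>j. pmf P (j + 2) * (z ^ j / fact j)) -
     (\<Sum>j. pmf P (j + 2) * ((z ^ Suc j - (z - y) ^ Suc j) / fact (Suc j)))"
    unfolding suminf_mult[OF g2_series_summable, symmetric]
    by (rule suminf_diff[OF summable_mult[OF g2_series_summable] surv_offspring_shift(2), symmetric])
  finally show ?thesis
    unfolding surv_offspring_shift(1) g2_eq dens_def
    using mult_strict_left_mono[of _ _ "exp (- z)"] by (simp add: mult_ac)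
qed

text \<open>If \<open>P\<close> is concentrated on \<open>{1, 2}\<close>, the recursion is linear and the strict inequality
  \<open>surv z y < g2 z * y\<close> fails; the critical case \<open>beta0 = 1\<close> then does not occur.\<close>

lemma ell_1_pos_if_linear:
  assumes nn: "\<And>x. 0 \<le> x \<Longrightarrow> 0 \<le> ell 1 x" and linear: "\<And>j. 1 \<le> j \<Longrightarrow> pmf P (j + 2) = 0"
  shows "ell 1 0 \<noteq> 0"
proof
  assume 0: "ell 1 0 = 0"
  have g2: "g2 P z = pmf P 2 * exp (- z)" for z
  proof -
    have "(\<Sum>j. pmf P (j + 2) * (z ^ j / fact j)) = (\<Sum>j\<in>{0}. pmf P (j + 2) * (z ^ j / fact j))"
      using linear by (intro suminf_finite) (auto simp: Suc_le_eq)
    then show ?thesis by (simp add: g2_eq dens_def numeral_2_eq_2)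
  qed
  \<comment> \<open>The Erlang density of shape 2 written as \<open>dens\<close> of a point mass, so
    that \<open>integral_dens\<close> computes its total mass.\<close>
  have d1: "dens (\<lambda>k. if k = 1 then 1 else 0) z = z * exp (- z)" for z
  proof -
    have "(\<Sum>k. (if k = 1 then 1 else 0) * (z ^ k / fact k)) = (\<Sum>k\<in>{1}. (if k = 1 then 1 else 0) * (z ^ k / fact k))"
      by (intro suminf_finite) auto
    then show ?thesis by (simp add: dens_def)
  qed
  have "(\<integral>z. z * exp (- z) \<partial>half) = 1"
  proof -
    have "(\<integral>z. dens (\<lambda>k. if k = 1 then 1 else 0) z \<partial>half) = (\<Sum>k::nat. if k = 1 then 1 else 0)"
      by (intro integral_dens summable_finite[of "{1}"]) auto
    also have "\<dots> = 1" by (subst suminf_finite[of "{1}"]) auto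
    finally show ?thesis unfolding d1 .
  qed
  moreover have "(\<integral>z. z * g2 P z \<partial>half) = (\<integral>z. pmf P 2 * (z * exp (- z)) \<partial>half)"
    unfolding g2 by (intro Bochner_Integration.integral_cong) auto
  ultimately have le1: "(\<integral>z. z * g2 P z \<partial>half) \<le> 1"
    using pmf_le_1[of P 2] by simp
  have int: "integrable half (\<lambda>z. z * (g2 P z * ell 1 z))" by (intro integrable_kernel_ell) auto
  have "(\<integral>z. max 0 (z - 0) * (g2 P z * ell 1 z) \<partial>half) = (\<integral>z. z * (g2 P z * ell 1 z) \<partial>half)"
    by (rule integral_cong_AE) (use AE_half in \<open>auto elim!: eventually_mono\<close>)
  then have "(\<integral>z. z * (g2 P z * ell 1 z) \<partial>half) = 1" using ell_eq[of 0 1] 0 by simp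
  \<comment> \<open>A root at s = 1 means that \<open>z * g2 P z * ell 1 z\<close> has integral 1,
    while \<open>ell 1\<close> \<le> 1 and \<open>z * g2 P z\<close> has integral at most 1.
    Equality throughout forces \<open>ell 1\<close> = 1 almost everywhere.\<close>
  with le1 have "(\<integral>z. z * g2 P z - z * (g2 P z * ell 1 z) \<partial>half) \<le> 0"
    using int integrable_z_g2 by (subst Bochner_Integration.integral_diff) auto
  moreover have nn1: "0 \<le> z * g2 P z - z * (g2 P z * ell 1 z)" if "0 \<le> z" for z
    using mult_left_mono[OF ell_le_1[OF nn zero_le_one that], of "z * g2 P z"] g2_nonneg[OF that] that
    by (simp add: mult_ac)
  then have "0 \<le> (\<integral>z. z * g2 P z - z * (g2 P z * ell 1 z) \<partial>half)" by (rule integral_nonneg_half)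
  ultimately have "(\<integral>z. z * g2 P z - z * (g2 P z * ell 1 z) \<partial>half) = 0" by simp
  then have "AE z in half. z * g2 P z - z * (g2 P z * ell 1 z) = 0"
    using int integrable_z_g2 nn1 by (intro integral_eq_0_AE_half) auto
  with AE_half_pos have one: "AE z in half. ell 1 z = 1"
    by eventually_elim (use g2_pos in fastforce)
  \<comment> \<open>At such a point \<open>ell_eq\<close> makes the integral over z > x vanish,
    although its integrand is positive almost everywhere there.\<close>
  from AE_half_witness[OF one order_refl] obtain x where x: "0 < x" "ell 1 x = 1" by blast
  then have "(\<integral>z. max 0 (z - x) * (g2 P z * ell 1 z) \<partial>half) = 0" using ell_eq[of x 1] by simp
  moreover have "integrable half (\<lambda>z. max 0 (z - x) * (g2 P z * ell 1 z))"
    using x by (intro integrable_kernel_ell) auto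
  ultimately have "AE z in half. max 0 (z - x) * (g2 P z * ell 1 z) = 0"
    using nn g2_nonneg by (intro integral_eq_0_AE_half mult_nonneg_nonneg) auto
  with one have "AE z in half. max 0 (z - x) * g2 P z = 0" by eventually_elim simp
  from AE_half_witness[OF this, of x] x obtain z where "z > x" "max 0 (z - x) * g2 P z = 0" by auto
  with g2_pos[of z] x show False by simp
qed

lemma integrable_offspring_surv:
  assumes "f \<in> borel_measurable borel" "k \<in> borel_measurable borel"
    and "\<And>z. 0 \<le> z \<Longrightarrow> 0 \<le> f z" "\<And>z. 0 \<le> z \<Longrightarrow> f z \<le> z" "\<And>z. 0 \<le> z \<Longrightarrow> \<bar>k z\<bar> \<le> B"
  shows "integrable half (\<lambda>z. k z * surv (offspring P) z (f z))"
  by (rule integrable_surv[OF offspring_bounds summable_offspring assms])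

lemma fixed_point_zero:
  assumes [measurable]: "f \<in> borel_measurable borel"
    and f: "\<And>z. 0 \<le> z \<Longrightarrow> 0 \<le> f z" "\<And>z. 0 \<le> z \<Longrightarrow> f z \<le> z"
    and fix_eq: "\<And>x. 0 \<le> x \<Longrightarrow> f x = (\<integral>z. min x z * surv (offspring P) z (f z) \<partial>half)"
    and ell_nn: "\<And>x. 0 \<le> x \<Longrightarrow> 0 \<le> ell 1 x"
    and x: "0 \<le> x"
  shows "f x = 0"
proof -
  define N where "N z = surv (offspring P) z (f z)" for z
  have [measurable]: "N \<in> borel_measurable borel" unfolding N_def by measurable
  have N_nn: "0 \<le> N z" if "0 \<le> z" for z
    unfolding N_def using f that by (intro surv_nonneg offspring_bounds) auto
  have N_le: "N z \<le> g2 P z * f z" if "0 \<le> z" for z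
    unfolding N_def using f that by (intro surv_le_linear) auto
  have int_N: "integrable half (\<lambda>z. k z * N z)"
    if "k \<in> borel_measurable borel" "\<And>z. 0 \<le> z \<Longrightarrow> \<bar>k z\<bar> \<le> B" for k B
    unfolding N_def using that f by (intro integrable_offspring_surv) auto
  have int_N1: "integrable half N" using int_N[of "\<lambda>_. 1" 1] by simp
  have zero_if: "f y = 0" if "AE z in half. N z = 0" "0 \<le> y" for y
  proof -
    have "f y = (\<integral>z. min y z * N z \<partial>half)" using fix_eq[OF that(2)] by (simp add: N_def)
    also have "\<dots> = 0" by (rule integral_eq_zero_AE) (use that(1) in \<open>auto elim!: eventually_mono\<close>)
    finally show ?thesis .
  qed
  have l1: "ell 1 x \<le> 1" if "0 \<le> x" for x using ell_le_1[OF ell_nn _ that] by simp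
  have int_gf: "integrable half (\<lambda>z. ell 1 z * (g2 P z * f z))"
  proof -
    have "integrable half (\<lambda>z. f z * (g2 P z * ell 1 z))"
      using f by (intro integrable_kernel_ell) auto
    then show ?thesis by (simp add: mult_ac)
  qed
  have int_ellN: "integrable half (\<lambda>z. ell 1 z * N z)"
    using ell_nn l1 by (intro int_N[where B = 1]) auto
  \<comment> \<open>Insert the integral formula for f and use symmetry to move the kernel onto
    \<open>g2 P * ell 1\<close>, where \<open>ell_eq_min\<close> at s = 1 evaluates it as
    \<open>ell 1 z - ell 1 0\<close>.\<close>
  have sym: "(\<integral>z. ell 1 z * (g2 P z * f z) \<partial>half) = (\<integral>z. N z * (ell 1 z - ell 1 0) \<partial>half)"
  proof -
    have "(\<integral>z. ell 1 z * (g2 P z * f z) \<partial>half) = (\<integral>x. (g2 P x * ell 1 x) * (\<integral>z. min x z * N z \<partial>half) \<partial>half)"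
      by (rule integral_cong_AE)
        (use AE_half borel_measurable_min_integral[of N] in \<open>auto elim!: eventually_mono simp: fix_eq[folded N_def] mult_ac\<close>)
    also have "\<dots> = (\<integral>z. N z * (\<integral>x. min z x * (g2 P x * ell 1 x) \<partial>half) \<partial>half)"
    proof (rule min_kernel_symmetric)
      show "integrable half (\<lambda>z. min x z * N z)" if "0 \<le> x" for x
        using that by (intro int_N[where B = x]) auto
      show "integrable half (\<lambda>z. min x z * (g2 P z * ell 1 z))" if "0 \<le> x" for x
        using that by (intro integrable_kernel_ell) auto
    qed (auto intro!: N_nn mult_nonneg_nonneg g2_nonneg ell_nn)
    also have "\<dots> = (\<integral>z. N z * (ell 1 z - ell 1 0) \<partial>half)"
    proof (rule integral_cong_AE)
      show "AE z in half. N z * (\<integral>x. min z x * (g2 P x * ell 1 x) \<partial>half) = N z * (ell 1 z - ell 1 0)"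
        using AE_half
      proof eventually_elim
        case (elim z)
        have "(\<integral>x. min z x * (g2 P x * ell 1 x) \<partial>half) = ell 1 z - ell 1 0"
          using ell_eq_min[OF elim, of 1] by linarith
        then show ?case by (simp only:)
      qed
    qed (use borel_measurable_min_integral[of "\<lambda>x. g2 P x * ell 1 x"] in auto)
    finally show ?thesis .
  qed
  have "(\<integral>z. N z * (ell 1 z - ell 1 0) \<partial>half) = (\<integral>z. ell 1 z * N z \<partial>half) - ell 1 0 * (\<integral>z. N z \<partial>half)"
    using Bochner_Integration.integral_diff[OF int_ellN integrable_mult_right[OF int_N1, of "ell 1 0"]]
    by (simp add: algebra_simps)
  \<comment> \<open>Two nonnegative terms with sum 0: the first measures the gap in the tangent
    bound, the second the distance of s = 1 from being a root.\<close>
  with sym int_gf int_ellN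
  have balance: "(\<integral>z. ell 1 z * (g2 P z * f z) - ell 1 z * N z \<partial>half) + ell 1 0 * (\<integral>z. N z \<partial>half) = 0"
    by simp
  have diff_nn: "0 \<le> ell 1 z * (g2 P z * f z) - ell 1 z * N z" if "0 \<le> z" for z
    using mult_left_mono[OF N_le[OF that] ell_nn[OF that]] by simp
  have nn1: "0 \<le> (\<integral>z. ell 1 z * (g2 P z * f z) - ell 1 z * N z \<partial>half)"
    by (rule integral_nonneg_half[OF diff_nn])
  have nn2: "0 \<le> ell 1 0 * (\<integral>z. N z \<partial>half)"
    by (intro mult_nonneg_nonneg ell_nn integral_nonneg_half N_nn) auto
  from balance nn1 nn2 have z1: "(\<integral>z. ell 1 z * (g2 P z * f z) - ell 1 z * N z \<partial>half) = 0"
    and z2: "ell 1 0 * (\<integral>z. N z \<partial>half) = 0" by linarith+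
  show ?thesis
  proof (cases "ell 1 0 = 0")
    case False
    with z2 have "(\<integral>z. N z \<partial>half) = 0" by simp
    then have "AE z in half. N z = 0" using int_N1 N_nn by (intro integral_eq_0_AE_half)
    then show ?thesis using x by (rule zero_if)
  next
    case True
    from z1 have "AE z in half. ell 1 z * (g2 P z * f z) - ell 1 z * N z = 0"
      using int_gf int_ellN diff_nn by (intro integral_eq_0_AE_half) auto
    \<comment> \<open>The critical case: dividing by the positive \<open>ell 1\<close> shows that
      the tangent bound is attained almost everywhere.\<close>
    with AE_half_pos have N_eq: "AE z in half. 0 < z \<and> N z = g2 P z * f z"
    proof eventually_elim
      case (elim z)
      with ell_pos[OF ell_nn zero_less_one, of z] have "ell 1 z \<noteq> 0" by simp
      with elim show ?case by (simp flip: right_diff_distrib)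
    qed
    \<comment> \<open>A root at s = 1 rules out the linear recursion, so P charges a degree at least
      3 and the tangent bound is strict wherever f is positive.\<close>
    obtain j where j: "1 \<le> j" "0 < pmf P (j + 2)"
      using ell_1_pos_if_linear[OF ell_nn] True pmf_pos[of _ P] by (metis less_le pmf_nonneg)
    show ?thesis
    proof (rule ccontr)
      assume "f x \<noteq> 0"
      \<comment> \<open>A zero of f at one z > 0 forces N to vanish almost everywhere, and then f
        vanishes on the whole half-line.\<close>
      have pos: "0 < f z" if "0 < z" for z
      proof (rule ccontr)
        assume "\<not> 0 < f z"
        then have "f z = 0" using f(1)[of z] that by simp
        then have "(\<integral>t. min z t * N t \<partial>half) = 0" using fix_eq[of z] that by (simp add: N_def)
        then have "AE t in half. min z t * N t = 0"
          using that N_nn by (intro integral_eq_0_AE_half int_N[where B = z]) auto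
        with AE_half_pos have "AE t in half. N t = 0" by eventually_elim (use that in auto)
        from zero_if[OF this x] show False using \<open>f x \<noteq> 0\<close> by simp
      qed
      from AE_half_witness[OF N_eq order_refl] obtain z where z: "0 < z" "N z = g2 P z * f z" by auto
      have "N z < g2 P z * f z"
        unfolding N_def using pos f z j by (intro surv_less_linear[of _ _ j]) auto
      with z show False by simp
    qed
  qed
qed

text \<open>The decreasing iterates have a pointwise limit, and domination by a multiple of
  \<open>dens\<close> carries the limit through the recursion, so it is a fixed point and hence 0. A
  second dominated convergence transfers this to the root.\<close>

lemma subcritical:
  assumes beta: "beta0 P \<le> 1"
    and w_bounds: "\<And>l x. 0 \<le> x \<Longrightarrow> 0 \<le> W (offspring P) l x" "\<And>l x. 0 \<le> x \<Longrightarrow> W (offspring P) l x \<le> x"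
    and w_dec: "\<And>l x. 0 \<le> x \<Longrightarrow> W (offspring P) (Suc l) x \<le> W (offspring P) l x"
  shows "(\<lambda>l. \<integral>z. surv (pmf P) z (W (offspring P) l z) \<partial>half) \<longlonglongrightarrow> 0"
proof -
  obtain s0 where s0: "0 < s0" "\<And>s. 0 \<le> s \<Longrightarrow> s < s0 \<Longrightarrow> ell s 0 \<noteq> 0" "beta0 P = 1 / s0"
    using beta0_root by metis
  \<comment> \<open>In the variable s the hypothesis places the first root at or beyond 1, so
    \<open>ell 1\<close> is still nonnegative.\<close>
  have "1 \<le> s0" using beta s0 by (simp add: field_simps)
  then have ell_nn: "0 \<le> ell 1 x" if "0 \<le> x" for x
    using s0 that by (intro ell_nonneg_below_root) auto
  define f where "f x = lim (\<lambda>l. W (offspring P) l x)" for x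
  have [measurable]: "f \<in> borel_measurable borel" unfolding f_def by measurable
  have lim: "(\<lambda>l. W (offspring P) l x) \<longlonglongrightarrow> f x" if x: "0 \<le> x" for x
  proof -
    have "decseq (\<lambda>l. W (offspring P) l x)" using w_dec[OF x] by (intro decseq_SucI)
    then obtain L where "(\<lambda>l. W (offspring P) l x) \<longlonglongrightarrow> L"
      by (rule decseq_convergent) (use w_bounds(1)[OF x] in auto)
    then have "convergent (\<lambda>l. W (offspring P) l x)" by (rule convergentI)
    then show ?thesis unfolding f_def by (simp add: convergent_LIMSEQ_iff)
  qed
  have f: "0 \<le> f x" "f x \<le> x" if "0 \<le> x" for x
    using lim[OF that] w_bounds[OF that] by (auto intro: LIMSEQ_le_const LIMSEQ_le_const2)
  have fix_eq: "f x = (\<integral>z. min x z * surv (offspring P) z (f z) \<partial>half)" if x: "0 \<le> x" for x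
  proof -
    have "(\<lambda>l. \<integral>z. min x z * surv (offspring P) z (W (offspring P) l z) \<partial>half) \<longlonglongrightarrow> (\<integral>z. min x z * surv (offspring P) z (f z) \<partial>half)"
    proof (rule integral_dominated_convergence)
      show "integrable half (\<lambda>z. x * dens (offspring P) z)"
        using integrable_dens[OF offspring_bounds summable_offspring] by simp
      show "AE z in half. (\<lambda>l. min x z * surv (offspring P) z (W (offspring P) l z)) \<longlonglongrightarrow> min x z * surv (offspring P) z (f z)"
        using AE_half by eventually_elim (intro tendsto_intros surv_tendsto[OF offspring_bounds] lim)
      show "AE z in half. norm (min x z * surv (offspring P) z (W (offspring P) l z)) \<le> x * dens (offspring P) z" for l
        using AE_half
      proof eventually_elim
        case (elim z)
        show ?case
          using x elim surv_nonneg[OF offspring_bounds w_bounds[OF elim]]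
            surv_le_dens[OF offspring_bounds w_bounds[OF elim]]
          by (auto simp: abs_mult intro!: mult_mono)
      qed
    qed measurable
    then have "(\<lambda>l. W (offspring P) (Suc l) x) \<longlonglongrightarrow> (\<integral>z. min x z * surv (offspring P) z (f z) \<partial>half)" by simp
    moreover have "(\<lambda>l. W (offspring P) (Suc l) x) \<longlonglongrightarrow> f x" using lim[OF x] by (rule LIMSEQ_Suc)
    ultimately show ?thesis by (rule LIMSEQ_unique[symmetric])
  qed
  have f0: "f z = 0" if "0 \<le> z" for z
    by (rule fixed_point_zero[OF _ f fix_eq ell_nn that]) auto
  have "(\<lambda>l. \<integral>z. surv (pmf P) z (W (offspring P) l z) \<partial>half) \<longlonglongrightarrow> (\<integral>z. 0 \<partial>half)"
  proof (rule integral_dominated_convergence)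
    show "integrable half (dens (pmf P))"
      by (rule integrable_dens[OF _ _ summable_law]) (auto simp: pmf_le_1)
    show "AE z in half. (\<lambda>l. surv (pmf P) z (W (offspring P) l z)) \<longlonglongrightarrow> 0"
      using AE_half
    proof eventually_elim
      case (elim z)
      have "(\<lambda>l. surv (pmf P) z (W (offspring P) l z)) \<longlonglongrightarrow> surv (pmf P) z (f z)"
        by (rule surv_tendsto[OF _ _ lim[OF elim]]) (auto simp: pmf_le_1)
      then show ?case by (simp add: f0[OF elim] surv_def)
    qed
    show "AE z in half. norm (surv (pmf P) z (W (offspring P) l z)) \<le> dens (pmf P) z" for l
      using AE_half
    proof eventually_elim
      case (elim z)
      show ?case
        using surv_nonneg[OF _ _ w_bounds[OF elim], of "pmf P"] surv_le_dens[OF _ _ w_bounds[OF elim], of "pmf P"]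
        by (simp add: pmf_le_1)
    qed
  qed measurable
  then show ?thesis by simp
qed

section \<open>The truncated weight and the supercritical case\<close>

definition g2_trunc :: "nat \<Rightarrow> real \<Rightarrow> real" where
  "g2_trunc m = dens (\<lambda>k. if k \<le> m then pmf P (k + 2) else 0)"

lemma measurable_g2_trunc [measurable]: "g2_trunc m \<in> borel_measurable borel"
  unfolding g2_trunc_def by measurable

lemma g2_trunc_eq: "g2_trunc m z = exp (- z) * (\<Sum>k\<le>m. pmf P (k + 2) * (z ^ k / fact k))"
proof -
  have "(\<Sum>k. (if k \<le> m then pmf P (k + 2) else 0) * (z ^ k / fact k)) =
    (\<Sum>k\<le>m. (if k \<le> m then pmf P (k + 2) else 0) * (z ^ k / fact k))"
    by (intro suminf_finite) auto
  then show ?thesis by (simp add: g2_trunc_def dens_def)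
qed

lemma g2_trunc_bounds:
  assumes "0 \<le> z" shows "0 \<le> g2_trunc m z" "g2_trunc m z \<le> g2 P z"
proof -
  show "0 \<le> g2_trunc m z" unfolding g2_trunc_eq using assms by (intro mult_nonneg_nonneg sum_nonneg) auto
  have "(\<Sum>k\<le>m. pmf P (k + 2) * (z ^ k / fact k)) \<le> (\<Sum>k. pmf P (k + 2) * (z ^ k / fact k))"
    using assms by (intro sum_le_suminf g2_series_summable) auto
  then show "g2_trunc m z \<le> g2 P z"
    unfolding g2_trunc_eq g2_eq dens_def by (intro mult_left_mono) auto
qed

lemma g2_trunc_tendsto: "(\<lambda>m. g2_trunc m z) \<longlonglongrightarrow> g2 P z"
  unfolding g2_trunc_eq g2_eq dens_def
  by (intro tendsto_intros summable_LIMSEQ' g2_series_summable)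

text \<open>The weight z is the one that appears once concavity replaces
  \<open>min x z * e z\<close> by \<open>z * e x\<close> in \<open>ex_subsolution\<close>.\<close>

lemma g2_trunc_integral_tendsto: "(\<lambda>m. \<integral>z. z * (g2 P z - g2_trunc m z) \<partial>half) \<longlonglongrightarrow> 0"
proof -
  have "(\<lambda>m. \<integral>z. z * (g2 P z - g2_trunc m z) \<partial>half) \<longlonglongrightarrow> (\<integral>z. 0 \<partial>half)"
  proof (rule integral_dominated_convergence)
    show "integrable half (\<lambda>z. z * g2 P z)" by (rule integrable_z_g2)
    show "AE z in half. (\<lambda>m. z * (g2 P z - g2_trunc m z)) \<longlonglongrightarrow> 0"
    proof (rule AE_I2)
      fix z
      have "(\<lambda>m. z * (g2 P z - g2_trunc m z)) \<longlonglongrightarrow> z * (g2 P z - g2 P z)"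
        by (intro tendsto_intros g2_trunc_tendsto)
      then show "(\<lambda>m. z * (g2 P z - g2_trunc m z)) \<longlonglongrightarrow> 0" by simp
    qed
    show "AE z in half. norm (z * (g2 P z - g2_trunc m z)) \<le> z * g2 P z" for m
      using AE_half
    proof eventually_elim
      case (elim z)
      with g2_trunc_bounds[OF elim, of m] show ?case by (auto simp: abs_mult intro!: mult_left_mono)
    qed
  qed measurable
  then show ?thesis by simp
qed

text \<open>For y \<le> \<epsilon> z the lower mean value bound leaves (z - y)^k \<ge> (1 -
  \<epsilon>)^k z^k, and Bernoulli bounds (1 - \<epsilon>)^k below by 1 - m \<epsilon> for k \<le>
  m. The resulting factor is the same for all z.\<close>

lemma surv_ge_trunc:
  assumes "0 \<le> y" "y \<le> \<epsilon> * z" "0 \<le> z" "0 \<le> \<epsilon>" "\<epsilon> \<le> 1"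
  shows "(1 - real m * \<epsilon>) * (g2_trunc m z * y) \<le> surv (offspring P) z y"
proof -
  have yz: "y \<le> z" using assms mult_right_mono[of \<epsilon> 1 z] by simp
  have "(1 - real m * \<epsilon>) * (y * (\<Sum>k\<le>m. pmf P (k + 2) * (z ^ k / fact k))) =
    (\<Sum>k\<le>m. pmf P (k + 2) * (((1 - real m * \<epsilon>) * z ^ k * y) / fact k))"
    by (simp add: sum_distrib_left mult_ac)
  also have "\<dots> \<le> (\<Sum>k\<le>m. pmf P (k + 2) * ((z ^ Suc k - (z - y) ^ Suc k) / fact (Suc k)))"
  proof (rule sum_mono)
    fix k assume k: "k \<in> {..m}"
    have "1 - real m * \<epsilon> \<le> 1 + real k * (- \<epsilon>)" using k assms by (simp add: mult_right_mono)
    also have "\<dots> \<le> (1 + (- \<epsilon>)) ^ k" using assms by (intro Bernoulli_inequality) auto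
    finally have "(1 - real m * \<epsilon>) * z ^ k \<le> ((1 - \<epsilon>) * z) ^ k"
      using assms by (simp add: power_mult_distrib mult_right_mono)
    also have "\<dots> \<le> (z - y) ^ k"
      using assms by (intro power_mono) (auto simp: algebra_simps mult_left_le_one_le)
    finally have "(1 - real m * \<epsilon>) * z ^ k * y \<le> (z - y) ^ k * y"
      using assms by (intro mult_right_mono)
    then have "((1 - real m * \<epsilon>) * z ^ k * y) / fact k \<le> ((z - y) ^ k * y) / fact k"
      by (rule divide_right_mono) simp
    also have "\<dots> = (real (Suc k) * ((z - y) ^ k * y)) / fact (Suc k)" by (rule fact_ratio[symmetric])
    also have "\<dots> \<le> (z ^ Suc k - (z - y) ^ Suc k) / fact (Suc k)"
      using power_Suc_diff_bounds(1)[OF assms(1) yz, of k] by (intro divide_right_mono) (auto simp: mult_ac)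
    finally show "pmf P (k + 2) * (((1 - real m * \<epsilon>) * z ^ k * y) / fact k) \<le>
        pmf P (k + 2) * ((z ^ Suc k - (z - y) ^ Suc k) / fact (Suc k))"
      by (rule mult_left_mono) simp
  qed
  also have "\<dots> \<le> (\<Sum>k. pmf P (k + 2) * ((z ^ Suc k - (z - y) ^ Suc k) / fact (Suc k)))"
  proof (intro sum_le_suminf surv_offspring_shift(2))
    fix k
    have "(z - y) ^ Suc k \<le> z ^ Suc k" using assms yz by (intro power_mono) auto
    then show "0 \<le> pmf P (k + 2) * ((z ^ Suc k - (z - y) ^ Suc k) / fact (Suc k))"
      by (intro mult_nonneg_nonneg divide_nonneg_nonneg) auto
  qed simp
  finally have "exp (- z) * ((1 - real m * \<epsilon>) * (y * (\<Sum>k\<le>m. pmf P (k + 2) * (z ^ k / fact k)))) \<le>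
    surv (offspring P) z y"
    unfolding surv_offspring_shift(1) by (rule mult_left_mono) simp
  then show ?thesis unfolding g2_trunc_eq by (simp only: mult_ac)
qed

text \<open>The integral is the probability under P of a degree at least 2.\<close>

lemma integral_g2_le_1: "integrable half (g2 P)" "(\<integral>z. g2 P z \<partial>half) \<le> 1"
proof -
  have s: "summable (\<lambda>k. pmf P (k + 2))" by (rule summable_pmf_shift)
  show "integrable half (g2 P)" unfolding g2_eq by (rule integrable_dens[OF _ _ s]) (auto simp: pmf_le_1)
  have "(\<integral>z. g2 P z \<partial>half) = (\<Sum>k. pmf P (k + 2))"
    unfolding g2_eq by (rule integral_dens[OF _ _ s]) (auto simp: pmf_le_1)
  also have "\<dots> \<le> 1"
  proof (rule suminf_le_const[OF s])
    fix N
    have "(\<Sum>k<N. pmf P (k + 2)) = sum (pmf P) ((\<lambda>k. k + 2) ` {..<N})"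
      by (subst sum.reindex) (auto simp: inj_on_def)
    also have "\<dots> = measure (measure_pmf P) ((\<lambda>k. k + 2) ` {..<N})"
      by (rule measure_measure_pmf_finite[symmetric]) simp
    also have "\<dots> \<le> 1" by simp
    finally show "(\<Sum>k<N. pmf P (k + 2)) \<le> 1" .
  qed
  finally show "(\<integral>z. g2 P z \<partial>half) \<le> 1" .
qed

text \<open>For fixed t, min x t is nondecreasing in x while (min x t) / x is nonincreasing; each
  property settles one order of x and z.\<close>

lemma min_kernel_concave:
  fixes x z t :: real
  assumes "0 \<le> x" "0 \<le> z" "0 \<le> t"
  shows "min x z * min z t \<le> z * min x t"
proof (cases "x \<le> z")
  case True
  then have "x * min z t \<le> z * min x t"
    using assms mult_mono[of x z t t] mult_left_mono[of "min z t" z x] by (cases "t \<le> x") (auto simp: min_def mult_ac)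
  with True show ?thesis by (simp add: min_absorb1)
next
  case False
  then have "min z t \<le> min x t" by auto
  then show ?thesis using False assms by (simp add: min_absorb2 mult_left_mono)
qed

text \<open>The linearised operator multiplies the eigenfunction e by 1 / s0 > 1. This surplus pays
  for two losses: truncation, a factor 1 - \<eta>, and nonlinearity, a factor 1 - m \<epsilon>. The
  subsolution is a multiple of h, s0 times the image of e under the truncated operator: as an
  integral against min x z, h allows the final inequality to be checked on integrands.\<close>

lemma ex_subsolution:
  assumes beta: "beta0 P > 1"
  obtains f where "f \<in> borel_measurable borel" "\<And>x. 0 < x \<Longrightarrow> 0 < f x"
    "\<And>x. 0 \<le> x \<Longrightarrow> 0 \<le> f x" "\<And>x. 0 \<le> x \<Longrightarrow> f x \<le> x"
    "\<And>x. 0 \<le> x \<Longrightarrow> f x \<le> (\<integral>z. min x z * surv (offspring P) z (f z) \<partial>half)"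
proof -
  obtain s0 where s0: "0 < s0" "ell s0 0 = 0" "\<And>s. 0 \<le> s \<Longrightarrow> s < s0 \<Longrightarrow> ell s 0 \<noteq> 0" "beta0 P = 1 / s0"
    using beta0_root by metis
  have s01: "s0 < 1" using beta s0 by (simp add: field_simps)
  define e where "e = ell s0"
  have [measurable]: "e \<in> borel_measurable borel" by (simp add: e_def)
  have e_nn: "0 \<le> e x" if "0 \<le> x" for x
    unfolding e_def using s0 that by (intro ell_nonneg_below_root) auto
  have e_pos: "0 < e x" if "0 < x" for x
    unfolding e_def using s0 that e_nn[unfolded e_def] by (intro ell_pos) auto
  have e_le_1: "e x \<le> 1" if "0 \<le> x" for x
    unfolding e_def using s0 that e_nn[unfolded e_def] by (intro ell_le_1) auto
  have e_abs: "\<bar>e x\<bar> \<le> 1" if "0 \<le> x" for x using e_nn[OF that] e_le_1[OF that] by simp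
  have e_eq: "e x = s0 * (\<integral>z. min x z * (g2 P z * e z) \<partial>half)" if "0 \<le> x" for x
    using ell_eq_min[OF that, of s0] s0(2) unfolding e_def by linarith
  have int_ge: "integrable half (\<lambda>z. min x z * (g2 P z * e z))" if "0 \<le> x" for x
    using that e_abs by (intro integrable_kernel[where B = 1]) auto
  \<comment> \<open>The eigenfunction inherits this from the kernel. It lets e x be pulled out of
    the truncation error, which makes that error relative to e x and uniform in x.\<close>
  have e_concave: "min x z * e z \<le> z * e x" if "0 \<le> x" "0 \<le> z" for x z
  proof -
    have "(\<integral>t. min x z * (min z t * (g2 P t * e t)) \<partial>half) \<le> (\<integral>t. z * (min x t * (g2 P t * e t)) \<partial>half)"
    proof (rule integral_mono_half)
      fix t :: real assume t: "0 \<le> t"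
      have "min x z * min z t * (g2 P t * e t) \<le> z * min x t * (g2 P t * e t)"
        using min_kernel_concave[OF that t] g2_nonneg[OF t] e_nn[OF t] by (intro mult_right_mono) auto
      then show "min x z * (min z t * (g2 P t * e t)) \<le> z * (min x t * (g2 P t * e t))" by (simp only: mult.assoc)
    qed (use that in \<open>auto intro!: integrable_mult_right int_ge\<close>)
    then have "s0 * (min x z * (\<integral>t. min z t * (g2 P t * e t) \<partial>half)) \<le> s0 * (z * (\<integral>t. min x t * (g2 P t * e t) \<partial>half))"
      using s0(1) by (intro mult_left_mono) auto
    then show ?thesis unfolding e_eq[OF that(1)] e_eq[OF that(2)] by (simp only: mult.left_commute)
  qed
  \<comment> \<open>Half of the gap 1 - s0; the other half leaves room for the nonlinear
    loss.\<close>
  define \<eta> where "\<eta> = (1 - s0) / 2"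
  have \<eta>: "0 < \<eta>" "s0 < 1 - \<eta>" using s01 by (auto simp: \<eta>_def field_simps)
  obtain m where m: "(\<integral>z. z * (g2 P z - g2_trunc m z) \<partial>half) < \<eta>"
    using order_tendstoD(2)[OF g2_trunc_integral_tendsto \<eta>(1)] by (auto simp: eventually_sequentially)
  have int_te: "integrable half (\<lambda>z. min x z * (g2_trunc m z * e z))" if x: "0 \<le> x" for x
  proof (rule Bochner_Integration.integrable_bound[OF int_ge[OF x]])
    show "AE z in half. norm (min x z * (g2_trunc m z * e z)) \<le> norm (min x z * (g2 P z * e z))"
      using AE_half
    proof eventually_elim
      case (elim z)
      show ?case
        using g2_trunc_bounds[OF elim, of m] e_nn[OF elim] x elim
        by (auto simp: abs_mult intro!: mult_left_mono mult_right_mono)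
    qed
  qed measurable
  define h where "h x = s0 * (\<integral>z. min x z * (g2_trunc m z * e z) \<partial>half)" for x
  have [measurable]: "h \<in> borel_measurable borel"
    unfolding h_def using borel_measurable_min_integral[of "\<lambda>z. g2_trunc m z * e z"] by measurable
  \<comment> \<open>Provides \<epsilon> h z \<le> \<epsilon> z, the smallness relative to z that
    \<open>surv_ge_trunc\<close> requires.\<close>
  have h_le: "h x \<le> x" if x: "0 \<le> x" for x
  proof -
    have "(\<integral>z. min x z * (g2_trunc m z * e z) \<partial>half) \<le> (\<integral>z. x * g2 P z \<partial>half)"
    proof (rule integral_mono_half[OF int_te[OF x]])
      show "min x z * (g2_trunc m z * e z) \<le> x * g2 P z" if "0 \<le> z" for z
      proof -
        have "g2_trunc m z * e z \<le> g2 P z * 1"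
          using g2_trunc_bounds[OF that] e_nn[OF that] e_le_1[OF that] g2_nonneg[OF that] by (intro mult_mono) auto
        then show ?thesis
          using x g2_trunc_bounds[OF that] e_nn[OF that] by (intro mult_mono) auto
      qed
    qed (use integral_g2_le_1 in simp)
    also have "\<dots> \<le> x * 1" using integral_g2_le_1 x by (simp add: mult_left_le)
    finally have "(\<integral>z. min x z * (g2_trunc m z * e z) \<partial>half) \<le> x" by simp
    moreover have "0 \<le> (\<integral>z. min x z * (g2_trunc m z * e z) \<partial>half)"
      using x g2_trunc_bounds e_nn by (intro integral_nonneg_half mult_nonneg_nonneg) auto
    ultimately show ?thesis
      unfolding h_def using s0(1) s01 mult_left_le_one_le[of _ s0] by (meson less_imp_le order_trans)
  qed
  have h_ge: "(1 - \<eta>) * e x \<le> h x" if x: "0 \<le> x" for x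
  proof -
    let ?d = "\<lambda>z. z * (g2 P z - g2_trunc m z)"
    have int_d: "integrable half ?d"
    proof (rule Bochner_Integration.integrable_bound[OF integrable_z_g2])
      show "AE z in half. norm (?d z) \<le> norm (z * g2 P z)"
        using AE_half
      proof eventually_elim
        case (elim z)
        with g2_trunc_bounds[OF elim, of m] show ?case by (auto simp: abs_mult intro!: mult_left_mono)
      qed
    qed measurable
    have "(\<integral>z. min x z * (g2 P z * e z) - min x z * (g2_trunc m z * e z) \<partial>half) \<le> (\<integral>z. e x * ?d z \<partial>half)"
    proof (rule integral_mono_half)
      fix z :: real assume z: "0 \<le> z"
      have "(min x z * e z) * (g2 P z - g2_trunc m z) \<le> (z * e x) * (g2 P z - g2_trunc m z)"
        using e_concave[OF x z] g2_trunc_bounds[OF z, of m] by (intro mult_right_mono) auto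
      then show "min x z * (g2 P z * e z) - min x z * (g2_trunc m z * e z) \<le> e x * ?d z"
        by (simp add: algebra_simps)
    qed (use int_d int_ge[OF x] int_te[OF x] in auto)
    also have "\<dots> = e x * (\<integral>z. ?d z \<partial>half)" by simp
    also have "\<dots> \<le> e x * \<eta>" using m e_nn[OF x] by (intro mult_left_mono) auto
    finally have "(\<integral>z. min x z * (g2 P z * e z) \<partial>half) - (\<integral>z. min x z * (g2_trunc m z * e z) \<partial>half) \<le> e x * \<eta>"
      using int_ge[OF x] int_te[OF x] by simp
    then have "s0 * ((\<integral>z. min x z * (g2 P z * e z) \<partial>half) - (\<integral>z. min x z * (g2_trunc m z * e z) \<partial>half)) \<le> s0 * (e x * \<eta>)"
      using s0(1) by (intro mult_left_mono) auto
    moreover have "s0 * (e x * \<eta>) \<le> e x * \<eta>"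
      using s01 s0(1) e_nn[OF x] \<eta>(1) by (intro mult_left_le_one_le) auto
    ultimately show ?thesis
      using e_eq[OF x] unfolding h_def by (simp add: algebra_simps)
  qed
  \<comment> \<open>Chosen so that (m + 1) \<epsilon> = 1 - s0 / (1 - \<eta>), whence the two losses
    together leave at least s0. The + 1 covers m = 0 and keeps \<epsilon> \<le> 1.\<close>
  define \<epsilon> where "\<epsilon> = (1 - s0 / (1 - \<eta>)) / (real m + 1)"
  have \<epsilon>: "0 < \<epsilon>" "\<epsilon> \<le> 1" "s0 \<le> (1 - real m * \<epsilon>) * (1 - \<eta>)"
  proof -
    have r: "0 < s0 / (1 - \<eta>)" "s0 / (1 - \<eta>) < 1" using \<eta> s0(1) by auto
    show "0 < \<epsilon>" using r by (simp add: \<epsilon>_def)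
    show "\<epsilon> \<le> 1" using r by (simp add: \<epsilon>_def field_simps)
    have "(real m + 1) * \<epsilon> = 1 - s0 / (1 - \<eta>)" by (simp add: \<epsilon>_def)
    then have "real m * \<epsilon> \<le> 1 - s0 / (1 - \<eta>)" using \<open>0 < \<epsilon>\<close> by (simp add: algebra_simps)
    then have "s0 / (1 - \<eta>) * (1 - \<eta>) \<le> (1 - real m * \<epsilon>) * (1 - \<eta>)"
      using \<eta> s0(1) by (intro mult_right_mono) auto
    then show "s0 \<le> (1 - real m * \<epsilon>) * (1 - \<eta>)" using \<eta> s0(1) by simp
  qed
  have h_nn: "0 \<le> h x" if "0 \<le> x" for x
    using order_trans[OF _ h_ge[OF that], of 0] e_nn[OF that] \<eta> s0(1) by simp
  have sub_le: "\<epsilon> * h x \<le> x" if "0 \<le> x" for x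
    using mult_mono[of \<epsilon> 1 "h x" x] \<epsilon> h_nn[OF that] h_le[OF that] by simp
  show thesis
  proof (rule that[of "\<lambda>x. \<epsilon> * h x"])
    show "(\<lambda>x. \<epsilon> * h x) \<in> borel_measurable borel" by measurable
    show "0 < \<epsilon> * h x" if "0 < x" for x
      using h_ge[of x] e_pos[OF that] that \<epsilon> \<eta> s0(1) by (smt (verit) mult_pos_pos)
    show "0 \<le> \<epsilon> * h x" if "0 \<le> x" for x using h_nn[OF that] \<epsilon> by simp
    show "\<epsilon> * h x \<le> x" if "0 \<le> x" for x by (rule sub_le[OF that])
    show "\<epsilon> * h x \<le> (\<integral>z. min x z * surv (offspring P) z (\<epsilon> * h z) \<partial>half)" if x: "0 \<le> x" for x
    proof -
      have "\<epsilon> * h x = (\<integral>z. \<epsilon> * s0 * (min x z * (g2_trunc m z * e z)) \<partial>half)"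
        by (simp add: h_def)
      also have "\<dots> \<le> (\<integral>z. min x z * surv (offspring P) z (\<epsilon> * h z) \<partial>half)"
      proof (rule integral_mono_half)
        show "integrable half (\<lambda>z. \<epsilon> * s0 * (min x z * (g2_trunc m z * e z)))"
          by (rule integrable_mult_right[OF int_te[OF x]])
        show "integrable half (\<lambda>z. min x z * surv (offspring P) z (\<epsilon> * h z))"
          using x sub_le h_nn \<epsilon> by (intro integrable_offspring_surv[where B = x]) auto
        fix z :: real assume z: "0 \<le> z"
        have "\<epsilon> * s0 * (g2_trunc m z * e z) \<le> \<epsilon> * ((1 - real m * \<epsilon>) * (1 - \<eta>)) * (g2_trunc m z * e z)"
          using \<epsilon> g2_trunc_bounds[OF z] e_nn[OF z] by (intro mult_right_mono mult_left_mono) auto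
        also have "\<dots> = (\<epsilon> * (1 - real m * \<epsilon>) * g2_trunc m z) * ((1 - \<eta>) * e z)" by (simp only: mult_ac)
        also have "\<dots> \<le> (\<epsilon> * (1 - real m * \<epsilon>) * g2_trunc m z) * h z"
        proof (rule mult_left_mono[OF h_ge[OF z]])
          have "0 < (1 - real m * \<epsilon>) * (1 - \<eta>)" using \<epsilon>(3) s0(1) by simp
          then have "0 < 1 - real m * \<epsilon>" using \<eta> s0(1) by (simp add: zero_less_mult_iff)
          then show "0 \<le> \<epsilon> * (1 - real m * \<epsilon>) * g2_trunc m z"
            using \<epsilon> g2_trunc_bounds[OF z] by (intro mult_nonneg_nonneg) auto
        qed
        also have "\<dots> = (1 - real m * \<epsilon>) * (g2_trunc m z * (\<epsilon> * h z))" by (simp only: mult_ac)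
        also have "\<dots> \<le> surv (offspring P) z (\<epsilon> * h z)"
          using \<epsilon> h_nn[OF z] h_le[OF z] z by (intro surv_ge_trunc) auto
        finally have "min x z * (\<epsilon> * s0 * (g2_trunc m z * e z)) \<le> min x z * surv (offspring P) z (\<epsilon> * h z)"
          using x z by (intro mult_left_mono) auto
        then show "\<epsilon> * s0 * (min x z * (g2_trunc m z * e z)) \<le> min x z * surv (offspring P) z (\<epsilon> * h z)"
          by (simp only: mult_ac)
      qed
      finally show ?thesis .
    qed
  qed
qed

text \<open>\<open>surv\<close> is monotone in its last argument, so a subsolution stays below every
  iterate; the start is covered by \<open>surv\<close> \<le> \<open>dens\<close>. The bound \<delta>
  is the survival integral at the root with the subsolution in place of the iterates, positive
  because P charges some degree at least 2.\<close>

lemma supercritical: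
  assumes beta: "beta0 P > 1"
    and w_bounds: "\<And>l x. 0 \<le> x \<Longrightarrow> 0 \<le> W (offspring P) l x" "\<And>l x. 0 \<le> x \<Longrightarrow> W (offspring P) l x \<le> x"
  shows "\<exists>\<delta>>0. \<forall>l. \<delta> \<le> (\<integral>z. surv (pmf P) z (W (offspring P) l z) \<partial>half)"
proof -
  obtain f where [measurable]: "f \<in> borel_measurable borel"
    and f: "\<And>x. 0 < x \<Longrightarrow> 0 < f x" "\<And>x. 0 \<le> x \<Longrightarrow> 0 \<le> f x" "\<And>x. 0 \<le> x \<Longrightarrow> f x \<le> x"
    and sub: "\<And>x. 0 \<le> x \<Longrightarrow> f x \<le> (\<integral>z. min x z * surv (offspring P) z (f z) \<partial>half)"
    using ex_subsolution[OF beta] by metis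
  have int_f: "integrable half (\<lambda>z. min x z * surv (offspring P) z (f z))" if "0 \<le> x" for x
    using f that by (intro integrable_offspring_surv[where B = x]) auto
  have f_le_w: "f x \<le> W (offspring P) l x" if "0 \<le> x" for l x
    using that
  proof (induction l arbitrary: x)
    case 0
    have "(\<integral>z. min x z * surv (offspring P) z (f z) \<partial>half) \<le> (\<integral>z. min x z * dens (offspring P) z \<partial>half)"
    proof (rule integral_mono_half[OF int_f[OF 0]])
      show "integrable half (\<lambda>z. min x z * dens (offspring P) z)"
      proof (rule Bochner_Integration.integrable_bound)
        show "integrable half (\<lambda>z. x * dens (offspring P) z)"
          using integrable_dens[OF offspring_bounds summable_offspring] by simp
        show "AE z in half. norm (min x z * dens (offspring P) z) \<le> norm (x * dens (offspring P) z)"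
          using AE_half by eventually_elim (use 0 in \<open>auto simp: abs_mult intro!: mult_right_mono\<close>)
      qed measurable
      show "min x z * surv (offspring P) z (f z) \<le> min x z * dens (offspring P) z" if "0 \<le> z" for z
        using 0 that f surv_le_dens[OF offspring_bounds f(2)[OF that] f(3)[OF that]] by (intro mult_left_mono) auto
    qed
    with sub[OF 0] show ?case by simp
  next
    case (Suc l)
    have "(\<integral>z. min x z * surv (offspring P) z (f z) \<partial>half) \<le> (\<integral>z. min x z * surv (offspring P) z (W (offspring P) l z) \<partial>half)"
    proof (rule integral_mono_half[OF int_f[OF Suc.prems]])
      show "integrable half (\<lambda>z. min x z * surv (offspring P) z (W (offspring P) l z))"
        using w_bounds Suc.prems by (intro integrable_offspring_surv[where B = x]) auto
      show "min x z * surv (offspring P) z (f z) \<le> min x z * surv (offspring P) z (W (offspring P) l z)" if "0 \<le> z" for z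
        using Suc.prems that surv_mono[OF offspring_bounds f(2)[OF that] Suc.IH[OF that] w_bounds(2)[OF that]]
        by (intro mult_left_mono) auto
    qed
    with sub[OF Suc.prems] show ?case by simp
  qed
  have law: "0 \<le> pmf P k" "pmf P k \<le> 1" for k by (auto simp: pmf_le_1)
  have int_law: "integrable half (\<lambda>z. surv (pmf P) z (y z))"
    if "y \<in> borel_measurable borel" "\<And>z. 0 \<le> z \<Longrightarrow> 0 \<le> y z" "\<And>z. 0 \<le> z \<Longrightarrow> y z \<le> z" for y
    using integrable_surv[OF law summable_law that(1) _ that(2,3), of "\<lambda>_. 1" 1] by simp
  define \<delta> where "\<delta> = (\<integral>z. surv (pmf P) z (f z) \<partial>half)"
  have "\<delta> \<noteq> 0"
  proof
    assume "\<delta> = 0"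
    then have "AE z in half. surv (pmf P) z (f z) = 0"
      unfolding \<delta>_def using f by (intro integral_eq_0_AE_half int_law surv_nonneg[OF law]) auto
    from AE_half_witness[OF this order_refl] obtain z where z: "0 < z" "surv (pmf P) z (f z) = 0" by blast
    obtain k where "0 < pmf P (k + 2)" using ex_branching by blast
    then have "0 < surv (pmf P) z (f z)"
      using z f by (intro surv_pos[OF law, where k = "k + 2"]) auto
    with z show False by simp
  qed
  moreover have "0 \<le> \<delta>"
    unfolding \<delta>_def using f by (intro integral_nonneg_half surv_nonneg[OF law]) auto
  moreover have "\<delta> \<le> (\<integral>z. surv (pmf P) z (W (offspring P) l z) \<partial>half)" for l
    unfolding \<delta>_def using f f_le_w w_bounds
    by (intro integral_mono_half int_law surv_mono[OF law]) auto
  ultimately show ?thesis by (intro exI[of _ \<delta>]) auto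
qed

end

theorem corollary5p24:
  fixes P :: "nat pmf" and M :: "'w measure"
    and n :: "vertex \<Rightarrow> 'w \<Rightarrow> nat" and v \<zeta> :: "vertex \<Rightarrow> 'w \<Rightarrow> real"
  assumes P_support: "pmf P 0 = 0"
    and P_nontrivial: "pmf P 1 < 1"
    and exp_moment: "\<exists>\<theta>>0. integrable (measure_pmf P) (\<lambda>k. exp (\<theta> * real k))"
    and EWT: "erlang_weighted_tree M P n v \<zeta>"
  shows "(beta0 P > 1 \<longrightarrow> extinction_prob M n v \<zeta> < 1) \<and>
         (beta0 P \<le> 1 \<longrightarrow> extinction_prob M n v \<zeta> = 1)"
proof -
  interpret T: erlang_weighted_tree M P n v \<zeta> by (rule EWT)
  interpret light_degree_law P by unfold_locales (fact P_support P_nontrivial exp_moment)+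
  have limit: "(\<lambda>l. 1 - T.survive_prob l) \<longlonglongrightarrow> extinction_prob M n v \<zeta>"
    by (rule T.extinction_limit)
  show ?thesis
  proof (intro conjI impI)
    assume "beta0 P > 1"
    from supercritical[OF this T.W_bounds]
    obtain \<delta> where \<delta>: "0 < \<delta>" "\<And>l. \<delta> \<le> T.survive_prob l"
      unfolding T.survive_prob_def by blast
    then have "extinction_prob M n v \<zeta> \<le> 1 - \<delta>"
      by (intro LIMSEQ_le_const2[OF limit]) auto
    with \<delta> show "extinction_prob M n v \<zeta> < 1" by simp
  next
    assume "beta0 P \<le> 1"
    from subcritical[OF this T.W_bounds T.W_Suc_le] have "T.survive_prob \<longlonglongrightarrow> 0"
      unfolding T.survive_prob_def .
    from LIMSEQ_unique[OF limit tendsto_diff[OF tendsto_const this]]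
    show "extinction_prob M n v \<zeta> = 1" by simp
  qed
qed

end
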